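(* Assume $\theta=2$. Let $v$ be a step function with $N$ jumps as described in the context (with associated $r>0$), and let $A\in\big(0,r\sqrt{2\lambda_1\mathcal{Q}^{-1}}\big)$, where $\mathcal{Q}:=\max_{s\in[-\kappa,\kappa]}Q'(s)$. For each sufficiently small $\varepsilon>0$ let $u^\varepsilon$ be the solution of $$u_t=Q(\varepsilon^2u_x)_x-F'(u)\ \text{ in }(a,b)\times(0,\infty),\qquad u_x(a,t)=u_x(b,t)=0\ (t>0),\qquad u(x,0)=u_0^\varepsilon(x),$$ with $|u^\varepsilon_x(x,t)|\le\kappa\varepsilon^{-2}$ for all $x\in[a,b]$, $t\ge0$, and $u^\varepsilon\in C([0,T],H^2(a,b))\cap C^1([0,T],H^1(a,b))$ for every $T>0$. Assume that $$\lim_{\varepsilon\to0^+}\|u_0^\varepsilon-v\|_{L^1(a,b)}=0$$ and that there exist $C,\varepsilon_0>0$ such that $E_\varepsilon[u_0^\varepsilon]\le Nc_\varepsilon+C\exp(-A/\varepsilon)$ for any $\varepsilon\in(0,\varepsilon_0)$. Then, for any $m>0$, $$\sup_{0\le t\le m\exp(A/\varepsilon)}\|u^\varepsilon(\cdot,t)-v\|_{L^1(a,b)}\longrightarrow0\qquad\text{as }\varepsilon\to0^+.$$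
   Context: Here $a<b$ are real. Assumptions on $Q$: $Q\in C^1(\mathbb{R})$, $Q(-s)=-Q(s)$ for all $s$, $\lim_{s\to\pm\infty}Q(s)=Q(0)=0$, and there is $\kappa>0$ with $Q'(s)>0$ for $s\in(-\kappa,\kappa)$ and $Q'(s)<0$ for $|s|>\kappa$. Assumptions on $F$ (with parameter $\theta$): $F\in C^1(\mathbb{R})$, $F(\pm1)=F'(\pm1)=0$, $F(u)>0$ for all $u\ne\pm1$, and there are constants $0<\lambda_1\le\lambda_2$, $\eta>0$ such that, for each choice of sign, $\lambda_1|1\pm u|^{\theta-2}\le\frac{F'(u)}{u\pm1}\le\lambda_2|1\pm u|^{\theta-2}$ for $|u\pm1|<\eta$ (understood for $u\ne\mp1$, where the quotient is defined). Step function $v$: $N\in\mathbb{N}$, $N\ge1$, and $v:[a,b]\to\{-1,+1\}$ is piecewise constant with exactly $N$ jumps located at $a<h_1<\dots<h_N<b$; $r>0$ is such that the intervals $(h_i-r,h_i+r)$ are pairwise disjoint, $a\le h_1-r$ and $h_N+r\le b$. Notation: $\tilde Q(s):=\int_0^sQ(t)\,dt$, $\ell:=\kappa Q(\kappa)-\tilde Q(\kappa)>0$, $P_\varepsilon(s):=\int_0^s\varepsilon^2z\,Q'(\varepsilon^2z)\,dz$; $J_\varepsilon:[0,\ell\varepsilon^{-2}]\to[0,\kappa\varepsilon^{-2}]$ is the inverse of the increasing bijection $P_\varepsilon:[0,\kappa\varepsilon^{-2}]\to[0,\ell\varepsilon^{-2}]$. Energy: $E_\varepsilon[u]:=\int_a^b\Big[\frac{\tilde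 Q(\varepsilon^2u_x)}{\varepsilon^3}+\frac{F(u)}{\varepsilon}\Big]dx$. Minimal transition energy: $c_\varepsilon:=\varepsilon^{-1}\int_{-1}^{1}Q\big(\varepsilon^2J_\varepsilon(F(s))\big)\,ds$, defined for $0<\varepsilon<\sqrt{\ell/\max_{[-1,1]}F}$. *)

theory Defs
  imports "HOL-Analysis.Analysis"
begin

section \<open>Sobolev spaces on a bounded interval\<close>

definition in_L2 :: "real \<Rightarrow> real \<Rightarrow> (real \<Rightarrow> real) \<Rightarrow> bool" where
  "in_L2 a b f \<longleftrightarrow> f \<in> borel_measurable (lebesgue_on {a<..<b})
     \<and> integrable (lebesgue_on {a<..<b}) (\<lambda>x. (f x)\<^sup>2)"

text \<open>Taking values in the extended reals keeps the norm (and suprema of norms) free of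
  default values: it is infinite for functions that are not integrable.\<close>

definition L1_norm :: "real \<Rightarrow> real \<Rightarrow> (real \<Rightarrow> real) \<Rightarrow> ennreal" where
  "L1_norm a b f = (\<integral>\<^sup>+x. ennreal \<bar>f x\<bar> \<partial>lebesgue_on {a<..<b})"

definition test_function :: "real \<Rightarrow> real \<Rightarrow> (real \<Rightarrow> real) \<Rightarrow> bool" where
  "test_function a b \<phi> \<longleftrightarrow> (\<forall>n x. (deriv ^^ n) \<phi> field_differentiable (at x))
     \<and> (\<exists>c d. a < c \<and> d < b \<and> (\<forall>x. x \<notin> {c..d} \<longrightarrow> \<phi> x = 0))"

definition has_weak_deriv :: "real \<Rightarrow> real \<Rightarrow> (real \<Rightarrow> real) \<Rightarrow> (real \<Rightarrow> real) \<Rightarrow> bool" where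
  "has_weak_deriv a b f g \<longleftrightarrow>
     (\<forall>c d. a < c \<and> d < b \<longrightarrow>
        set_integrable lebesgue {c..d} f \<and> set_integrable lebesgue {c..d} g)
     \<and> (\<forall>\<phi>. test_function a b \<phi> \<longrightarrow>
          (LINT x|lebesgue_on {a<..<b}. f x * deriv \<phi> x)
            = - (LINT x|lebesgue_on {a<..<b}. g x * \<phi> x))"

text \<open>Weak derivatives are unique only up to null sets in \<open>(a, b)\<close>; the choice below is used
  only under integrals and in statements holding almost everywhere.\<close>

definition weak_deriv :: "real \<Rightarrow> real \<Rightarrow> (real \<Rightarrow> real) \<Rightarrow> real \<Rightarrow> real" where
  "weak_deriv a b f = (SOME g. has_weak_deriv a b f g)"

primrec in_H :: "nat \<Rightarrow> real \<Rightarrow> real \<Rightarrow> (real \<Rightarrow> real) \<Rightarrow> bool" where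
  "in_H 0 a b f \<longleftrightarrow> in_L2 a b f"
| "in_H (Suc k) a b f \<longleftrightarrow> in_L2 a b f \<and> (\<exists>g. has_weak_deriv a b f g \<and> in_H k a b g)"

definition H_norm :: "nat \<Rightarrow> real \<Rightarrow> real \<Rightarrow> (real \<Rightarrow> real) \<Rightarrow> real" where
  "H_norm k a b f =
     sqrt (\<Sum>j\<le>k. LINT x|lebesgue_on {a<..<b}. (((weak_deriv a b ^^ j) f) x)\<^sup>2)"

definition C_into_H :: "nat \<Rightarrow> real \<Rightarrow> real \<Rightarrow> real set \<Rightarrow> (real \<Rightarrow> real \<Rightarrow> real) \<Rightarrow> bool" where
  "C_into_H k a b S u \<longleftrightarrow> (\<forall>t\<in>S. in_H k a b (u t)
     \<and> ((\<lambda>s. H_norm k a b (\<lambda>x. u s x - u t x)) \<longlongrightarrow> 0) (at t within S))"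

text \<open>Continuously differentiable maps from \<open>S\<close> into \<open>H\<^sup>k(a, b)\<close>, with time derivative \<open>w\<close>.\<close>

definition C1_into_H ::
  "nat \<Rightarrow> real \<Rightarrow> real \<Rightarrow> real set \<Rightarrow> (real \<Rightarrow> real \<Rightarrow> real) \<Rightarrow> (real \<Rightarrow> real \<Rightarrow> real) \<Rightarrow> bool" where
  "C1_into_H k a b S u w \<longleftrightarrow> C_into_H k a b S u \<and> C_into_H k a b S w
     \<and> (\<forall>t\<in>S. ((\<lambda>s. H_norm k a b (\<lambda>x. (u s x - u t x) / (s - t) - w t x)) \<longlongrightarrow> 0)
           (at t within S))"

definition C1_on_interval :: "real \<Rightarrow> real \<Rightarrow> (real \<Rightarrow> real) \<Rightarrow> (real \<Rightarrow> real) \<Rightarrow> bool" where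
  "C1_on_interval a b f f' \<longleftrightarrow> continuous_on {a..b} f'
     \<and> (\<forall>x\<in>{a..b}. (f has_real_derivative f' x) (at x within {a..b}))"


section \<open>Diffusion flux, potential and step functions\<close>

definition admissible_flux :: "(real \<Rightarrow> real) \<Rightarrow> real \<Rightarrow> bool" where
  "admissible_flux Q \<kappa> \<longleftrightarrow> Q C1_differentiable_on UNIV
     \<and> (\<forall>s. Q (- s) = - Q s)
     \<and> (Q \<longlongrightarrow> 0) at_top \<and> (Q \<longlongrightarrow> 0) at_bot \<and> Q 0 = 0
     \<and> \<kappa> > 0
     \<and> (\<forall>s\<in>{-\<kappa><..<\<kappa>}. deriv Q s > 0)
     \<and> (\<forall>s. \<bar>s\<bar> > \<kappa> \<longrightarrow> deriv Q s < 0)"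

definition admissible_potential ::
  "(real \<Rightarrow> real) \<Rightarrow> real \<Rightarrow> real \<Rightarrow> real \<Rightarrow> real \<Rightarrow> bool" where
  "admissible_potential F \<theta> lam1 lam2 \<eta> \<longleftrightarrow> F C1_differentiable_on UNIV
     \<and> F 1 = 0 \<and> F (-1) = 0 \<and> deriv F 1 = 0 \<and> deriv F (-1) = 0
     \<and> (\<forall>u. u \<noteq> 1 \<and> u \<noteq> -1 \<longrightarrow> F u > 0)
     \<and> 0 < lam1 \<and> lam1 \<le> lam2 \<and> \<eta> > 0
     \<and> (\<forall>\<sigma>\<in>{1, -1}. \<forall>u. 0 < \<bar>u + \<sigma>\<bar> \<and> \<bar>u + \<sigma>\<bar> < \<eta> \<longrightarrow>
          lam1 * \<bar>1 + \<sigma> * u\<bar> powr (\<theta> - 2) \<le> deriv F u / (u + \<sigma>)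
          \<and> deriv F u / (u + \<sigma>) \<le> lam2 * \<bar>1 + \<sigma> * u\<bar> powr (\<theta> - 2))"

text \<open>The values at the jump points themselves are arbitrary in \<open>{-1, 1}\<close>; away from them the
  function is constant on every interval, and the one-sided limits at each jump differ.\<close>

definition step_function ::
  "real \<Rightarrow> real \<Rightarrow> nat \<Rightarrow> (nat \<Rightarrow> real) \<Rightarrow> (real \<Rightarrow> real) \<Rightarrow> bool" where
  "step_function a b N h v \<longleftrightarrow> N \<ge> 1
     \<and> strict_mono_on {1..N} h \<and> a < h 1 \<and> h N < b
     \<and> (\<forall>x\<in>{a..b}. v x \<in> {-1, 1})
     \<and> (\<forall>x\<in>{a..b}. \<forall>y\<in>{a..b}. x \<le> y \<and> {x..y} \<inter> h ` {1..N} = {} \<longrightarrow> v x = v y)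
     \<and> (\<forall>i\<in>{1..N}. \<exists>l l'. l \<noteq> l'
          \<and> (v \<longlongrightarrow> l) (at_left (h i)) \<and> (v \<longlongrightarrow> l') (at_right (h i)))"

definition separation_radius ::
  "real \<Rightarrow> real \<Rightarrow> nat \<Rightarrow> (nat \<Rightarrow> real) \<Rightarrow> real \<Rightarrow> bool" where
  "separation_radius a b N h r \<longleftrightarrow> r > 0
     \<and> disjoint_family_on (\<lambda>i. {h i - r<..<h i + r}) {1..N}
     \<and> a \<le> h 1 - r \<and> h N + r \<le> b"


section \<open>Energy and minimal transition energy\<close>

definition Qtilde :: "(real \<Rightarrow> real) \<Rightarrow> real \<Rightarrow> real" where
  "Qtilde Q s = (LBINT t=0..ereal s. Q t)"

definition energy ::
  "(real \<Rightarrow> real) \<Rightarrow> (real \<Rightarrow> real) \<Rightarrow> real \<Rightarrow> real \<Rightarrow> real \<Rightarrow> (real \<Rightarrow> real) \<Rightarrow> real" where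
  "energy Q F a b \<epsilon> u =
     (LINT x|lebesgue_on {a<..<b}. Qtilde Q (\<epsilon>\<^sup>2 * weak_deriv a b u x) / \<epsilon>^3 + F (u x) / \<epsilon>)"

definition P_fun :: "(real \<Rightarrow> real) \<Rightarrow> real \<Rightarrow> real \<Rightarrow> real" where
  "P_fun Q \<epsilon> s = (LBINT z=0..ereal s. \<epsilon>\<^sup>2 * z * deriv Q (\<epsilon>\<^sup>2 * z))"

text \<open>\<open>J_fun Q \<kappa> \<epsilon>\<close> is meaningful on \<open>[0, \<ell> / \<epsilon>\<^sup>2]\<close> with \<open>\<ell> = \<kappa> * Q \<kappa> - Qtilde Q \<kappa>\<close>, which is the image
  of \<open>[0, \<kappa> / \<epsilon>\<^sup>2]\<close> under \<open>P_fun Q \<epsilon>\<close>. Hence \<open>c_min\<close> is meaningful when \<open>\<epsilon>\<^sup>2 * F \<le> \<ell>\<close> on \<open>[-1, 1]\<close>.\<close>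

definition J_fun :: "(real \<Rightarrow> real) \<Rightarrow> real \<Rightarrow> real \<Rightarrow> real \<Rightarrow> real" where
  "J_fun Q \<kappa> \<epsilon> = inv_into {0..\<kappa> / \<epsilon>\<^sup>2} (P_fun Q \<epsilon>)"

definition c_min :: "(real \<Rightarrow> real) \<Rightarrow> (real \<Rightarrow> real) \<Rightarrow> real \<Rightarrow> real \<Rightarrow> real" where
  "c_min Q F \<kappa> \<epsilon> = (LBINT s=-1..1. Q (\<epsilon>\<^sup>2 * J_fun Q \<kappa> \<epsilon> (F s))) / \<epsilon>"


section \<open>Solutions of the Neumann problem\<close>

text \<open>Here \<open>u t x\<close> is the value at time \<open>t\<close> and position \<open>x\<close>. An element of \<open>H\<^sup>2(a, b)\<close> is identified
  with its continuously differentiable representative on \<open>[a, b]\<close>, so that \<open>ux\<close> is defined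
  pointwise up to the boundary. The equation is an identity in \<open>L\<^sup>2(a, b)\<close> for each \<open>t > 0\<close>.\<close>

definition is_solution ::
  "(real \<Rightarrow> real) \<Rightarrow> (real \<Rightarrow> real) \<Rightarrow> real \<Rightarrow> real \<Rightarrow> real \<Rightarrow> real \<Rightarrow>
   (real \<Rightarrow> real) \<Rightarrow> (real \<Rightarrow> real \<Rightarrow> real) \<Rightarrow> bool" where
  "is_solution Q F \<kappa> a b \<epsilon> u0 u \<longleftrightarrow>
     (\<exists>ux ut.
        (\<forall>T>0. C_into_H 2 a b {0..T} u \<and> C1_into_H 1 a b {0..T} u ut)
        \<and> (\<forall>t\<ge>0. C1_on_interval a b (u t) (ux t))
        \<and> (\<forall>t>0. AE x in lebesgue_on {a<..<b}.
             ut t x = weak_deriv a b (\<lambda>y. Q (\<epsilon>\<^sup>2 * ux t y)) x - deriv F (u t x))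
        \<and> (\<forall>t>0. ux t a = 0 \<and> ux t b = 0)
        \<and> (\<forall>x\<in>{a..b}. u 0 x = u0 x)
        \<and> (\<forall>t\<ge>0. \<forall>x\<in>{a..b}. \<bar>ux t x\<bar> \<le> \<kappa> / \<epsilon>\<^sup>2))"

end

theory Submission imports Defs begin

text \<open>The equation is the gradient flow of the energy, slowed down by the factor \<open>\<epsilon>\<close>: the energy
  decreases at the rate \<open>\<parallel>u\<^sub>t\<parallel>\<^sup>2 / \<epsilon>\<close>, so up to time \<open>T\<close> the solution moves in \<open>L\<^sup>2\<close> by at most the square
  root of \<open>\<epsilon> * T\<close> times the energy that is lost (\<open>energy_dissipation\<close>). A solution therefore moves slowly
  as long as it has little energy to lose, and \<open>exponential_lower_bound\<close> says that this is the case
  near \<open>v\<close>: a profile with slope at most \<open>\<kappa> / \<epsilon>\<^sup>2\<close> that is \<open>L\<^sup>1\<close>-close to \<open>v\<close> has energy at least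
  \<open>N * c_min - C * exp (- A / \<epsilon>)\<close>. The initial energy exceeds \<open>N * c_min\<close> by a multiple of
  \<open>exp (- A / \<epsilon>)\<close> at most, so a solution that is close to \<open>v\<close> at a time \<open>t \<le> m * exp (A / \<epsilon>)\<close> has moved
  by \<open>O(sqrt \<epsilon>)\<close> only. The \<open>L\<^sup>1\<close> distance from the initial datum is continuous in time and hence cannot
  jump from \<open>O(sqrt \<epsilon>)\<close> to a fixed positive size (\<open>no_intermediate_value\<close>).

  The lower bound comes from a calibration. The function \<open>Qtilde\<close> is convex on \<open>[-\<kappa>, \<kappa>]\<close>, and Young's
  inequality bounds \<open>\<epsilon>\<close> times the energy density from below by the derivative of \<open>cost (w x)\<close>, up to
  sign; here \<open>cost\<close> is a primitive whose increment from -1 to 1 is \<open>\<epsilon> * c_min\<close> (\<open>transition_cost\<close>). A profile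
  close to \<open>v\<close> takes values near the two wells -1 and 1 at points close to each jump of \<open>v\<close>, on either
  side, and pays for the transition between these values there. What is missing to \<open>c_min\<close> is the cost of
  reaching the wells themselves. It is paid on the rest of the interval of radius \<open>r\<close> around the jump,
  up to an exponentially small amount (\<open>tail_cost\<close>): for \<open>\<tau> = tanh (\<alpha> * z / \<epsilon>)\<close>, where \<open>z\<close> is the distance
  from the far end of such a tail, the derivative of \<open>\<tau> * \<bar>cost (w x) - cost \<sigma>\<bar>\<close> is still bounded by \<open>\<epsilon>\<close>
  times the energy density, and \<open>1 - \<tau>\<close> is exponentially small where the tail begins. This asks for
  \<open>\<bar>cost s - cost \<sigma>\<bar>\<close> to be dominated by \<open>F s\<close> near the well \<open>\<sigma>\<close>, with a good constant. As \<open>F'\<close> is only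
  pinched between two linear functions, that bound is an integrated one (\<open>primitive_bound\<close>); its constant
  is larger than the one for a quadratic \<open>F\<close> by the factor \<open>sqrt (3 / 2)\<close>, which is less than the
  margin \<open>sqrt 2\<close> that the condition on \<open>A\<close> leaves.

  Weak derivatives are defined by test functions. The energy identity needs their uniqueness, absolutely
  continuous representatives, the chain rule for \<open>Q (\<epsilon>\<^sup>2 * u\<^sub>x)\<close> and integration by parts, which are
  obtained from explicit smooth bump functions and from a chain rule for indefinite integrals.\<close>

section \<open>Calculus on the line\<close>

lemma DERIV_imp_continuous_on:
  fixes f :: "real \<Rightarrow> real"
  assumes "\<And>x. (f has_real_derivative f' x) (at x)"
  shows "continuous_on S f"
  using assms by (meson DERIV_isCont continuous_at_imp_continuous_on)

lemma C1_differentiable_on_UNIV_D: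
  fixes f :: "real \<Rightarrow> real"
  assumes "f C1_differentiable_on UNIV"
  shows "(f has_real_derivative deriv f x) (at x)" "continuous_on UNIV (deriv f)"
proof -
  obtain D where D: "\<And>x. (f has_real_derivative D x) (at x)" "continuous_on UNIV D"
    using assms by (auto simp: C1_differentiable_on_def has_real_derivative_iff_has_vector_derivative)
  then have "deriv f = D" by (auto intro!: ext DERIV_imp_deriv)
  then show "(f has_real_derivative deriv f x) (at x)" "continuous_on UNIV (deriv f)" using D by simp_all
qed

lemma increment_mono:
  fixes f g :: "real \<Rightarrow> real"
  assumes "s \<le> t"
    and "\<And>x. s \<le> x \<Longrightarrow> x \<le> t \<Longrightarrow> (f has_real_derivative f' x) (at x)"
    and "\<And>x. s \<le> x \<Longrightarrow> x \<le> t \<Longrightarrow> (g has_real_derivative g' x) (at x)"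
    and "\<And>x. s \<le> x \<Longrightarrow> x \<le> t \<Longrightarrow> f' x \<le> g' x"
  shows "f t - f s \<le> g t - g s"
proof -
  have "g s - f s \<le> g t - f t"
  proof (rule DERIV_nonneg_imp_nondecreasing[where f = "\<lambda>x. g x - f x", OF assms(1)])
    fix x assume x: "s \<le> x" "x \<le> t"
    show "\<exists>y. ((\<lambda>x. g x - f x) has_real_derivative y) (at x) \<and> 0 \<le> y"
      using DERIV_diff[OF assms(3)[OF x] assms(2)[OF x]] assms(4)[OF x]
      by (intro exI[of _ "g' x - f' x"]) auto
  qed
  then show ?thesis by simp
qed

lemma mean_value_between:
  fixes \<phi> \<phi>' :: "real \<Rightarrow> real"
  assumes "\<And>s. (\<phi> has_real_derivative \<phi>' s) (at s)"
  obtains \<xi> where "\<phi> y - \<phi> x = \<phi>' \<xi> * (y - x)" "min x y \<le> \<xi>" "\<xi> \<le> max x y"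
proof (cases x y rule: linorder_cases)
  case less
  from MVT2[OF this, of \<phi> \<phi>'] assms obtain \<xi> where "x < \<xi>" "\<xi> < y" "\<phi> y - \<phi> x = (y - x) * \<phi>' \<xi>" by auto
  then show thesis by (intro that[of \<xi>]) (auto simp: mult.commute)
next
  case greater
  from MVT2[OF this, of \<phi> \<phi>'] assms obtain \<xi> where "y < \<xi>" "\<xi> < x" "\<phi> x - \<phi> y = (x - y) * \<phi>' \<xi>" by auto
  then show thesis by (intro that[of \<xi>]) (auto simp: algebra_simps)
qed (use that[of x] in auto)

lemma C1_on_interval_subset:
  assumes "C1_on_interval a b f f'" "a \<le> c" "d \<le> b"
  shows "C1_on_interval c d f f'"
  unfolding C1_on_interval_def
proof (intro conjI ballI)
  show "continuous_on {c..d} f'"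
    using assms by (auto simp: C1_on_interval_def intro: continuous_on_subset)
  fix x assume x: "x \<in> {c..d}"
  show "(f has_real_derivative f' x) (at x within {c..d})"
  proof (rule DERIV_subset)
    show "(f has_real_derivative f' x) (at x within {a..b})"
      using assms x by (auto simp: C1_on_interval_def)
  qed (use assms in auto)
qed

lemma C1_on_interval_diff:
  assumes "C1_on_interval a b f f'" "C1_on_interval a b g g'"
  shows "C1_on_interval a b (\<lambda>x. f x - g x) (\<lambda>x. f' x - g' x)"
  unfolding C1_on_interval_def
proof (intro conjI ballI)
  show "continuous_on {a..b} (\<lambda>x. f' x - g' x)"
    using assms unfolding C1_on_interval_def by (intro continuous_on_diff) blast+
  fix x assume "x \<in> {a..b}"
  then show "((\<lambda>x. f x - g x) has_real_derivative f' x - g' x) (at x within {a..b})"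
    using assms unfolding C1_on_interval_def by (intro DERIV_diff) blast+
qed


section \<open>Smooth bump functions\<close>

text \<open>In the variable \<open>y = 1 / x\<close> this is the flatness at the origin of all derivatives of
  \<open>exp (- \<mu> / x)\<close>.\<close>

lemma tendsto_poly_exp_neg_at_top:
  fixes p :: "real poly"
  assumes "0 < \<mu>"
  shows "((\<lambda>y. poly p y * exp (- \<mu> * y)) \<longlongrightarrow> 0) at_top"
proof -
  have e: "((\<lambda>y::real. y ^ k * exp (- \<mu> * y)) \<longlongrightarrow> 0) at_top" for k
  proof -
    have "((\<lambda>y::real. (\<mu> * y) ^ k / exp (\<mu> * y)) \<longlongrightarrow> 0) at_top"
      by (rule filterlim_compose[OF tendsto_power_div_exp_0])
         (simp add: assms filterlim_tendsto_pos_mult_at_top[OF tendsto_const] filterlim_ident)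
    then have "((\<lambda>y::real. inverse (\<mu> ^ k) * ((\<mu> * y) ^ k / exp (\<mu> * y))) \<longlongrightarrow> inverse (\<mu> ^ k) * 0) at_top"
      by (rule tendsto_mult_left)
    then show ?thesis using assms by (simp add: power_mult_distrib field_simps exp_minus)
  qed
  have "((\<lambda>y. \<Sum>i\<le>degree p. coeff p i * (y ^ i * exp (- \<mu> * y))) \<longlongrightarrow> (\<Sum>i\<le>degree p. coeff p i * 0)) at_top"
    by (intro tendsto_intros e)
  then show ?thesis by (simp add: poly_altdef sum_distrib_right mult.assoc)
qed

text \<open>The functions that arise from \<open>exp (- \<mu> / x)\<close> by differentiation; the family is closed under
  derivatives, which is why a polynomial in \<open>1 / x\<close> is carried along.\<close>

definition flat :: "real \<Rightarrow> real poly \<Rightarrow> real \<Rightarrow> real" where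
  "flat \<mu> p x = (if 0 < x then poly p (1 / x) * exp (- \<mu> / x) else 0)"

lemma flat_has_derivative:
  assumes "0 < \<mu>"
  shows "(flat \<mu> p has_real_derivative flat \<mu> (monom 1 2 * (smult \<mu> p - pderiv p)) x) (at x)"
proof (cases x "0::real" rule: linorder_cases)
  case greater
  have "((\<lambda>x. poly p (1 / x) * exp (- \<mu> / x)) has_real_derivative
           flat \<mu> (monom 1 2 * (smult \<mu> p - pderiv p)) x) (at x)"
    using greater
    by (auto intro!: derivative_eq_intros simp: flat_def poly_monom field_simps power2_eq_square)
  moreover have "\<forall>\<^sub>F y in nhds x. flat \<mu> p y = poly p (1 / y) * exp (- \<mu> / y)"
    using eventually_nhds_in_open[of "{0<..}" x] greater
    by (auto simp: flat_def elim!: eventually_mono)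
  ultimately show ?thesis by (subst DERIV_cong_ev[OF refl _ refl])
next
  case less
  have "\<forall>\<^sub>F y in nhds x. flat \<mu> p y = 0"
    using eventually_nhds_in_open[of "{..<0}" x] less
    by (auto simp: flat_def elim!: eventually_mono)
  then show ?thesis using less by (subst DERIV_cong_ev[OF refl _ refl]) (auto simp: flat_def)
next
  case equal
  have "((\<lambda>h. poly (monom 1 1 * p) (inverse h) * exp (- \<mu> * inverse h)) \<longlongrightarrow> 0) (at_right 0)"
    by (rule filterlim_compose[OF tendsto_poly_exp_neg_at_top[OF assms] filterlim_inverse_at_top_right])
  then have "((\<lambda>h. flat \<mu> p h / h) \<longlongrightarrow> 0) (at_right 0)"
    by (rule Lim_transform_eventually)
       (auto simp: eventually_at_right_less flat_def poly_monom field_simps intro: eventually_at_right_less[THEN eventually_mono])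
  moreover have "((\<lambda>h. flat \<mu> p h / h) \<longlongrightarrow> 0) (at_left 0)"
    by (rule Lim_transform_eventually[OF tendsto_const])
       (auto simp: flat_def eventually_at_left_field intro: exI[of _ "-1"])
  ultimately have "((\<lambda>h. flat \<mu> p h / h) \<longlongrightarrow> 0) (at 0)"
    by (simp add: filterlim_split_at)
  then show ?thesis using equal by (simp add: DERIV_def flat_def)
qed

text \<open>A class of functions that contains the bumps below and is closed under differentiation, so that
  every member is smooth. Derivatives of products are taken care of by closing it under sums.\<close>

inductive smooth_family :: "(real \<Rightarrow> real) \<Rightarrow> bool" where
  right: "0 < \<mu> \<Longrightarrow> smooth_family (\<lambda>x. flat \<mu> p (x - c))"
| left: "0 < \<mu> \<Longrightarrow> smooth_family (\<lambda>x. flat \<mu> p (c - x))"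
| add: "smooth_family f \<Longrightarrow> smooth_family g \<Longrightarrow> smooth_family (\<lambda>x. f x + g x)"
| mult: "smooth_family f \<Longrightarrow> smooth_family g \<Longrightarrow> smooth_family (\<lambda>x. f x * g x)"
| cmult: "smooth_family f \<Longrightarrow> smooth_family (\<lambda>x. k * f x)"

lemma smooth_family_deriv:
  "smooth_family f \<Longrightarrow> \<exists>f'. smooth_family f' \<and> (\<forall>x. (f has_real_derivative f' x) (at x))"
proof (induction rule: smooth_family.induct)
  case (right \<mu> p c)
  have "((\<lambda>x. flat \<mu> p (x - c)) has_real_derivative flat \<mu> (monom 1 2 * (smult \<mu> p - pderiv p)) (x - c)) (at x)" for x
    using DERIV_shift[of "flat \<mu> p" _ x "-c"] flat_has_derivative[OF right, of p "x - c"] by simp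
  then show ?case using smooth_family.right[OF right] by blast
next
  case (left \<mu> p c)
  have "((\<lambda>x. flat \<mu> p (c - x)) has_real_derivative (-1) * flat \<mu> (monom 1 2 * (smult \<mu> p - pderiv p)) (c - x)) (at x)" for x
  proof -
    have "((\<lambda>x. c - x) has_real_derivative -1) (at x)" by (auto intro!: derivative_eq_intros)
    from DERIV_chain2[where g = "\<lambda>x. c - x", OF flat_has_derivative[OF left, of p "c - x"] this]
    show ?thesis by (simp add: mult.commute)
  qed
  then show ?case using smooth_family.cmult[OF smooth_family.left[OF left], of "-1"] by blast
next
  case (add f g)
  then obtain f' g' where "smooth_family f'" "smooth_family g'"
    "\<And>x. (f has_real_derivative f' x) (at x)" "\<And>x. (g has_real_derivative g' x) (at x)" by blast
  then show ?case by (intro exI[of _ "\<lambda>x. f' x + g' x"]) (auto intro!: smooth_family.intros derivative_eq_intros)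
next
  case (mult f g)
  then obtain f' g' where "smooth_family f'" "smooth_family g'"
    "\<And>x. (f has_real_derivative f' x) (at x)" "\<And>x. (g has_real_derivative g' x) (at x)" by blast
  then show ?case using mult
    by (intro exI[of _ "\<lambda>x. f' x * g x + f x * g' x"]) (auto intro!: smooth_family.intros derivative_eq_intros)
next
  case (cmult f k)
  then obtain f' where "smooth_family f'" "\<And>x. (f has_real_derivative f' x) (at x)" by blast
  then show ?case by (intro exI[of _ "\<lambda>x. k * f' x"]) (auto intro!: smooth_family.intros derivative_eq_intros)
qed

lemma smooth_family_iterated_deriv:
  "smooth_family f \<Longrightarrow> (deriv ^^ n) f field_differentiable (at x) \<and> smooth_family ((deriv ^^ n) f)"
proof (induction n)
  case 0
  then show ?case using smooth_family_deriv[of f] by (auto simp: field_differentiable_def)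
next
  case (Suc n)
  then obtain f' where f': "smooth_family f'" "\<And>x. ((deriv ^^ n) f has_real_derivative f' x) (at x)"
    using smooth_family_deriv by blast
  then have "(deriv ^^ Suc n) f = f'" by (auto intro!: ext DERIV_imp_deriv)
  then show ?case using f' smooth_family_deriv[of f'] by (auto simp: field_differentiable_def)
qed

text \<open>As the rate in the exponential tends to 0 the bumps increase to the indicator function of
  \<open>{c<..<d}\<close>.\<close>

definition bump :: "nat \<Rightarrow> real \<Rightarrow> real \<Rightarrow> real \<Rightarrow> real" where
  "bump k c d x = flat (1 / Suc k) 1 (x - c) * flat (1 / Suc k) 1 (d - x)"

lemma smooth_family_bump: "smooth_family (bump k c d)"
  unfolding bump_def by (intro smooth_family.intros) auto

lemma bump_bounds: "0 \<le> bump k c d x" "bump k c d x \<le> 1"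
  unfolding bump_def flat_def by (auto intro!: mult_le_one simp: divide_le_0_iff)

lemma bump_support: "x \<notin> {c<..<d} \<Longrightarrow> bump k c d x = 0"
  by (auto simp: bump_def flat_def)

lemma bump_pos: "x \<in> {c<..<d} \<Longrightarrow> 0 < bump k c d x"
  by (auto simp: bump_def flat_def)

lemma bump_tendsto_indicator: "(\<lambda>k. bump k c d x) \<longlonglongrightarrow> indicator {c<..<d} x"
proof (cases "x \<in> {c<..<d}")
  case True
  have "(\<lambda>k. exp (- (1 / Suc k) / (x - c)) * exp (- (1 / Suc k) / (d - x)))
      \<longlonglongrightarrow> exp (- 0 / (x - c)) * exp (- 0 / (d - x))"
    using True by (intro tendsto_intros LIMSEQ_Suc[OF lim_1_over_n]) auto
  then show ?thesis using True by (simp add: bump_def flat_def)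
qed (simp add: bump_support)

lemma continuous_on_bump: "continuous_on S (bump k c d)"
  using smooth_family_deriv[OF smooth_family_bump, of k c d] DERIV_imp_continuous_on by metis

lemma test_function_bump:
  assumes "a < c" "d < b"
  shows "test_function a b (bump k c d)"
  unfolding test_function_def
  using smooth_family_iterated_deriv[OF smooth_family_bump] bump_support assms
  by (intro conjI allI exI[of _ c] exI[of _ d]) auto


section \<open>Absolutely continuous functions\<close>

abbreviation Leb :: "real \<Rightarrow> real \<Rightarrow> real measure" where
  "Leb a b \<equiv> lebesgue_on {a<..<b}"

text \<open>Absolute continuity on \<open>[a, b]\<close>, expressed by the fundamental theorem of calculus: \<open>f\<close> is an
  indefinite Lebesgue integral of \<open>f'\<close>.\<close>

definition abs_cont :: "real \<Rightarrow> real \<Rightarrow> (real \<Rightarrow> real) \<Rightarrow> (real \<Rightarrow> real) \<Rightarrow> bool" where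
  "abs_cont a b f f' \<longleftrightarrow> f' absolutely_integrable_on {a..b}
     \<and> (\<forall>x y. a \<le> x \<and> x \<le> y \<and> y \<le> b \<longrightarrow> f y - f x = integral {x..y} f')"

lemma abs_contD:
  assumes "abs_cont a b f f'"
  shows "f' absolutely_integrable_on {a..b}"
    "\<And>x y. a \<le> x \<Longrightarrow> x \<le> y \<Longrightarrow> y \<le> b \<Longrightarrow> f y - f x = integral {x..y} f'"
  using assms by (auto simp: abs_cont_def)

lemma abs_cont_C1:
  assumes "C1_on_interval a b f f'"
  shows "abs_cont a b f f'"
  unfolding abs_cont_def
proof (intro conjI allI impI)
  show "f' absolutely_integrable_on {a..b}"
    using assms by (intro absolutely_integrable_continuous_real) (simp add: C1_on_interval_def)
  fix x y assume xy: "a \<le> x \<and> x \<le> y \<and> y \<le> b"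
  have "(f' has_integral (f y - f x)) {x..y}"
  proof (intro fundamental_theorem_of_calculus)
    fix s assume "s \<in> {x..y}"
    then have "(f has_real_derivative f' s) (at s within {x..y})"
      using assms xy by (auto simp: C1_on_interval_def intro: DERIV_subset[where s = "{a..b}"])
    then show "(f has_vector_derivative f' s) (at s within {x..y})"
      by (simp add: has_real_derivative_iff_has_vector_derivative)
  qed (use xy in simp)
  then show "f y - f x = integral {x..y} f'" by (simp add: integral_unique)
qed

lemma abs_cont_indefinite_integral:
  assumes "f' absolutely_integrable_on {a..b}"
  shows "abs_cont a b (\<lambda>x. c + integral {a..x} f') f'"
  unfolding abs_cont_def
proof (intro conjI allI impI assms)
  fix x y assume xy: "a \<le> x \<and> x \<le> y \<and> y \<le> b"
  have "f' integrable_on {a..y}"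
    using assms xy by (meson absolutely_integrable_on_def integrable_subinterval_real atLeastatMost_subset_iff order_refl)
  from Henstock_Kurzweil_Integration.integral_combine[OF _ _ this, of x] xy
  show "c + integral {a..y} f' - (c + integral {a..x} f') = integral {x..y} f'" by simp
qed

lemma abs_cont_continuous:
  assumes "abs_cont a b f f'"
  shows "continuous_on {a..b} f"
proof -
  have "continuous_on {a..b} (\<lambda>x. f a + integral {a..x} f')"
    using assms by (intro continuous_intros indefinite_integral_continuous_1)
      (auto simp: abs_cont_def absolutely_integrable_on_def)
  moreover have "f a + integral {a..x} f' = f x" if "x \<in> {a..b}" for x
    using abs_contD(2)[OF assms, of a x] that by simp
  ultimately show ?thesis by (rule continuous_on_eq)
qed

lemma abs_cont_add:
  assumes "abs_cont a b f f'" "abs_cont a b g g'"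
  shows "abs_cont a b (\<lambda>x. f x + g x) (\<lambda>x. f' x + g' x)"
  unfolding abs_cont_def
proof (intro conjI allI impI)
  show "(\<lambda>x. f' x + g' x) absolutely_integrable_on {a..b}"
    using assms by (auto simp: abs_cont_def intro: set_integral_add)
  fix x y assume xy: "a \<le> x \<and> x \<le> y \<and> y \<le> b"
  have "f' integrable_on {x..y}" "g' integrable_on {x..y}"
    using assms xy unfolding abs_cont_def absolutely_integrable_on_def
    by (meson integrable_subinterval_real atLeastatMost_subset_iff)+
  then show "f y + g y - (f x + g x) = integral {x..y} (\<lambda>x. f' x + g' x)"
    using abs_contD(2)[OF assms(1), of x y] abs_contD(2)[OF assms(2), of x y] xy
    by (simp add: Henstock_Kurzweil_Integration.integral_add)
qed

lemma abs_cont_cmult: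
  assumes "abs_cont a b f f'"
  shows "abs_cont a b (\<lambda>x. k * f x) (\<lambda>x. k * f' x)"
  unfolding abs_cont_def
proof (intro conjI allI impI)
  show "(\<lambda>x. k * f' x) absolutely_integrable_on {a..b}"
    using abs_contD(1)[OF assms] by (rule set_integrable_mult_right)
  fix x y assume xy: "a \<le> x \<and> x \<le> y \<and> y \<le> b"
  then show "k * f y - k * f x = integral {x..y} (\<lambda>x. k * f' x)"
    using abs_contD(2)[OF assms, of x y] by (simp flip: right_diff_distrib)
qed

text \<open>Cutting \<open>[a, b]\<close> into pieces shorter than \<open>\<delta>\<close> and adding up. It is used to show that an interval
  function vanishes once it is of smaller order than an additive one.\<close>

lemma locally_dominated_increment:
  fixes d m :: "real \<Rightarrow> real"
  assumes "0 < \<delta>" and "a \<le> b"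
    and loc: "\<And>x y. a \<le> x \<Longrightarrow> x \<le> y \<Longrightarrow> y \<le> b \<Longrightarrow> y - x < \<delta> \<Longrightarrow> \<bar>d y - d x\<bar> \<le> m y - m x"
  shows "\<bar>d b - d a\<bar> \<le> m b - m a"
proof -
  have "\<bar>d y - d a\<bar> \<le> m y - m a" if "a \<le> y" "y \<le> b" "y - a \<le> real n * (\<delta> / 2)" for n y
    using that
  proof (induction n arbitrary: y)
    case 0
    then show ?case using \<open>a \<le> b\<close> by simp
  next
    case (Suc n)
    define x where "x = max a (y - \<delta> / 2)"
    have "\<bar>d x - d a\<bar> \<le> m x - m a"
      using Suc.prems \<open>0 < \<delta>\<close> by (intro Suc.IH) (auto simp: x_def algebra_simps max_def)
    moreover have "\<bar>d y - d x\<bar> \<le> m y - m x"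
      using Suc.prems \<open>0 < \<delta>\<close> by (intro loc) (auto simp: x_def)
    ultimately show ?case by linarith
  qed
  moreover obtain n where "b - a \<le> real n * (\<delta> / 2)"
    using reals_Archimedean3[of "\<delta> / 2"] \<open>0 < \<delta>\<close> that by (meson half_gt_zero less_imp_le)
  ultimately show ?thesis using \<open>a \<le> b\<close> by blast
qed

text \<open>By the mean value theorem and the intermediate value
  theorem the increment of \<open>\<phi> \<circ> f\<close> over \<open>[x, y]\<close> is \<open>\<phi>' (f z)\<close> times that of \<open>f\<close>, with \<open>z\<close> in \<open>[x, y]\<close>. By
  uniform continuity of \<open>\<phi>' \<circ> f\<close> its difference from the integral of \<open>\<phi>' (f s) * f' s\<close> is at most \<open>\<eta>\<close>
  times the integral of \<open>\<bar>f'\<bar>\<close> on short intervals, hence on all of them.\<close>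

lemma abs_cont_compose:
  fixes \<phi> \<phi>' :: "real \<Rightarrow> real"
  assumes f: "abs_cont a b f f'"
    and \<phi>: "\<And>s. (\<phi> has_real_derivative \<phi>' s) (at s)" and \<phi>': "continuous_on UNIV \<phi>'"
  shows "abs_cont a b (\<lambda>x. \<phi> (f x)) (\<lambda>x. \<phi>' (f x) * f' x)"
proof -
  have cf: "continuous_on {a..b} f" by (rule abs_cont_continuous[OF f])
  have c: "continuous_on {a..b} (\<lambda>x. \<phi>' (f x))"
    using continuous_on_compose[OF cf, of \<phi>'] \<phi>' continuous_on_subset by (auto simp: o_def)
  have ai: "(\<lambda>x. \<phi>' (f x) * f' x) absolutely_integrable_on {a..b}"
  proof (rule absolutely_integrable_bounded_measurable_product_real)
    show "(\<lambda>x. \<phi>' (f x)) \<in> borel_measurable (lebesgue_on {a..b})"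
      using c by (rule continuous_imp_measurable_on_sets_lebesgue) auto
    show "bounded ((\<lambda>x. \<phi>' (f x)) ` {a..b})"
      by (intro compact_imp_bounded compact_continuous_image c) auto
  qed (use f in \<open>auto simp: abs_cont_def\<close>)
  have sub: "g absolutely_integrable_on {x..y}" if "g absolutely_integrable_on {a..b}" "a \<le> x" "y \<le> b"
    for g :: "real \<Rightarrow> real" and x y
    using that absolutely_integrable_on_subinterval by fastforce
  have "\<phi> (f y0) - \<phi> (f x0) = integral {x0..y0} (\<lambda>x. \<phi>' (f x) * f' x)"
    if xy0: "a \<le> x0" "x0 \<le> y0" "y0 \<le> b" for x0 y0
  proof -
    define d where "d = (\<lambda>x. \<phi> (f x) - integral {x0..x} (\<lambda>x. \<phi>' (f x) * f' x))"
    define V where "V = integral {x0..y0} (\<lambda>x. \<bar>f' x\<bar>)"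
    have key: "\<bar>d y0 - d x0\<bar> \<le> \<eta> * V" if "0 < \<eta>" for \<eta>
    proof -
      have "uniformly_continuous_on {a..b} (\<lambda>x. \<phi>' (f x))"
        by (rule compact_uniformly_continuous[OF c]) simp
      then obtain \<delta> where \<delta>: "0 < \<delta>"
        "\<And>x y. x \<in> {a..b} \<Longrightarrow> y \<in> {a..b} \<Longrightarrow> dist y x < \<delta> \<Longrightarrow> dist (\<phi>' (f y)) (\<phi>' (f x)) < \<eta>"
        using \<open>0 < \<eta>\<close> unfolding uniformly_continuous_on_def by meson
      define m where "m = (\<lambda>x. \<eta> * integral {x0..x} (\<lambda>x. \<bar>f' x\<bar>))"
      have "\<bar>d y0 - d x0\<bar> \<le> m y0 - m x0"
      proof (rule locally_dominated_increment[OF \<open>0 < \<delta>\<close> xy0(2)])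
        fix x y assume xy: "x0 \<le> x" "x \<le> y" "y \<le> y0" "y - x < \<delta>"
        have abxy: "a \<le> x" "y \<le> b" using xy xy0 by auto
        have ai': "(\<lambda>x. \<phi>' (f x) * f' x) absolutely_integrable_on {u..v}"
          "f' absolutely_integrable_on {u..v}" "(\<lambda>x. \<bar>f' x\<bar>) integrable_on {u..v}" if "a \<le> u" "v \<le> b" for u v
          using sub[OF ai that] sub[OF abs_contD(1)[OF f] that] by (auto simp: absolutely_integrable_on_def)
        obtain z where z: "x \<le> z" "z \<le> y" "\<phi> (f y) - \<phi> (f x) = \<phi>' (f z) * (f y - f x)"
        proof -
          have cxy: "continuous_on {x..y} f" using cf abxy by (auto intro: continuous_on_subset)
          have conn: "{min (f x) (f y)..max (f x) (f y)} \<subseteq> f ` {x..y}"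
            using connected_continuous_image[OF cxy] xy
            by (intro connected_contains_Icc) (auto simp: min_def max_def)
          obtain \<xi> where "\<phi> (f y) - \<phi> (f x) = \<phi>' \<xi> * (f y - f x)" "\<xi> \<in> {min (f x) (f y)..max (f x) (f y)}"
            using mean_value_between[OF \<phi>, of "f y" "f x"] by auto
          with conn that show ?thesis by fastforce
        qed
        have i1: "integral {x0..y} g = integral {x0..x} g + integral {x..y} g"
          if "g integrable_on {x0..y}" for g :: "real \<Rightarrow> real"
          using Henstock_Kurzweil_Integration.integral_combine[OF _ _ that, of x] xy by auto
        have "d y - d x = \<phi>' (f z) * (f y - f x) - integral {x..y} (\<lambda>s. \<phi>' (f s) * f' s)"
          unfolding d_def using z i1[of "\<lambda>x. \<phi>' (f x) * f' x"] ai'(1)[of x0 y] xy xy0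
          by (simp add: absolutely_integrable_on_def)
        also have "f y - f x = integral {x..y} f'"
          using abs_contD(2)[OF f] xy abxy by auto
        also have "\<phi>' (f z) * integral {x..y} f' - integral {x..y} (\<lambda>s. \<phi>' (f s) * f' s)
            = integral {x..y} (\<lambda>s. (\<phi>' (f z) - \<phi>' (f s)) * f' s)"
          using ai'[OF abxy] unfolding absolutely_integrable_on_def left_diff_distrib
          by (subst Henstock_Kurzweil_Integration.integral_diff) (auto intro: integrable_on_mult_right)
        finally have dd: "d y - d x = integral {x..y} (\<lambda>s. (\<phi>' (f z) - \<phi>' (f s)) * f' s)" .
        have "norm (integral {x..y} (\<lambda>s. (\<phi>' (f z) - \<phi>' (f s)) * f' s)) \<le> integral {x..y} (\<lambda>s. \<eta> * \<bar>f' s\<bar>)"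
        proof (rule integral_norm_bound_integral)
          show "(\<lambda>s. (\<phi>' (f z) - \<phi>' (f s)) * f' s) integrable_on {x..y}"
            using ai'[OF abxy] unfolding absolutely_integrable_on_def left_diff_distrib
            by (intro integrable_diff) (auto intro: integrable_on_mult_right)
          show "(\<lambda>s. \<eta> * \<bar>f' s\<bar>) integrable_on {x..y}"
            using ai'(3)[OF abxy] by (rule integrable_on_mult_right)
          fix s assume s: "s \<in> {x..y}"
          have "dist (\<phi>' (f z)) (\<phi>' (f s)) < \<eta>"
            using s z(1,2) xy abxy by (intro \<delta>(2)) (auto simp: dist_real_def)
          then show "norm ((\<phi>' (f z) - \<phi>' (f s)) * f' s) \<le> \<eta> * \<bar>f' s\<bar>"
            by (auto simp: dist_real_def abs_mult intro!: mult_right_mono)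
        qed
        also have "\<dots> = m y - m x"
          unfolding m_def using i1[of "\<lambda>x. \<bar>f' x\<bar>"] ai'(3)[of x0 y] xy xy0 by (simp add: distrib_left)
        finally show "\<bar>d y - d x\<bar> \<le> m y - m x" using dd by simp
      qed
      then show ?thesis by (simp add: m_def V_def)
    qed
    have "\<bar>d y0 - d x0\<bar> \<le> 0"
    proof (rule field_le_epsilon)
      fix e :: real assume "0 < e"
      have V: "0 \<le> V" unfolding V_def by (rule Henstock_Kurzweil_Integration.integral_nonneg)
        (use sub[OF abs_contD(1)[OF f] xy0(1,3)] in \<open>auto simp: absolutely_integrable_on_def\<close>)
      have "\<bar>d y0 - d x0\<bar> \<le> e / (V + 1) * V" using V \<open>0 < e\<close> by (intro key) auto
      also have "\<dots> \<le> e" using V \<open>0 < e\<close> by (simp add: field_simps)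
      finally show "\<bar>d y0 - d x0\<bar> \<le> 0 + e" by simp
    qed
    then show ?thesis by (simp add: d_def)
  qed
  with ai show ?thesis by (auto simp: abs_cont_def)
qed

text \<open>Polarisation reduces the product rule to the chain rule for the square.\<close>

lemma abs_cont_mult:
  assumes "abs_cont a b f f'" "abs_cont a b g g'"
  shows "abs_cont a b (\<lambda>x. f x * g x) (\<lambda>x. f' x * g x + f x * g' x)"
proof -
  have sq: "abs_cont a b (\<lambda>x. (h x)\<^sup>2) (\<lambda>x. 2 * h x * h' x)" if "abs_cont a b h h'" for h h'
    by (rule abs_cont_compose[OF that, of "\<lambda>s. s\<^sup>2" "\<lambda>s. 2 * s"])
       (auto intro!: derivative_eq_intros continuous_intros)
  have "abs_cont a b (\<lambda>x. 1/2 * ((f x + g x)\<^sup>2 + (-1) * ((f x)\<^sup>2 + (g x)\<^sup>2)))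
     (\<lambda>x. 1/2 * (2 * (f x + g x) * (f' x + g' x) + (-1) * (2 * f x * f' x + 2 * g x * g' x)))"
    by (intro abs_cont_cmult abs_cont_add sq assms)
  then show ?thesis by (simp add: power2_eq_square algebra_simps)
qed


section \<open>Weak derivatives on an interval\<close>

definition loc_integrable :: "real \<Rightarrow> real \<Rightarrow> (real \<Rightarrow> real) \<Rightarrow> bool" where
  "loc_integrable a b f \<longleftrightarrow> (\<forall>c d. a < c \<and> d < b \<longrightarrow> f absolutely_integrable_on {c..d})"

lemma absolutely_integrable_imp_loc_integrable:
  "f absolutely_integrable_on {a..b} \<Longrightarrow> loc_integrable a b f"
  unfolding loc_integrable_def by (auto intro: absolutely_integrable_on_subinterval)

lemma loc_integrable_diff:
  "loc_integrable a b f \<Longrightarrow> loc_integrable a b g \<Longrightarrow> loc_integrable a b (\<lambda>x. f x - g x)"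
  unfolding loc_integrable_def by (auto intro: set_integral_diff)

lemma loc_integrable_const: "loc_integrable a b (\<lambda>x. k)"
  unfolding loc_integrable_def by (auto intro: absolutely_integrable_continuous_real)

lemma eventually_in_inner_interval:
  fixes a b x :: real
  assumes "x \<in> {a<..<b}"
  shows "\<forall>\<^sub>F n in sequentially. x \<in> {a + 1 / Suc n..b - 1 / Suc n}"
proof -
  have "\<forall>\<^sub>F n in sequentially. 1 / Suc n < min (x - a) (b - x)"
    using assms by (intro order_tendstoD(2)[OF LIMSEQ_Suc[OF lim_1_over_n]]) auto
  then show ?thesis by eventually_elim auto
qed

lemma loc_integrable_measurable:
  assumes "loc_integrable a b f"
  shows "f \<in> borel_measurable (Leb a b)"
proof (rule borel_measurable_LIMSEQ_real)
  show "(\<lambda>x. if x \<in> {a + 1 / Suc n..b - 1 / Suc n} then f x else 0) \<in> borel_measurable (Leb a b)" for n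
  proof (subst borel_measurable_if_lebesgue_on)
    have "0 < 1 / real (Suc n)" by simp
    then have "a < a + 1 / Suc n" "b - 1 / Suc n < b" by linarith+
    then show "{a + 1 / Suc n..b - 1 / Suc n} \<subseteq> {a<..<b}"
      by (metis (no_types, lifting) atLeastAtMost_iff greaterThanLessThan_iff order.strict_trans1 order.strict_trans2 subsetI)
    show "f \<in> borel_measurable (lebesgue_on {a + 1 / Suc n..b - 1 / Suc n})"
      using assms \<open>a < a + 1 / Suc n\<close> \<open>b - 1 / Suc n < b\<close>
      by (intro absolutely_integrable_imp_borel_measurable) (auto simp: loc_integrable_def)
  qed auto
next
  fix x assume "x \<in> space (Leb a b)"
  then have "\<forall>\<^sub>F n in sequentially. x \<in> {a + 1 / Suc n..b - 1 / Suc n}"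
    using eventually_in_inner_interval[of x a b] by simp
  then have "\<forall>\<^sub>F n in sequentially. f x = (if x \<in> {a + 1 / Suc n..b - 1 / Suc n} then f x else 0)"
    by (rule eventually_mono) simp
  then show "(\<lambda>n. if x \<in> {a + 1 / Suc n..b - 1 / Suc n} then f x else 0) \<longlonglongrightarrow> f x"
    by (rule Lim_transform_eventually[OF tendsto_const])
qed

lemma integrable_Leb_iff:
  fixes f :: "real \<Rightarrow> real"
  shows "integrable (Leb a b) f \<longleftrightarrow> f absolutely_integrable_on {a..b}"
proof -
  have "integrable (Leb a b) f \<longleftrightarrow> f absolutely_integrable_on {a<..<b}"
    unfolding set_integrable_def by (rule integrable_restrict_space) simp
  then show ?thesis by (simp add: absolutely_integrable_on_Icc_iff_Ioo)
qed

lemma LINT_Leb: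
  fixes f :: "real \<Rightarrow> real"
  assumes "f absolutely_integrable_on {a..b}"
  shows "(LINT x|Leb a b. f x) = integral {a..b} f"
proof -
  have "(LINT x|Leb a b. f x) = integral {a<..<b} f"
  proof (rule integral_unique[symmetric], rule has_integral_integral_lebesgue_on)
    show "integrable (Leb a b) f" using assms by (simp add: integrable_Leb_iff)
  qed simp
  then show ?thesis by (simp add: integral_open_interval_real)
qed

lemma integrable_Leb_compact_support:
  assumes f: "loc_integrable a b f" and \<phi>: "\<phi> \<in> borel_measurable (lebesgue_on {c..d})" "bounded (\<phi> ` {c..d})"
    and cd: "a < c" "d < b" and supp: "\<And>x. x \<notin> {c..d} \<Longrightarrow> \<phi> x = 0"
  shows "integrable (Leb a b) (\<lambda>x. f x * \<phi> x)" "(LINT x|Leb a b. f x * \<phi> x) = integral {c..d} (\<lambda>x. f x * \<phi> x)"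
proof -
  have *: "(\<lambda>x. \<phi> x * f x) absolutely_integrable_on {c..d}"
    using f cd by (intro absolutely_integrable_bounded_measurable_product_real[OF \<phi>(1) _ \<phi>(2)])
      (auto simp: loc_integrable_def)
  have sub: "{c..d} \<subseteq> {a..b}" using cd by auto
  have neg: "negligible {x \<in> {c..d} - {a..b}. g x \<noteq> 0}" "negligible {x \<in> {a..b} - {c..d}. g x * \<phi> x \<noteq> 0}"
    "negligible {x \<in> {a..b} - {c..d}. \<phi> x * g x \<noteq> 0}" for g :: "real \<Rightarrow> real"
    using sub supp by (auto intro!: negligible_subset[OF negligible_empty])
  have "(\<lambda>x. \<phi> x * f x) absolutely_integrable_on {a..b}"
    by (rule absolutely_integrable_spike_set[OF * neg(1) neg(3)])
  then have i: "(\<lambda>x. f x * \<phi> x) absolutely_integrable_on {a..b}" by (simp add: mult.commute)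
  then show "integrable (Leb a b) (\<lambda>x. f x * \<phi> x)" by (simp add: integrable_Leb_iff)
  have "integral {a..b} (\<lambda>x. f x * \<phi> x) = integral {c..d} (\<lambda>x. f x * \<phi> x)"
    by (rule integral_spike_set[OF neg(2) neg(1)])
  then show "(LINT x|Leb a b. f x * \<phi> x) = integral {c..d} (\<lambda>x. f x * \<phi> x)"
    by (simp add: LINT_Leb[OF i])
qed

text \<open>By Lebesgue differentiation, on each compact subinterval.\<close>

lemma AE_zero_if_integrals_zero:
  assumes f: "loc_integrable a b f"
    and z: "\<And>c d. a < c \<Longrightarrow> c < d \<Longrightarrow> d < b \<Longrightarrow> integral {c..d} f = 0"
  shows "AE x in Leb a b. f x = 0"
proof -
  have "\<exists>N. negligible N \<and> (\<forall>x\<in>{c<..<d} - N. f x = 0)" if cd: "a < c" "d < b" for c d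
  proof -
    define g where "g = (\<lambda>x. if x \<in> {c..d} then f x else 0)"
    have "f integrable_on {c..d}" using f cd by (auto simp: loc_integrable_def absolutely_integrable_on_def)
    then have "g integrable_on UNIV" unfolding g_def by (simp only: integrable_restrict_UNIV)
    then have "g integrable_on cbox s t" for s t
      by (rule integrable_on_subcbox) auto
    then obtain N where N: "negligible N" and lim: "\<And>x e. \<lbrakk>x \<notin> N; 0 < e\<rbrakk> \<Longrightarrow>
        \<exists>\<delta>>0. \<forall>h. 0 < h \<and> h < \<delta> \<longrightarrow> norm (integral (cbox x (x + h *\<^sub>R One)) g /\<^sub>R h ^ DIM(real) - g x) < e"
      by (rule integrable_ccontinuous_explicit) blast
    have "f x = 0" if x: "x \<in> {c<..<d} - N" for x
    proof (rule ccontr)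
      assume "f x \<noteq> 0"
      then obtain \<delta> where \<delta>: "\<delta> > 0" "\<And>h. 0 < h \<Longrightarrow> h < \<delta> \<Longrightarrow> \<bar>integral {x..x+h} g / h - g x\<bar> < \<bar>f x\<bar>"
        using lim[of x "\<bar>f x\<bar>"] x by (auto simp: divide_inverse mult.commute)
      define h where "h = min (\<delta> / 2) (d - x)"
      have h: "0 < h" "h < \<delta>" "x + h \<le> d" using \<delta>(1) x by (auto simp: h_def)
      have "integral {x..x+h} g = integral {x..x+h} f"
        using x h by (intro Henstock_Kurzweil_Integration.integral_cong) (auto simp: g_def)
      also have "\<dots> = 0" using x h cd by (intro z) auto
      finally show False using \<delta>(2)[OF h(1,2)] x by (auto simp: g_def)
    qed
    then show ?thesis using N by blast
  qed
  then have "\<forall>n. \<exists>N. negligible N \<and> (\<forall>x\<in>{a + 1 / Suc n<..<b - 1 / Suc n} - N. f x = 0)"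
    by simp
  then obtain N where N: "\<And>n. negligible (N n)" "\<And>n x. x \<in> {a + 1 / Suc n<..<b - 1 / Suc n} - N n \<Longrightarrow> f x = 0"
    by metis
  have "negligible (\<Union>n. N n)" using N(1) by (intro negligible_countable_Union) auto
  moreover have "f x = 0" if x: "x \<in> {a<..<b}" "x \<notin> (\<Union>n. N n)" for x
  proof -
    obtain y z where yz: "a < y" "y < x" "x < z" "z < b" using x by (meson dense greaterThanLessThan_iff)
    have "\<forall>\<^sub>F n in sequentially. y \<in> {a + 1 / Suc n..b - 1 / Suc n} \<and> z \<in> {a + 1 / Suc n..b - 1 / Suc n}"
      using yz by (intro eventually_conj eventually_in_inner_interval) auto
    from eventually_happens'[OF sequentially_bot this]
    obtain n where n: "y \<in> {a + 1 / Suc n..b - 1 / Suc n}" "z \<in> {a + 1 / Suc n..b - 1 / Suc n}"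
      by blast
    then have "x \<in> {a + 1 / Suc n<..<b - 1 / Suc n}" using yz by (simp del: of_nat_Suc)
    then show ?thesis using N(2)[of x n] x(2) by blast
  qed
  ultimately have "AE x in lebesgue. x \<in> {a<..<b} \<longrightarrow> f x = 0"
    by (intro AE_I'[of "\<Union>n. N n"]) (auto simp: negligible_iff_null_sets)
  then show ?thesis by (simp add: AE_restrict_space_iff)
qed

text \<open>Dominated convergence along the bumps on \<open>{c<..<d}\<close> shows that the integral of \<open>f\<close> over that interval
  vanishes.\<close>

theorem fundamental_lemma:
  assumes f: "loc_integrable a b f"
    and z: "\<And>k c d. a < c \<Longrightarrow> c < d \<Longrightarrow> d < b \<Longrightarrow> (LINT x|Leb a b. f x * bump k c d x) = 0"
  shows "AE x in Leb a b. f x = 0"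
proof (rule AE_zero_if_integrals_zero[OF f])
  fix c d assume cd: "a < c" "c < d" "d < b"
  have ind: "integrable (Leb a b) (\<lambda>x. f x * indicator {c..d} x)"
    using cd by (intro integrable_Leb_compact_support(1)[OF f, of _ c d])
      (auto intro!: borel_measurable_indicator boundedI[of _ 1])
  have "(\<lambda>k. LINT x|Leb a b. f x * bump k c d x) \<longlonglongrightarrow> (LINT x|Leb a b. f x * indicator {c<..<d} x)"
  proof (rule integral_dominated_convergence)
    show "integrable (Leb a b) (\<lambda>x. \<bar>f x * indicator {c..d} x\<bar>)" using ind by (rule integrable_abs)
    show "(\<lambda>x. f x * indicator {c<..<d} x) \<in> borel_measurable (Leb a b)"
      by (intro borel_measurable_times loc_integrable_measurable[OF f] borel_measurable_indicator)
         (use cd in \<open>auto simp: sets_restrict_space_iff\<close>)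
    show "(\<lambda>x. f x * bump k c d x) \<in> borel_measurable (Leb a b)" for k
      by (intro borel_measurable_times loc_integrable_measurable[OF f]
          continuous_imp_measurable_on_sets_lebesgue[OF continuous_on_bump]) simp
    show "AE x in Leb a b. (\<lambda>k. f x * bump k c d x) \<longlonglongrightarrow> f x * indicator {c<..<d} x"
      by (intro AE_I2 tendsto_intros bump_tendsto_indicator)
    show "AE x in Leb a b. norm (f x * bump k c d x) \<le> \<bar>f x * indicator {c..d} x\<bar>" for k
      using bump_bounds[of k c d] bump_support[of _ c d k]
      by (intro AE_I2) (auto simp: abs_mult indicator_def intro!: mult_left_le)
  qed
  then have "(\<lambda>k. 0) \<longlonglongrightarrow> (LINT x|Leb a b. f x * indicator {c<..<d} x)"
    by (simp only: z[OF cd])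
  then have "(LINT x|Leb a b. f x * indicator {c<..<d} x) = 0"
    by (rule LIMSEQ_unique[OF _ tendsto_const])
  moreover have "(LINT x|Leb a b. f x * indicator {c<..<d} x) = integral {c..d} (\<lambda>x. f x * indicator {c<..<d} x)"
    using cd by (intro integrable_Leb_compact_support(2)[OF f, of _ c d] borel_measurable_indicator boundedI[of _ 1])
      (auto simp: sets_restrict_space_iff indicator_def)
  moreover have "\<dots> = integral {c..d} f"
    by (rule integral_spike[of "{c, d}"]) (auto simp: indicator_def)
  ultimately show "integral {c..d} f = 0" by simp
qed

lemma test_functionE:
  assumes "test_function a b \<phi>"
  obtains c d where "a < c" "d < b" "\<And>x. x \<notin> {c..d} \<Longrightarrow> \<phi> x = 0" "\<And>x. x \<notin> {c..d} \<Longrightarrow> deriv \<phi> x = 0"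
    "\<And>x. (\<phi> has_real_derivative deriv \<phi> x) (at x)"
    "\<And>S. continuous_on S \<phi>" "\<And>S. continuous_on S (deriv \<phi>)"
proof -
  obtain c d where cd: "a < c" "d < b" "\<And>x. x \<notin> {c..d} \<Longrightarrow> \<phi> x = 0"
    using assms by (auto simp: test_function_def)
  have 0: "(\<phi> has_real_derivative deriv \<phi> x) (at x)" for x
    using assms[unfolded test_function_def, THEN conjunct1, rule_format, of 0 x]
    by (simp add: DERIV_deriv_iff_field_differentiable)
  have 1: "(deriv \<phi> has_real_derivative deriv (deriv \<phi>) x) (at x)" for x
    using assms[unfolded test_function_def, THEN conjunct1, rule_format, of 1 x]
    by (simp add: DERIV_deriv_iff_field_differentiable)
  have "deriv \<phi> x = 0" if "x \<notin> {c..d}" for x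
  proof -
    have "\<forall>\<^sub>F y in nhds x. \<phi> y = 0"
    proof (rule eventually_mono)
      show "\<forall>\<^sub>F y in nhds x. y \<in> - {c..d}"
        using that by (intro eventually_nhds_in_open) (auto intro: open_Compl)
    qed (use cd(3) in blast)
    then have "(\<phi> has_real_derivative 0) (at x)" by (subst DERIV_cong_ev[OF refl _ refl]) auto
    then show ?thesis by (rule DERIV_imp_deriv)
  qed
  moreover have "continuous_on S \<phi>" "continuous_on S (deriv \<phi>)" for S
    using 0 1 by (auto intro: DERIV_isCont continuous_at_imp_continuous_on)
  ultimately show thesis using that cd 0 by blast
qed

lemma integrable_test:
  assumes "loc_integrable a b f" "test_function a b \<phi>"
  shows "integrable (Leb a b) (\<lambda>x. f x * \<phi> x)" "integrable (Leb a b) (\<lambda>x. f x * deriv \<phi> x)"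
proof -
  obtain c d where cd: "a < c" "d < b" "\<And>x. x \<notin> {c..d} \<Longrightarrow> \<phi> x = 0" "\<And>x. x \<notin> {c..d} \<Longrightarrow> deriv \<phi> x = 0"
    "\<And>S. continuous_on S \<phi>" "\<And>S. continuous_on S (deriv \<phi>)"
    using test_functionE[OF assms(2)] by metis
  show "integrable (Leb a b) (\<lambda>x. f x * \<phi> x)" "integrable (Leb a b) (\<lambda>x. f x * deriv \<phi> x)"
    by (rule integrable_Leb_compact_support(1)[OF assms(1) _ _ cd(1,2)];
        auto intro!: cd continuous_imp_measurable_on_sets_lebesgue compact_imp_bounded compact_continuous_image)+
qed

lemma has_weak_deriv_iff:
  "has_weak_deriv a b f g \<longleftrightarrow> loc_integrable a b f \<and> loc_integrable a b g
     \<and> (\<forall>\<phi>. test_function a b \<phi> \<longrightarrow>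
          (LINT x|Leb a b. f x * deriv \<phi> x) = - (LINT x|Leb a b. g x * \<phi> x))"
  unfolding has_weak_deriv_def loc_integrable_def by blast

lemma has_weak_deriv_diff:
  assumes f: "has_weak_deriv a b f f'" and g: "has_weak_deriv a b g g'"
  shows "has_weak_deriv a b (\<lambda>x. f x - g x) (\<lambda>x. f' x - g' x)"
  using assms unfolding has_weak_deriv_iff
  by (auto simp: loc_integrable_diff left_diff_distrib integrable_test)

lemma has_weak_deriv_cmult:
  assumes "has_weak_deriv a b f f'"
  shows "has_weak_deriv a b (\<lambda>x. k * f x) (\<lambda>x. k * f' x)"
  using assms unfolding has_weak_deriv_iff
  by (auto simp: loc_integrable_def mult.assoc)

lemma weak_deriv_unique:
  assumes f: "has_weak_deriv a b f g" "has_weak_deriv a b f g'"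
  shows "AE x in Leb a b. g x = g' x"
proof -
  have "AE x in Leb a b. g x - g' x = 0"
  proof (rule fundamental_lemma)
    show "loc_integrable a b (\<lambda>x. g x - g' x)" using f by (auto simp: has_weak_deriv_iff loc_integrable_diff)
    fix k :: nat and c d assume "a < c" "c < d" "d < b"
    then have "test_function a b (bump k c d)" by (simp add: test_function_bump)
    then show "(LINT x|Leb a b. (g x - g' x) * bump k c d x) = 0"
      using f by (simp add: has_weak_deriv_iff left_diff_distrib integrable_test)
  qed
  then show ?thesis by simp
qed

lemma weak_deriv_AE:
  assumes "has_weak_deriv a b f g"
  shows "AE x in Leb a b. weak_deriv a b f x = g x"
  using weak_deriv_unique[OF _ assms] someI[of "has_weak_deriv a b f", OF assms] by (simp add: weak_deriv_def)

lemma weak_deriv_measurable: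
  assumes "has_weak_deriv a b f g"
  shows "weak_deriv a b f \<in> borel_measurable (Leb a b)"
proof -
  have "has_weak_deriv a b f (weak_deriv a b f)"
    unfolding weak_deriv_def by (rule someI[where P = "has_weak_deriv a b f", OF assms])
  then show ?thesis by (simp add: has_weak_deriv_iff loc_integrable_measurable)
qed

lemma has_weak_deriv_cong_AE:
  assumes f: "has_weak_deriv a b f g" and h: "loc_integrable a b h" and eq: "AE x in Leb a b. f x = h x"
  shows "has_weak_deriv a b h g"
proof -
  have "(LINT x|Leb a b. h x * deriv \<phi> x) = (LINT x|Leb a b. f x * deriv \<phi> x)"
    if "test_function a b \<phi>" for \<phi>
    using f h eq that
    by (intro integral_cong_AE) (auto simp: has_weak_deriv_iff intro: borel_measurable_integrable integrable_test)
  then show ?thesis using f h by (auto simp: has_weak_deriv_iff)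
qed

theorem abs_cont_has_weak_deriv:
  assumes f: "abs_cont a b f f'"
  shows "has_weak_deriv a b f f'"
  unfolding has_weak_deriv_iff
proof (intro conjI allI impI)
  show lf: "loc_integrable a b f"
    using abs_cont_continuous[OF f] by (intro absolutely_integrable_imp_loc_integrable absolutely_integrable_continuous_real)
  show lf': "loc_integrable a b f'"
    using f by (intro absolutely_integrable_imp_loc_integrable) (simp add: abs_cont_def)
  fix \<phi> assume t: "test_function a b \<phi>"
  obtain c d where cd: "a < c" "d < b" "\<And>x. x \<notin> {c..d} \<Longrightarrow> \<phi> x = 0"
    "\<And>x. (\<phi> has_real_derivative deriv \<phi> x) (at x)" "\<And>S. continuous_on S (deriv \<phi>)"
    using test_functionE[OF t] by metis
  show "(LINT x|Leb a b. f x * deriv \<phi> x) = - (LINT x|Leb a b. f' x * \<phi> x)"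
  proof (cases "a \<le> b")
    case True
    have "abs_cont a b \<phi> (deriv \<phi>)"
      using cd by (intro abs_cont_C1) (auto simp: C1_on_interval_def intro: has_field_derivative_at_within)
    from abs_cont_mult[OF f this] have ac: "abs_cont a b (\<lambda>x. f x * \<phi> x) (\<lambda>x. f' x * \<phi> x + f x * deriv \<phi> x)" .
    have "(LINT x|Leb a b. f' x * \<phi> x + f x * deriv \<phi> x) = integral {a..b} (\<lambda>x. f' x * \<phi> x + f x * deriv \<phi> x)"
      by (rule LINT_Leb[OF abs_contD(1)[OF ac]])
    also have "\<dots> = 0"
      using abs_contD(2)[OF ac, of a b] True cd by auto
    finally show ?thesis
      using integrable_test[OF lf t] integrable_test[OF lf' t] by simp
  next
    case False
    then have "{a<..<b} = {}" by auto
    then show ?thesis by (simp add: Bochner_Integration.integral_empty)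
  qed
qed

text \<open>A test function with zero mean is the derivative of a test function: the indefinite integral
  vanishes on both sides of the support.\<close>

lemma test_function_antiderivative:
  assumes \<psi>: "smooth_family \<psi>" and cd: "a < c" "c \<le> d" "d < b"
    and supp: "\<And>x. x \<notin> {c..d} \<Longrightarrow> \<psi> x = 0" and mean: "integral {a..b} \<psi> = 0"
  obtains \<phi> where "test_function a b \<phi>" "deriv \<phi> = \<psi>"
proof
  define \<phi> where "\<phi> = (\<lambda>x. integral {a..x} \<psi>)"
  have cont: "continuous_on S \<psi>" for S
    using smooth_family_deriv[OF \<psi>] by (metis DERIV_isCont continuous_at_imp_continuous_on)
  have zero_left: "\<phi> x = 0" if "x < c" for x
    unfolding \<phi>_def using that supp by (intro integral_eq_0_iff[THEN iffD2] integral_unique has_integral_is_0) auto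
  have zero_right: "\<phi> x = 0" if "d < x" for x
  proof -
    have split: "integral {a..y} \<psi> = integral {a..d} \<psi>" if "d < y" for y
    proof -
      have "integral {a..d} \<psi> + integral {d..y} \<psi> = integral {a..y} \<psi>"
        using cd that by (intro Henstock_Kurzweil_Integration.integral_combine integrable_continuous_real cont) auto
      moreover have "integral {d..y} \<psi> = integral {d..y} (\<lambda>x. 0)"
        by (rule integral_spike[of "{d}"]) (auto simp: supp)
      ultimately show ?thesis by simp
    qed
    from split[OF that] split[OF cd(3)] mean show ?thesis by (simp add: \<phi>_def)
  qed
  have der: "(\<phi> has_real_derivative \<psi> x) (at x)" for x
  proof (cases "x < c")
    case True
    have "\<forall>\<^sub>F y in nhds x. y \<in> {..<c}" using True by (intro eventually_nhds_in_open) auto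
    then have "\<forall>\<^sub>F y in nhds x. \<phi> y = 0" by eventually_elim (simp add: zero_left)
    then have "(\<phi> has_real_derivative 0) (at x)" by (subst DERIV_cong_ev[OF refl _ refl]) auto
    then show ?thesis using supp[of x] True by simp
  next
    case False
    have "(\<phi> has_real_derivative \<psi> x) (at x within {a..x+1})"
      unfolding \<phi>_def using False cd by (intro integral_has_real_derivative cont) auto
    moreover have "at x within {a..x+1} = at x" using False cd by (intro at_within_interior) auto
    ultimately show ?thesis by simp
  qed
  show d: "deriv \<phi> = \<psi>" using der by (auto intro!: ext DERIV_imp_deriv)
  have "(deriv ^^ n) \<phi> field_differentiable at x" for n x
  proof (cases n)
    case 0
    then show ?thesis using der by (auto simp: field_differentiable_def)
  next
    case (Suc m)
    then show ?thesis
      using smooth_family_iterated_deriv[OF \<psi>, of m x] by (simp add: funpow_Suc_right d del: funpow.simps)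
  qed
  then show "test_function a b \<phi>"
    unfolding test_function_def using zero_left zero_right cd
    by (intro conjI allI exI[of _ c] exI[of _ d]) auto
qed

text \<open>Subtract from a bump \<open>\<rho>\<close> the multiple of a fixed bump \<open>\<beta>\<close> with the same integral. The difference has a
  test function as its primitive, so \<open>f\<close> integrates to 0 against it, and the integral of \<open>f * \<rho>\<close> is a
  fixed constant times the integral of \<open>\<rho>\<close>.\<close>

lemma weak_deriv_zero_imp_const:
  assumes "a < b" and f: "has_weak_deriv a b f (\<lambda>x. 0)"
  obtains C where "AE x in Leb a b. f x = C"
proof -
  define c0 d0 where "c0 = (2 * a + b) / 3" and "d0 = (a + 2 * b) / 3"
  have cd0: "a < c0" "c0 < d0" "d0 < b" using \<open>a < b\<close> by (auto simp: c0_def d0_def)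
  define \<beta> where "\<beta> = bump 0 c0 d0"
  define I where "I = integral {a..b} \<beta>"
  have cb: "continuous_on S \<beta>" for S unfolding \<beta>_def by (rule continuous_on_bump)
  have "I \<noteq> 0"
  proof
    assume "I = 0"
    then have "\<forall>x\<in>{a..b}. \<beta> x = 0"
      unfolding I_def using \<open>a < b\<close> integral_eq_0_iff[OF cb, of a b] bump_bounds(1) by (auto simp: \<beta>_def)
    moreover have "0 < \<beta> ((c0 + d0) / 2)" unfolding \<beta>_def using cd0 by (intro bump_pos) auto
    ultimately show False using cd0 by auto
  qed
  have lf: "loc_integrable a b f" using f by (simp add: has_weak_deriv_iff)
  define C where "C = (LINT x|Leb a b. f x * \<beta> x) / I"
  have "AE x in Leb a b. f x - C = 0"
  proof (rule fundamental_lemma)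
    show "loc_integrable a b (\<lambda>x. f x - C)" using lf by (intro loc_integrable_diff loc_integrable_const)
    fix k c d assume cd: "a < c" "c < d" "d < b"
    define \<rho> where "\<rho> = bump k c d"
    define K where "K = integral {a..b} \<rho> / I"
    have cx: "continuous_on S \<rho>" for S unfolding \<rho>_def by (rule continuous_on_bump)
    obtain \<phi> where \<phi>: "test_function a b \<phi>" "deriv \<phi> = (\<lambda>x. \<rho> x + (- K) * \<beta> x)"
    proof (rule test_function_antiderivative)
      show "smooth_family (\<lambda>x. \<rho> x + (- K) * \<beta> x)"
        unfolding \<rho>_def \<beta>_def by (intro smooth_family.intros smooth_family_bump)
      show "a < min c c0" "min c c0 \<le> max d d0" "max d d0 < b" using cd cd0 by auto
      show "\<rho> x + - K * \<beta> x = 0" if "x \<notin> {min c c0..max d d0}" for x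
      proof -
        have "x \<notin> {c<..<d}" "x \<notin> {c0<..<d0}" using that by auto
        then show ?thesis by (simp add: \<rho>_def \<beta>_def bump_support)
      qed
      have "integral {a..b} (\<lambda>x. \<rho> x + - K * \<beta> x) = integral {a..b} \<rho> + integral {a..b} (\<lambda>x. - K * \<beta> x)"
        by (intro Henstock_Kurzweil_Integration.integral_add integrable_continuous_real continuous_intros cx cb)
      also have "\<dots> = 0" using \<open>I \<noteq> 0\<close> by (simp add: K_def I_def[symmetric])
      finally show "integral {a..b} (\<lambda>x. \<rho> x + - K * \<beta> x) = 0" .
    qed
    have t: "test_function a b \<rho>" "test_function a b \<beta>" unfolding \<rho>_def \<beta>_def using cd cd0 by (auto intro: test_function_bump)
    have "0 = (LINT x|Leb a b. f x * (\<rho> x + (- K) * \<beta> x))"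
    proof -
      have "(LINT x|Leb a b. f x * deriv \<phi> x) = 0"
        using f \<phi>(1) by (simp add: has_weak_deriv_iff)
      then show ?thesis by (simp add: \<phi>(2))
    qed
    also have "\<dots> = (LINT x|Leb a b. f x * \<rho> x - K * (f x * \<beta> x))"
      by (simp add: algebra_simps)
    also have "\<dots> = (LINT x|Leb a b. f x * \<rho> x) - K * (LINT x|Leb a b. f x * \<beta> x)"
      using integrable_test(1)[OF lf t(1)] integrable_test(1)[OF lf t(2)] by simp
    also have "K * (LINT x|Leb a b. f x * \<beta> x) = C * integral {a..b} \<rho>"
      by (simp add: K_def C_def)
    also have "integral {a..b} \<rho> = (LINT x|Leb a b. \<rho> x)"
      by (intro LINT_Leb[symmetric] absolutely_integrable_continuous_real cx)
    finally have "(LINT x|Leb a b. f x * \<rho> x) = C * (LINT x|Leb a b. \<rho> x)" by simp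
    moreover have "integrable (Leb a b) \<rho>"
      by (simp add: integrable_Leb_iff absolutely_integrable_continuous_real cx)
    ultimately show "(LINT x|Leb a b. (f x - C) * bump k c d x) = 0"
      using integrable_test(1)[OF lf t(1)] by (simp add: left_diff_distrib \<rho>_def)
  qed
  then show thesis using that[of C] by simp
qed

text \<open>The difference between \<open>f\<close> and the indefinite integral of \<open>g\<close> has weak derivative 0.\<close>

theorem weak_deriv_abs_cont_representative:
  assumes "a < b" and f: "has_weak_deriv a b f g" and g: "g absolutely_integrable_on {a..b}"
  obtains U where "abs_cont a b U g" "AE x in Leb a b. f x = U x"
proof -
  have W: "abs_cont a b (\<lambda>x. c + integral {a..x} g) g" for c
    by (rule abs_cont_indefinite_integral[OF g])
  have "has_weak_deriv a b (\<lambda>x. f x - (0 + integral {a..x} g)) (\<lambda>x. g x - g x)"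
    by (intro has_weak_deriv_diff f abs_cont_has_weak_deriv W)
  then obtain C where C: "AE x in Leb a b. f x - (0 + integral {a..x} g) = C"
    using weak_deriv_zero_imp_const[OF \<open>a < b\<close>] by auto
  have "AE x in Leb a b. f x = C + integral {a..x} g" using C by eventually_elim simp
  then show thesis by (rule that[OF W])
qed


section \<open>The flux and its Legendre transform\<close>

text \<open>\<open>Qtilde g\<close> is the primitive of \<open>g\<close> that vanishes at 0; it is used for functions other than the flux
  as well.\<close>

lemma Qtilde_has_derivative:
  assumes "continuous_on UNIV g"
  shows "(Qtilde g has_real_derivative g s) (at s)"
proof -
  define m where "m = \<bar>s\<bar> + 1"
  have "((\<lambda>u. LBINT y=ereal 0..ereal u. g y) has_vector_derivative g s) (at s within {-m..m})"
    by (rule interval_integral_FTC2) (auto simp: m_def intro: continuous_on_subset[OF assms])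
  moreover have "at s within {-m..m} = at s" by (rule at_within_interior) (auto simp: m_def)
  ultimately show ?thesis
    by (simp add: Qtilde_def[abs_def] has_real_derivative_iff_has_vector_derivative zero_ereal_def)
qed

lemma Qtilde_0 [simp]: "Qtilde g 0 = 0"
  by (simp add: Qtilde_def zero_ereal_def)

text \<open>The convex conjugate of \<open>Qtilde Q\<close> at the point \<open>Q s\<close>, written in terms of \<open>s\<close>. It is a primitive of
  \<open>s * deriv Q s\<close> and thus, up to scaling, the function \<open>P_fun\<close>.\<close>

definition legendre :: "(real \<Rightarrow> real) \<Rightarrow> real \<Rightarrow> real" where
  "legendre Q s = s * Q s - Qtilde Q s"

locale flux =
  fixes Q :: "real \<Rightarrow> real" and \<kappa> :: real
  assumes flux: "admissible_flux Q \<kappa>"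
begin

lemma kappa_pos: "0 < \<kappa>" using flux by (simp add: admissible_flux_def)

lemma Q_deriv: "(Q has_real_derivative deriv Q s) (at s)" and cont_deriv_Q: "continuous_on UNIV (deriv Q)"
  using flux C1_differentiable_on_UNIV_D[of Q] by (auto simp: admissible_flux_def)

lemma cont_Q: "continuous_on S Q"
  by (rule DERIV_imp_continuous_on[OF Q_deriv])

lemma Q_odd: "Q (- s) = - Q s" and Q_0 [simp]: "Q 0 = 0"
  using flux by (simp_all add: admissible_flux_def)

lemma Q_deriv_pos: "- \<kappa> < s \<Longrightarrow> s < \<kappa> \<Longrightarrow> 0 < deriv Q s"
  using flux by (simp add: admissible_flux_def)

lemma Q_strict_mono: "\<lbrakk>- \<kappa> \<le> s; s < t; t \<le> \<kappa>\<rbrakk> \<Longrightarrow> Q s < Q t"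
  by (rule DERIV_pos_imp_increasing_open)
     (use Q_deriv Q_deriv_pos cont_Q in \<open>auto intro!: exI[of _ "deriv Q _"]\<close>)

lemma Q_mono: "\<lbrakk>- \<kappa> \<le> s; s \<le> t; t \<le> \<kappa>\<rbrakk> \<Longrightarrow> Q s \<le> Q t"
  using Q_strict_mono[of s t] by (cases "s = t") auto

lemma Q_nonneg: "\<lbrakk>0 \<le> s; s \<le> \<kappa>\<rbrakk> \<Longrightarrow> 0 \<le> Q s"
  using Q_mono[of 0 s] kappa_pos by simp

lemma Qt_deriv: "(Qtilde Q has_real_derivative Q s) (at s)"
  by (rule Qtilde_has_derivative[OF cont_Q])

lemma cont_Qt: "continuous_on S (Qtilde Q)"
  by (rule DERIV_imp_continuous_on[OF Qt_deriv])

lemma Qtilde_even: "Qtilde Q (- s) = Qtilde Q s"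
proof -
  have "((\<lambda>s. Qtilde Q (- s) - Qtilde Q s) has_real_derivative 0) (at s)" for s
  proof -
    have "((\<lambda>s. Qtilde Q (- s)) has_real_derivative Q (- s) * (- 1)) (at s)"
      by (rule DERIV_chain2[OF Qt_deriv]) (auto intro!: derivative_eq_intros)
    from DERIV_diff[OF this Qt_deriv[of s]] show ?thesis by (simp add: Q_odd)
  qed
  then have "Qtilde Q (- s) - Qtilde Q s = Qtilde Q (- 0) - Qtilde Q 0"
    by (intro DERIV_isconst_all) auto
  then show ?thesis by simp
qed

lemma legendre_deriv: "(legendre Q has_real_derivative s * deriv Q s) (at s)"
  unfolding legendre_def[abs_def] by (auto intro!: derivative_eq_intros Qt_deriv Q_deriv)

lemma legendre_0 [simp]: "legendre Q 0 = 0" by (simp add: legendre_def)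

lemma cont_legendre: "continuous_on S (legendre Q)"
  by (rule DERIV_imp_continuous_on[OF legendre_deriv])

lemma legendre_strict_mono: "\<lbrakk>0 \<le> s; s < t; t \<le> \<kappa>\<rbrakk> \<Longrightarrow> legendre Q s < legendre Q t"
  using legendre_deriv Q_deriv_pos cont_legendre
  by (intro DERIV_pos_imp_increasing_open[of s t "legendre Q"]) (auto intro!: exI[of _ "_ * deriv Q _"])

lemma legendre_mono: "\<lbrakk>0 \<le> s; s \<le> t; t \<le> \<kappa>\<rbrakk> \<Longrightarrow> legendre Q s \<le> legendre Q t"
  using legendre_strict_mono[of s t] by (cases "s = t") auto

text \<open>\<open>Qtilde Q\<close> lies above its tangent at \<open>i\<close>, since \<open>Q\<close> is increasing on \<open>[-\<kappa>, \<kappa>]\<close>.\<close>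

lemma young:
  assumes "0 \<le> i" "i \<le> \<kappa>" "\<bar>s\<bar> \<le> \<kappa>"
  shows "\<bar>s\<bar> * Q i - legendre Q i \<le> Qtilde Q s"
proof -
  have lin: "((\<lambda>s. s * Q i) has_real_derivative Q i) (at s)" for s by (auto intro!: derivative_eq_intros)
  have "Qtilde Q i - i * Q i \<le> Qtilde Q \<bar>s\<bar> - \<bar>s\<bar> * Q i"
  proof (cases "i \<le> \<bar>s\<bar>")
    case True
    from increment_mono[OF this lin Qt_deriv] show ?thesis using assms Q_mono[of i] by fastforce
  next
    case False
    then have "\<bar>s\<bar> \<le> i" by simp
    from increment_mono[OF this Qt_deriv lin] show ?thesis using assms Q_mono[of _ i] by fastforce
  qed
  moreover have "Qtilde Q \<bar>s\<bar> = Qtilde Q s" using Qtilde_even[of s] by (auto simp: abs_if)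
  ultimately show ?thesis by (simp add: legendre_def)
qed

lemma Qtilde_nonneg: "\<bar>s\<bar> \<le> \<kappa> \<Longrightarrow> 0 \<le> Qtilde Q s"
  using young[of 0 s] kappa_pos by simp

text \<open>The inverse of \<open>legendre Q\<close>. By \<open>speed_eq_J\<close> below, \<open>speed (\<epsilon>\<^sup>2 * y)\<close> is the slope \<open>J_fun Q \<kappa> \<epsilon> y\<close>
  multiplied by \<open>\<epsilon>\<^sup>2\<close>; this scaling removes \<open>\<epsilon>\<close> from the inverse function.\<close>

definition speed :: "real \<Rightarrow> real" where
  "speed y = inv_into {0..\<kappa>} (legendre Q) y"

lemma legendre_image: "legendre Q ` {0..\<kappa>} = {0..legendre Q \<kappa>}"
proof
  show "legendre Q ` {0..\<kappa>} \<subseteq> {0..legendre Q \<kappa>}"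
    using legendre_mono[of 0] legendre_mono[of _ \<kappa>] by auto
  show "{0..legendre Q \<kappa>} \<subseteq> legendre Q ` {0..\<kappa>}"
    using connected_continuous_image[OF cont_legendre, of "{0..\<kappa>}"] kappa_pos legendre_0
    by (intro connected_contains_Icc) (auto intro!: image_eqI[of 0 _ 0])
qed

lemma legendre_inj: "inj_on (legendre Q) {0..\<kappa>}"
  by (rule linorder_inj_onI) (use legendre_strict_mono in force)+

lemma legendre_speed: "0 \<le> y \<Longrightarrow> y \<le> legendre Q \<kappa> \<Longrightarrow> legendre Q (speed y) = y"
  and speed_range: "0 \<le> y \<Longrightarrow> y \<le> legendre Q \<kappa> \<Longrightarrow> 0 \<le> speed y \<and> speed y \<le> \<kappa>"
  using f_inv_into_f[of y "legendre Q" "{0..\<kappa>}"] inv_into_into[of y "legendre Q" "{0..\<kappa>}"]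
  by (auto simp: legendre_image speed_def)

lemma speed_legendre: "0 \<le> s \<Longrightarrow> s \<le> \<kappa> \<Longrightarrow> speed (legendre Q s) = s"
  unfolding speed_def by (intro inv_into_f_f legendre_inj) auto

lemma speed_le: "0 \<le> y \<Longrightarrow> 0 \<le> s \<Longrightarrow> s \<le> \<kappa> \<Longrightarrow> y \<le> legendre Q s \<Longrightarrow> speed y \<le> s"
  using legendre_speed[of y] speed_range[of y] legendre_strict_mono[of s "speed y"] legendre_mono[of s \<kappa>]
  by force

lemma cont_speed: "continuous_on {0..legendre Q \<kappa>} speed"
  using continuous_on_inv[OF cont_legendre compact_Icc, of 0 \<kappa> speed] speed_legendre
  by (simp add: legendre_image)

lemma P_fun_eq:
  assumes "\<epsilon> \<noteq> 0"
  shows "P_fun Q \<epsilon> s = legendre Q (\<epsilon>\<^sup>2 * s) / \<epsilon>\<^sup>2"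
proof -
  have P: "P_fun Q \<epsilon> = Qtilde (\<lambda>z. \<epsilon>\<^sup>2 * z * deriv Q (\<epsilon>\<^sup>2 * z))"
    by (auto simp: P_fun_def Qtilde_def)
  have "((\<lambda>s. P_fun Q \<epsilon> s - legendre Q (\<epsilon>\<^sup>2 * s) / \<epsilon>\<^sup>2) has_real_derivative 0) (at s)" for s
  proof -
    have "(P_fun Q \<epsilon> has_real_derivative \<epsilon>\<^sup>2 * s * deriv Q (\<epsilon>\<^sup>2 * s)) (at s)"
      unfolding P by (intro Qtilde_has_derivative continuous_intros continuous_on_compose2[OF cont_deriv_Q]) auto
    moreover have "((\<lambda>s. legendre Q (\<epsilon>\<^sup>2 * s)) has_real_derivative (\<epsilon>\<^sup>2 * s * deriv Q (\<epsilon>\<^sup>2 * s)) * \<epsilon>\<^sup>2) (at s)"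
      by (rule DERIV_chain2[OF legendre_deriv]) (auto intro!: derivative_eq_intros)
    ultimately show ?thesis using assms
      by (auto intro!: derivative_eq_intros simp: field_simps)
  qed
  then have "P_fun Q \<epsilon> s - legendre Q (\<epsilon>\<^sup>2 * s) / \<epsilon>\<^sup>2 = P_fun Q \<epsilon> 0 - legendre Q (\<epsilon>\<^sup>2 * 0) / \<epsilon>\<^sup>2"
    by (intro DERIV_isconst_all) auto
  then show ?thesis by (simp add: P)
qed

lemma speed_eq_J:
  assumes "\<epsilon> \<noteq> 0" "0 \<le> y" "\<epsilon>\<^sup>2 * y \<le> legendre Q \<kappa>"
  shows "\<epsilon>\<^sup>2 * J_fun Q \<kappa> \<epsilon> y = speed (\<epsilon>\<^sup>2 * y)"
proof -
  have e: "0 < \<epsilon>\<^sup>2" using assms by simp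
  have "P_fun Q \<epsilon> (speed (\<epsilon>\<^sup>2 * y) / \<epsilon>\<^sup>2) = y"
    using assms by (simp add: P_fun_eq legendre_speed)
  moreover have "speed (\<epsilon>\<^sup>2 * y) / \<epsilon>\<^sup>2 \<in> {0..\<kappa> / \<epsilon>\<^sup>2}"
    using speed_range[of "\<epsilon>\<^sup>2 * y"] assms by (auto intro!: divide_right_mono)
  ultimately have "y \<in> P_fun Q \<epsilon> ` {0..\<kappa> / \<epsilon>\<^sup>2}" by (metis image_eqI)
  then have J: "P_fun Q \<epsilon> (J_fun Q \<kappa> \<epsilon> y) = y" "J_fun Q \<kappa> \<epsilon> y \<in> {0..\<kappa> / \<epsilon>\<^sup>2}"
    unfolding J_fun_def by (auto intro: f_inv_into_f inv_into_into simp del: atLeastAtMost_iff)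
  then have "legendre Q (\<epsilon>\<^sup>2 * J_fun Q \<kappa> \<epsilon> y) = \<epsilon>\<^sup>2 * y"
    using assms by (simp add: P_fun_eq field_simps)
  moreover have "0 \<le> \<epsilon>\<^sup>2 * J_fun Q \<kappa> \<epsilon> y" "\<epsilon>\<^sup>2 * J_fun Q \<kappa> \<epsilon> y \<le> \<kappa>"
    using J(2) e by (auto simp: field_simps)
  ultimately show ?thesis using speed_legendre by metis
qed

text \<open>The tolerance of 5 per cent is what the condition on \<open>A\<close> can afford, see
  \<open>exponential_lower_bound\<close>.\<close>

lemma near_linear:
  obtains s0 where "0 < s0" "s0 \<le> \<kappa>"
    "\<And>s. 0 \<le> s \<Longrightarrow> s \<le> s0 \<Longrightarrow> 19/20 * deriv Q 0 \<le> deriv Q s \<and> deriv Q s \<le> 21/20 * deriv Q 0"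
proof -
  have "0 < deriv Q 0" using Q_deriv_pos kappa_pos by simp
  moreover have "isCont (deriv Q) 0" using cont_deriv_Q by (simp add: continuous_on_eq_continuous_at)
  ultimately obtain d where d: "0 < d" "\<And>s. \<bar>s\<bar> < d \<Longrightarrow> \<bar>deriv Q s - deriv Q 0\<bar> < 1/20 * deriv Q 0"
    unfolding continuous_at_eps_delta by (metis dist_real_def diff_zero mult_pos_pos zero_less_divide_1_iff zero_less_numeral)
  show thesis
  proof (rule that[of "min (d / 2) \<kappa>"])
    fix s assume "0 \<le> s" "s \<le> min (d / 2) \<kappa>"
    then have "\<bar>deriv Q s - deriv Q 0\<bar> < 1/20 * deriv Q 0" using d(1) by (intro d(2)) auto
    then show "19/20 * deriv Q 0 \<le> deriv Q s \<and> deriv Q s \<le> 21/20 * deriv Q 0" by linarith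
  qed (use d kappa_pos in auto)
qed

text \<open>For the linear flux \<open>Q s = q * s\<close> both inequalities are equalities with \<open>q1 = q2 = q\<close>. In general
  compare the derivatives \<open>2 * Q s * deriv Q s\<close> and \<open>2 * q * s * deriv Q s\<close>.\<close>

lemma legendre_comparison:
  assumes "0 < q1" "0 < q2" "s0 \<le> \<kappa>" and q: "\<And>s. 0 \<le> s \<Longrightarrow> s \<le> s0 \<Longrightarrow> q1 \<le> deriv Q s \<and> deriv Q s \<le> q2"
    and ij: "0 \<le> i" "i \<le> j" "j \<le> s0"
  shows "(Q j)\<^sup>2 - (Q i)\<^sup>2 \<le> 2 * q2 * (legendre Q j - legendre Q i)"
    and "2 * q1 * (legendre Q j - legendre Q i) \<le> (Q j)\<^sup>2 - (Q i)\<^sup>2"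
proof -
  have lin: "((\<lambda>s. k * s) has_real_derivative k) (at s)" for k s :: real by (auto intro!: derivative_eq_intros)
  have Qb: "q1 * s \<le> Q s \<and> Q s \<le> q2 * s" if "0 \<le> s" "s \<le> s0" for s
    using increment_mono[OF that(1) lin[of q1] Q_deriv] increment_mono[OF that(1) Q_deriv lin[of q2]] that q by simp
  have sq: "((\<lambda>s. (Q s)\<^sup>2) has_real_derivative 2 * deriv Q s * Q s) (at s)"
    "((\<lambda>s. 2 * p * legendre Q s) has_real_derivative 2 * deriv Q s * (p * s)) (at s)" for p s
    by (auto intro!: derivative_eq_intros Q_deriv legendre_deriv)
  have "(Q j)\<^sup>2 - (Q i)\<^sup>2 \<le> 2 * q2 * legendre Q j - 2 * q2 * legendre Q i"
  proof (rule increment_mono[OF ij(2) sq(1) sq(2)])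
    fix s assume "i \<le> s" "s \<le> j"
    with ij have "0 \<le> s" "s \<le> s0" by auto
    with Qb[of s] q[of s] \<open>0 < q1\<close> show "2 * deriv Q s * Q s \<le> 2 * deriv Q s * (q2 * s)"
      by (intro mult_left_mono) auto
  qed
  then show "(Q j)\<^sup>2 - (Q i)\<^sup>2 \<le> 2 * q2 * (legendre Q j - legendre Q i)" by (simp add: algebra_simps)
  have "2 * q1 * legendre Q j - 2 * q1 * legendre Q i \<le> (Q j)\<^sup>2 - (Q i)\<^sup>2"
  proof (rule increment_mono[OF ij(2) sq(2) sq(1)])
    fix s assume "i \<le> s" "s \<le> j"
    with ij have "0 \<le> s" "s \<le> s0" by auto
    with Qb[of s] q[of s] \<open>0 < q1\<close> show "2 * deriv Q s * (q1 * s) \<le> 2 * deriv Q s * Q s"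
      by (intro mult_left_mono) auto
  qed
  then show "2 * q1 * (legendre Q j - legendre Q i) \<le> (Q j)\<^sup>2 - (Q i)\<^sup>2" by (simp add: algebra_simps)
qed

end


section \<open>The transition cost\<close>

lemma increment_le_integral:
  fixes V V' e :: "real \<Rightarrow> real"
  assumes "x0 \<le> x1" "e integrable_on {x0..x1}"
    and V: "\<And>x. x \<in> {x0..x1} \<Longrightarrow> (V has_real_derivative V' x) (at x within {x0..x1})"
    and le: "\<And>x. x \<in> {x0..x1} \<Longrightarrow> \<bar>V' x\<bar> \<le> e x"
  shows "\<bar>V x1 - V x0\<bar> \<le> integral {x0..x1} e"
proof -
  have i: "(V' has_integral (V x1 - V x0)) {x0..x1}"
    using V by (intro fundamental_theorem_of_calculus[OF assms(1)])
      (simp add: has_real_derivative_iff_has_vector_derivative)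
  have e: "(e has_integral integral {x0..x1} e) {x0..x1}" using assms(2) by (rule integrable_integral)
  have "V x1 - V x0 \<le> integral {x0..x1} e"
    by (rule has_integral_le[OF i e]) (use le in \<open>auto simp: abs_le_iff\<close>)
  moreover have "- (V x1 - V x0) \<le> integral {x0..x1} e"
    by (rule has_integral_le[OF has_integral_neg[OF i] e]) (use le in \<open>auto simp: abs_le_iff\<close>)
  ultimately show ?thesis by linarith
qed

text \<open>Bound \<open>\<gamma>\<close> by
  \<open>\<gamma>\<^sup>2 / (2 * k) + k / 2\<close> with a constant \<open>k\<close>, insert the bounds on \<open>\<gamma>\<^sup>2\<close> and \<open>f\<close>, and integrate. For
  \<open>f z = lam / 2 * z\<^sup>2\<close> and \<open>\<gamma>\<^sup>2 = B * f\<close> the constant would be \<open>sqrt (B / (2 * lam))\<close>, smaller by the factor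
  \<open>sqrt (3 / 2)\<close>.\<close>

lemma primitive_bound:
  fixes G \<gamma> f :: "real \<Rightarrow> real"
  assumes "0 < y" "0 < B" "0 < lam" "G 0 = 0"
    and G: "\<And>z. 0 \<le> z \<Longrightarrow> z \<le> y \<Longrightarrow> (G has_real_derivative \<gamma> z) (at z)"
    and \<gamma>: "\<And>z. 0 \<le> z \<Longrightarrow> z \<le> y \<Longrightarrow> (\<gamma> z)\<^sup>2 \<le> B * f z"
    and f: "\<And>z. 0 \<le> z \<Longrightarrow> z \<le> y \<Longrightarrow> f z \<le> f y - lam / 2 * (y\<^sup>2 - z\<^sup>2)"
  shows "G y \<le> sqrt (3 * B / (4 * lam)) * f y"
proof -
  \<comment> \<open>With \<open>k = c * y\<close> the terms other than \<open>f y\<close> cancel in \<open>H y\<close>.\<close>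
  define c where "c = sqrt (B * lam / 3)"
  have c: "0 < c" "c\<^sup>2 = B * lam / 3" using assms by (auto simp: c_def)
  define k where "k = c * y"
  have k: "0 < k" using c assms by (simp add: k_def)
  define H where "H = (\<lambda>z. (B / (2 * k) * (f y - lam / 2 * y\<^sup>2) + k / 2) * z + B / (2 * k) * (lam / 6) * z^3)"
  define H' where "H' z = B / (2 * k) * (f y - lam / 2 * y\<^sup>2) + k / 2 + B / (2 * k) * (lam / 2) * z\<^sup>2" for z
  have "(H has_real_derivative H' z) (at z)" for z
    unfolding H_def H'_def using k by (auto intro!: derivative_eq_intros)
  have "G y - G 0 \<le> H y - H 0"
  proof (rule increment_mono[where f' = \<gamma> and g' = H'])
    fix z assume z: "0 \<le> z" "z \<le> y"
    have "2 * k * \<gamma> z \<le> (\<gamma> z)\<^sup>2 + k\<^sup>2" using sum_squares_bound[of "\<gamma> z" k] by (simp add: mult_ac)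
    also have "\<dots> \<le> B * (f y - lam / 2 * (y\<^sup>2 - z\<^sup>2)) + k\<^sup>2"
      using \<gamma>[OF z] mult_left_mono[OF f[OF z], of B] assms by linarith
    finally have "\<gamma> z \<le> (B * (f y - lam / 2 * (y\<^sup>2 - z\<^sup>2)) + k\<^sup>2) / (2 * k)"
      using k by (simp add: field_simps)
    also have "\<dots> = H' z" using k by (simp add: H'_def field_simps power2_eq_square)
    finally show "\<gamma> z \<le> H' z" .
  qed (use assms(1) G \<open>\<And>z. (H has_real_derivative H' z) (at z)\<close> in auto)
  then have "G y \<le> H y" using assms by (simp add: H_def)
  also have "H y = B * y * f y / (2 * k) + (k\<^sup>2 - B * lam / 3 * y\<^sup>2) * y / (2 * k)"
    unfolding H_def using k by (simp add: field_simps power2_eq_square power3_eq_cube)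
  also have "k\<^sup>2 - B * lam / 3 * y\<^sup>2 = 0" using c by (simp add: k_def power_mult_distrib)
  also have "B * y * f y / (2 * k) + 0 * y / (2 * k) = B / (2 * c) * f y"
    using assms c by (simp add: k_def field_simps)
  also have "B / (2 * c) = sqrt (3 * B / (4 * lam))"
  proof (rule real_sqrt_unique[symmetric])
    show "(B / (2 * c))\<^sup>2 = 3 * B / (4 * lam)"
      using assms c by (simp add: power_divide power_mult_distrib field_simps power2_eq_square)
  qed (use assms c in simp)
  finally show ?thesis .
qed

locale reaction_diffusion = flux +
  fixes F :: "real \<Rightarrow> real" and lam1 lam2 \<eta> :: real
  assumes potential: "admissible_potential F 2 lam1 lam2 \<eta>"
begin

lemma F_deriv: "(F has_real_derivative deriv F s) (at s)" and cont_deriv_F: "continuous_on UNIV (deriv F)"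
  using potential C1_differentiable_on_UNIV_D[of F] by (auto simp: admissible_potential_def)

lemma cont_F: "continuous_on S F"
  by (rule DERIV_imp_continuous_on[OF F_deriv])

lemma F_nonneg: "0 \<le> F s"
  using potential by (cases "s = 1 \<or> s = -1") (auto simp: admissible_potential_def less_imp_le)

lemma lam_pos: "0 < lam1" "0 < lam2" "lam1 \<le> lam2" "0 < \<eta>"
  using potential by (auto simp: admissible_potential_def)

lemma F_well: "\<sigma> \<in> {1, -1} \<Longrightarrow> F \<sigma> = 0" "\<sigma> \<in> {1, -1} \<Longrightarrow> deriv F \<sigma> = 0"
  using potential by (auto simp: admissible_potential_def)

lemma F'_well:
  assumes "\<sigma> \<in> {1, -1}" "\<tau> \<in> {1, -1}" "0 \<le> z" "z < \<eta>"
  shows "lam1 * z \<le> \<tau> * deriv F (\<sigma> + \<tau> * z) \<and> \<tau> * deriv F (\<sigma> + \<tau> * z) \<le> lam2 * z"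
proof (cases "z = 0")
  case True
  then show ?thesis using F_well assms by auto
next
  case False
  then have z: "0 < z" using assms by simp
  have "0 < \<bar>\<sigma> + \<tau> * z + - \<sigma>\<bar>" "\<bar>\<sigma> + \<tau> * z + - \<sigma>\<bar> < \<eta>" using assms z by auto
  moreover have "1 + - \<sigma> * (\<sigma> + \<tau> * z) \<noteq> 0" using assms z by auto
  ultimately have "lam1 \<le> deriv F (\<sigma> + \<tau> * z) / (\<tau> * z)" "deriv F (\<sigma> + \<tau> * z) / (\<tau> * z) \<le> lam2"
    using potential[unfolded admissible_potential_def] assms(1)
    by (auto dest!: bspec[where x = "- \<sigma>"] spec[where x = "\<sigma> + \<tau> * z"])
  then show ?thesis using assms z by (auto simp: field_simps)
qed

text \<open>The coordinate \<open>z = \<tau> * (s - \<sigma>)\<close> puts both sides of both wells on the same footing.\<close>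

lemma F_growth:
  assumes "\<sigma> \<in> {1, -1}" "\<tau> \<in> {1, -1}" "0 \<le> z" "z \<le> y" "y < \<eta>"
  shows "lam1 / 2 * (y\<^sup>2 - z\<^sup>2) \<le> F (\<sigma> + \<tau> * y) - F (\<sigma> + \<tau> * z)"
    and "F (\<sigma> + \<tau> * y) - F (\<sigma> + \<tau> * z) \<le> lam2 / 2 * (y\<^sup>2 - z\<^sup>2)"
proof -
  have d: "((\<lambda>z. F (\<sigma> + \<tau> * z)) has_real_derivative \<tau> * deriv F (\<sigma> + \<tau> * z)) (at z)" for z
  proof -
    have "((\<lambda>z. F (\<sigma> + \<tau> * z)) has_real_derivative deriv F (\<sigma> + \<tau> * z) * \<tau>) (at z)"
      by (rule DERIV_chain2[OF F_deriv]) (auto intro!: derivative_eq_intros)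
    then show ?thesis by (simp add: mult.commute)
  qed
  have sq: "((\<lambda>z. k / 2 * z\<^sup>2) has_real_derivative k * z) (at z)" for k z :: real
    by (auto intro!: derivative_eq_intros)
  have F': "lam1 * t \<le> \<tau> * deriv F (\<sigma> + \<tau> * t) \<and> \<tau> * deriv F (\<sigma> + \<tau> * t) \<le> lam2 * t" if "z \<le> t" "t \<le> y" for t
    using that assms by (intro F'_well) auto
  show "lam1 / 2 * (y\<^sup>2 - z\<^sup>2) \<le> F (\<sigma> + \<tau> * y) - F (\<sigma> + \<tau> * z)"
    using increment_mono[OF assms(4) sq[of lam1] d] F' by (simp add: right_diff_distrib)
  show "F (\<sigma> + \<tau> * y) - F (\<sigma> + \<tau> * z) \<le> lam2 / 2 * (y\<^sup>2 - z\<^sup>2)"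
    using increment_mono[OF assms(4) d sq[of lam2]] F' by (simp add: right_diff_distrib)
qed

text \<open>The flux along the profile that joins the wells with the least energy, as a function of the value \<open>s\<close> of
  the profile. The cut-off at \<open>legendre Q \<kappa>\<close>, the end of the domain of \<open>speed\<close>, makes it continuous on the
  whole line. Young's inequality survives since it only asks for \<open>legendre Q j \<le> \<epsilon>\<^sup>2 * F s\<close>, and for
  small \<open>\<epsilon>\<close> the cut-off is not reached on \<open>[-1, 1]\<close> or near the wells.\<close>

definition opt :: "real \<Rightarrow> real \<Rightarrow> real" where
  "opt \<epsilon> s = Q (speed (min (\<epsilon>\<^sup>2 * F s) (legendre Q \<kappa>)))"

abbreviation cost :: "real \<Rightarrow> real \<Rightarrow> real" where
  "cost \<epsilon> \<equiv> Qtilde (opt \<epsilon>)"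

lemma legendre_kappa_pos: "0 < legendre Q \<kappa>"
  using legendre_strict_mono[of 0 \<kappa>] kappa_pos by simp

lemma min_range: "0 \<le> min (\<epsilon>\<^sup>2 * F s) (legendre Q \<kappa>)" "min (\<epsilon>\<^sup>2 * F s) (legendre Q \<kappa>) \<le> legendre Q \<kappa>"
  using F_nonneg[of s] legendre_kappa_pos by auto

lemma cont_opt: "continuous_on S (opt \<epsilon>)"
proof -
  have "continuous_on S (\<lambda>s. speed (min (\<epsilon>\<^sup>2 * F s) (legendre Q \<kappa>)))"
    using min_range by (intro continuous_on_compose2[OF cont_speed] continuous_intros cont_F) auto
  then show ?thesis unfolding opt_def[abs_def] by (rule continuous_on_compose2[OF cont_Q]) auto
qed

lemma opt_nonneg: "0 \<le> opt \<epsilon> s"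
  unfolding opt_def using speed_range[OF min_range] by (intro Q_nonneg) auto

lemma cost_deriv: "(cost \<epsilon> has_real_derivative opt \<epsilon> s) (at s)"
  by (rule Qtilde_has_derivative[OF cont_opt])

lemma cost_mono: "s \<le> t \<Longrightarrow> cost \<epsilon> s \<le> cost \<epsilon> t"
  by (erule DERIV_nonneg_imp_nondecreasing) (use cost_deriv opt_nonneg in blast)

lemma c_min_eq:
  assumes "0 < \<epsilon>" "\<And>s. s \<in> {-1..1} \<Longrightarrow> \<epsilon>\<^sup>2 * F s \<le> legendre Q \<kappa>"
  shows "c_min Q F \<kappa> \<epsilon> = (cost \<epsilon> 1 - cost \<epsilon> (-1)) / \<epsilon>"
proof -
  have "(LBINT s=-1..1. Q (\<epsilon>\<^sup>2 * J_fun Q \<kappa> \<epsilon> (F s))) = (LBINT s=ereal (-1)..ereal 1. opt \<epsilon> s)"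
    unfolding one_ereal_def uminus_ereal.simps
  proof (rule interval_integral_cong)
    fix s assume "s \<in> einterval (min (ereal (- 1)) (ereal 1)) (max (ereal (- 1)) (ereal 1))"
    then have "s \<in> {-1..1}" by (auto simp: einterval_iff min_def max_def)
    then show "Q (\<epsilon>\<^sup>2 * J_fun Q \<kappa> \<epsilon> (F s)) = opt \<epsilon> s"
      using assms speed_eq_J[of \<epsilon> "F s"] F_nonneg[of s] by (simp add: opt_def min_absorb1)
  qed
  also have "\<dots> = cost \<epsilon> 1 - cost \<epsilon> (-1)"
    by (rule interval_integral_FTC_finite)
       (auto intro!: cont_opt has_vector_derivative_at_within simp: has_field_derivative_at_within[OF cost_deriv] has_real_derivative_iff_has_vector_derivative[symmetric])
  finally show ?thesis by (simp add: c_min_def)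
qed

definition edens :: "real \<Rightarrow> real \<Rightarrow> real \<Rightarrow> real" where
  "edens \<epsilon> p s = Qtilde Q (\<epsilon>\<^sup>2 * p) / \<epsilon>^3 + F s / \<epsilon>"

lemma edens_nonneg:
  assumes "0 < \<epsilon>" "\<bar>\<epsilon>\<^sup>2 * p\<bar> \<le> \<kappa>"
  shows "0 \<le> edens \<epsilon> p s"
  using assms F_nonneg Qtilde_nonneg[OF assms(2)] by (auto simp: edens_def intro!: add_nonneg_nonneg divide_nonneg_pos)

text \<open>Young's inequality with \<open>i = j\<close>, the point that defines \<open>opt\<close>. As long as the cut-off is not reached it
  is an equality for the slope \<open>j / \<epsilon>\<^sup>2\<close>.\<close>

lemma edens_ge:
  assumes "0 < \<epsilon>" "\<bar>\<epsilon>\<^sup>2 * p\<bar> \<le> \<kappa>"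
  shows "\<bar>opt \<epsilon> s * p\<bar> \<le> \<epsilon> * edens \<epsilon> p s"
proof -
  let ?j = "speed (min (\<epsilon>\<^sup>2 * F s) (legendre Q \<kappa>))"
  have "\<bar>\<epsilon>\<^sup>2 * p\<bar> * opt \<epsilon> s - min (\<epsilon>\<^sup>2 * F s) (legendre Q \<kappa>) \<le> Qtilde Q (\<epsilon>\<^sup>2 * p)"
    using young[of ?j "\<epsilon>\<^sup>2 * p"] speed_range[OF min_range] legendre_speed[OF min_range] assms
    by (simp add: opt_def)
  then have "\<epsilon>\<^sup>2 * (\<bar>p\<bar> * opt \<epsilon> s) \<le> Qtilde Q (\<epsilon>\<^sup>2 * p) + \<epsilon>\<^sup>2 * F s" by (simp add: abs_mult mult_ac)
  then have "\<bar>p\<bar> * opt \<epsilon> s \<le> (Qtilde Q (\<epsilon>\<^sup>2 * p) + \<epsilon>\<^sup>2 * F s) / \<epsilon>\<^sup>2"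
    using assms by (simp add: field_simps)
  also have "\<dots> = \<epsilon> * edens \<epsilon> p s" using assms by (simp add: edens_def field_simps power2_eq_square power3_eq_cube)
  finally show ?thesis using opt_nonneg by (simp add: abs_mult mult.commute)
qed

text \<open>\<open>\<epsilon>\<close> times the energy density dominates the derivative of \<open>cost \<epsilon> (w x)\<close>.\<close>

lemma transition_cost:
  assumes "0 < \<epsilon>" "x0 \<le> x1" and w: "C1_on_interval x0 x1 w w'"
    and bd: "\<And>x. x \<in> {x0..x1} \<Longrightarrow> \<bar>\<epsilon>\<^sup>2 * w' x\<bar> \<le> \<kappa>"
  shows "\<bar>cost \<epsilon> (w x1) - cost \<epsilon> (w x0)\<bar> \<le> \<epsilon> * integral {x0..x1} (\<lambda>x. edens \<epsilon> (w' x) (w x))"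
    and "(\<lambda>x. edens \<epsilon> (w' x) (w x)) integrable_on {x0..x1}"
proof -
  have cw: "continuous_on {x0..x1} w" using w by (auto simp: C1_on_interval_def intro: DERIV_continuous_on)
  have "continuous_on {x0..x1} (\<lambda>x. edens \<epsilon> (w' x) (w x))"
    unfolding edens_def using w assms(1)
    by (intro continuous_intros continuous_on_compose2[OF cont_Qt[of UNIV]] continuous_on_compose2[OF cont_F cw])
       (auto simp: C1_on_interval_def)
  then show i: "(\<lambda>x. edens \<epsilon> (w' x) (w x)) integrable_on {x0..x1}"
    by (rule integrable_continuous_real)
  have "\<bar>cost \<epsilon> (w x1) - cost \<epsilon> (w x0)\<bar> \<le> integral {x0..x1} (\<lambda>x. \<epsilon> * edens \<epsilon> (w' x) (w x))"
  proof (rule increment_le_integral[where V = "\<lambda>x. cost \<epsilon> (w x)" and V' = "\<lambda>x. opt \<epsilon> (w x) * w' x", OF assms(2)])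
    fix x assume x: "x \<in> {x0..x1}"
    show "((\<lambda>x. cost \<epsilon> (w x)) has_real_derivative opt \<epsilon> (w x) * w' x) (at x within {x0..x1})"
      using w x by (intro DERIV_chain2[OF cost_deriv]) (auto simp: C1_on_interval_def)
    show "\<bar>opt \<epsilon> (w x) * w' x\<bar> \<le> \<epsilon> * edens \<epsilon> (w' x) (w x)"
      using edens_ge[OF assms(1) bd[OF x]] .
  qed (use i in \<open>auto intro: integrable_on_mult_right\<close>)
  then show "\<bar>cost \<epsilon> (w x1) - cost \<epsilon> (w x0)\<bar> \<le> \<epsilon> * integral {x0..x1} (\<lambda>x. edens \<epsilon> (w' x) (w x))" by simp
qed

end


section \<open>Calibration near a well\<close>

lemma abs_increment_deriv:
  fixes f g :: "real \<Rightarrow> real"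
  assumes f: "\<And>s. (f has_real_derivative g s) (at s)" and mono: "\<And>s t. s \<le> t \<Longrightarrow> f s \<le> f t" and "g \<sigma> = 0"
  shows "((\<lambda>s. \<bar>f s - f \<sigma>\<bar>) has_real_derivative sgn (s - \<sigma>) * g s) (at s)"
proof (cases s \<sigma> rule: linorder_cases)
  case greater
  have "\<forall>\<^sub>F t in nhds s. t \<in> {\<sigma><..}" using greater by (intro eventually_nhds_in_open) auto
  then have "\<forall>\<^sub>F t in nhds s. \<bar>f t - f \<sigma>\<bar> = f t - f \<sigma>" by eventually_elim (use mono[of \<sigma>] in auto)
  moreover have "((\<lambda>s. f s - f \<sigma>) has_real_derivative g s) (at s)" by (auto intro!: derivative_eq_intros f)
  ultimately show ?thesis using greater by (subst DERIV_cong_ev[OF refl _ refl]) auto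
next
  case less
  have "\<forall>\<^sub>F t in nhds s. t \<in> {..<\<sigma>}" using less by (intro eventually_nhds_in_open) auto
  then have "\<forall>\<^sub>F t in nhds s. \<bar>f t - f \<sigma>\<bar> = f \<sigma> - f t" by eventually_elim (use mono[of _ \<sigma>] in auto)
  moreover have "((\<lambda>s. f \<sigma> - f s) has_real_derivative - g s) (at s)" by (auto intro!: derivative_eq_intros f)
  ultimately show ?thesis using less by (subst DERIV_cong_ev[OF refl _ refl]) auto
next
  case equal
  have "((\<lambda>h. (f (\<sigma> + h) - f \<sigma>) / h) \<longlongrightarrow> 0) (at 0)"
    using f[of \<sigma>] \<open>g \<sigma> = 0\<close> by (simp add: DERIV_def)
  then have "((\<lambda>h. \<bar>f (\<sigma> + h) - f \<sigma>\<bar> / h) \<longlongrightarrow> 0) (at 0)"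
    by (rule tendsto_rabs_zero[THEN Lim_null_comparison[rotated]]) (auto simp: abs_divide)
  then show ?thesis using equal by (simp add: DERIV_def)
qed

lemma tanh_ge: "1 - 2 * exp (- 2 * z) \<le> tanh (z :: real)"
proof -
  have "(1 - 2 * exp (- 2 * z)) * (1 + exp (- 2 * z)) \<le> 1 - exp (- 2 * z)"
    by (simp add: algebra_simps)
  then show ?thesis by (simp add: tanh_real_altdef pos_le_divide_eq add_pos_pos)
qed

text \<open>The constants \<open>q1\<close> and \<open>q2\<close> bound \<open>deriv Q\<close> for the small slopes that occur within distance \<open>\<delta>\<close> of a
  well; the error of the calibration decays exponentially with the length of a tail, at the rate
  \<open>2 * \<alpha> / \<epsilon>\<close>. For \<open>q1 = q2 = q\<close> the condition on \<open>\<alpha>\<close>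
  is \<open>\<alpha>\<^sup>2 \<le> 2 * lam1 / (3 * q)\<close>, compared with \<open>\<alpha>\<^sup>2 \<le> lam1 / q\<close> for a quadratic well.\<close>

locale wells = reaction_diffusion +
  fixes q1 q2 s0 \<delta> \<alpha> :: real
  assumes q1: "0 < q1" and s0: "0 < s0" "s0 \<le> \<kappa>"
    and near: "\<And>s. 0 \<le> s \<Longrightarrow> s \<le> s0 \<Longrightarrow> q1 \<le> deriv Q s \<and> deriv Q s \<le> q2"
    and \<delta>: "0 < \<delta>" "\<delta> < \<eta>"
    and \<alpha>: "0 < \<alpha>" "3 * \<alpha>\<^sup>2 * q2 ^ 3 \<le> 2 * lam1 * q1\<^sup>2"
begin

lemma q2: "0 < q2" using near[of 0] q1 s0 by auto

text \<open>All slopes near the wells then lie in the range \<open>[0, s0]\<close> where \<open>q1\<close> and \<open>q2\<close> apply.\<close>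

definition small :: "real \<Rightarrow> bool" where
  "small \<epsilon> \<longleftrightarrow> 0 < \<epsilon> \<and> (\<forall>\<sigma>\<in>{1,-1}. \<forall>s. \<bar>s - \<sigma>\<bar> \<le> \<delta> \<longrightarrow> \<epsilon>\<^sup>2 * F s \<le> legendre Q s0)"

lemma speed_near:
  assumes "\<epsilon>\<^sup>2 * F s \<le> legendre Q s0"
  shows "opt \<epsilon> s = Q (speed (\<epsilon>\<^sup>2 * F s))" "0 \<le> speed (\<epsilon>\<^sup>2 * F s)" "speed (\<epsilon>\<^sup>2 * F s) \<le> s0"
    "legendre Q (speed (\<epsilon>\<^sup>2 * F s)) = \<epsilon>\<^sup>2 * F s"
proof -
  have le: "\<epsilon>\<^sup>2 * F s \<le> legendre Q \<kappa>" "0 \<le> \<epsilon>\<^sup>2 * F s"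
    using assms legendre_mono[of s0 \<kappa>] s0 F_nonneg[of s] by auto
  then show "opt \<epsilon> s = Q (speed (\<epsilon>\<^sup>2 * F s))" by (simp add: opt_def min_absorb1)
  show "0 \<le> speed (\<epsilon>\<^sup>2 * F s)" using speed_range le by blast
  show "speed (\<epsilon>\<^sup>2 * F s) \<le> s0" using le assms s0 by (intro speed_le) auto
  show "legendre Q (speed (\<epsilon>\<^sup>2 * F s)) = \<epsilon>\<^sup>2 * F s" using le by (intro legendre_speed)
qed

lemma opt_square:
  assumes "\<epsilon>\<^sup>2 * F s \<le> legendre Q s0"
  shows "2 * q1 * \<epsilon>\<^sup>2 * F s \<le> (opt \<epsilon> s)\<^sup>2" "(opt \<epsilon> s)\<^sup>2 \<le> 2 * q2 * \<epsilon>\<^sup>2 * F s"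
  using legendre_comparison[OF q1 q2 s0(2) near order_refl speed_near(2,3)[OF assms]]
  by (simp_all add: speed_near[OF assms] mult.assoc)

text \<open>Young's inequality at the point \<open>i\<close> with \<open>Q i = \<tau> * Q j\<close> instead of the optimal \<open>j\<close>. The flux is smaller
  by the factor \<open>\<tau>\<close>, and in return \<open>legendre Q j - legendre Q i\<close> is gained at every point, which is of
  the order \<open>1 - \<tau>\<^sup>2\<close>.\<close>

lemma edens_ge_scaled:
  assumes "0 < \<epsilon>" "\<bar>\<epsilon>\<^sup>2 * p\<bar> \<le> \<kappa>" and sm: "\<epsilon>\<^sup>2 * F s \<le> legendre Q s0" and \<tau>: "0 \<le> \<tau>" "\<tau> \<le> 1"
  shows "\<tau> * opt \<epsilon> s * \<bar>p\<bar> + (1 - \<tau>\<^sup>2) * ((opt \<epsilon> s)\<^sup>2 / (2 * q2 * \<epsilon>\<^sup>2)) \<le> \<epsilon> * edens \<epsilon> p s"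
proof -
  define j where "j = speed (\<epsilon>\<^sup>2 * F s)"
  note j = speed_near[OF sm, folded j_def]
  have "\<exists>i\<ge>0. i \<le> j \<and> Q i = \<tau> * Q j"
    using j s0 \<tau> Q_nonneg[of j] by (intro IVT' cont_Q) (auto intro: mult_left_le_one_le)
  then obtain i where i: "0 \<le> i" "i \<le> j" "Q i = \<tau> * Q j" by blast
  have "\<bar>\<epsilon>\<^sup>2 * p\<bar> * (\<tau> * Q j) - legendre Q i \<le> Qtilde Q (\<epsilon>\<^sup>2 * p)"
    using young[of i "\<epsilon>\<^sup>2 * p"] i j s0 assms by simp
  moreover have "(Q j)\<^sup>2 - (\<tau> * Q j)\<^sup>2 \<le> 2 * q2 * (\<epsilon>\<^sup>2 * F s - legendre Q i)"
    using legendre_comparison(1)[OF q1 q2 s0(2) near i(1,2) j(3)] i(3) j(4) by simp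
  then have "(1 - \<tau>\<^sup>2) * (Q j)\<^sup>2 / (2 * q2) \<le> \<epsilon>\<^sup>2 * F s - legendre Q i"
    using q2 by (simp add: field_simps power_mult_distrib)
  ultimately have "\<epsilon>\<^sup>2 * (\<bar>p\<bar> * (\<tau> * Q j)) + (1 - \<tau>\<^sup>2) * (Q j)\<^sup>2 / (2 * q2) \<le> Qtilde Q (\<epsilon>\<^sup>2 * p) + \<epsilon>\<^sup>2 * F s"
    by (simp add: abs_mult mult_ac)
  then have "(\<epsilon>\<^sup>2 * (\<bar>p\<bar> * (\<tau> * Q j)) + (1 - \<tau>\<^sup>2) * (Q j)\<^sup>2 / (2 * q2)) / \<epsilon>\<^sup>2 \<le> (Qtilde Q (\<epsilon>\<^sup>2 * p) + \<epsilon>\<^sup>2 * F s) / \<epsilon>\<^sup>2"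
    using assms by (intro divide_right_mono) auto
  also have "\<dots> = \<epsilon> * edens \<epsilon> p s" using assms by (simp add: edens_def field_simps power2_eq_square power3_eq_cube)
  also have "(\<epsilon>\<^sup>2 * (\<bar>p\<bar> * (\<tau> * Q j)) + (1 - \<tau>\<^sup>2) * (Q j)\<^sup>2 / (2 * q2)) / \<epsilon>\<^sup>2
      = \<tau> * opt \<epsilon> s * \<bar>p\<bar> + (1 - \<tau>\<^sup>2) * ((opt \<epsilon> s)\<^sup>2 / (2 * q2 * \<epsilon>\<^sup>2))"
    using assms q2 by (simp add: j(1) add_divide_distrib mult_ac)
  finally show ?thesis .
qed

context
  fixes \<epsilon> \<sigma> \<tau> :: real
  assumes sm: "small \<epsilon>" and \<sigma>: "\<sigma> \<in> {1, -1}" and \<tau>: "\<tau> \<in> {1, -1}"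
begin

lemma eps_pos: "0 < \<epsilon>" using sm by (simp add: small_def)

lemma small_well: "0 \<le> z \<Longrightarrow> z \<le> \<delta> \<Longrightarrow> \<epsilon>\<^sup>2 * F (\<sigma> + \<tau> * z) \<le> legendre Q s0"
  using sm \<sigma> \<tau> by (auto simp: small_def)

lemma cost_well_deriv:
  "((\<lambda>z. \<tau> * (cost \<epsilon> (\<sigma> + \<tau> * z) - cost \<epsilon> \<sigma>)) has_real_derivative opt \<epsilon> (\<sigma> + \<tau> * z)) (at z)"
proof -
  have "((\<lambda>z. cost \<epsilon> (\<sigma> + \<tau> * z)) has_real_derivative opt \<epsilon> (\<sigma> + \<tau> * z) * \<tau>) (at z)"
    by (rule DERIV_chain2[OF cost_deriv]) (auto intro!: derivative_eq_intros)
  from DERIV_cmult[OF DERIV_diff[OF this DERIV_const], of \<tau> "cost \<epsilon> \<sigma>"]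
  show ?thesis using \<tau> by (auto simp: mult_ac)
qed

lemma cost_well_abs:
  assumes "0 \<le> z"
  shows "\<bar>cost \<epsilon> (\<sigma> + \<tau> * z) - cost \<epsilon> \<sigma>\<bar> = \<tau> * (cost \<epsilon> (\<sigma> + \<tau> * z) - cost \<epsilon> \<sigma>)"
  using \<tau> assms cost_mono[of \<sigma> "\<sigma> + z" \<epsilon>] cost_mono[of "\<sigma> - z" \<sigma> \<epsilon>] by auto

text \<open>What the calibration needs from the well. Both sides are compared with \<open>\<epsilon>\<^sup>2 * F\<close>: the right one by
  \<open>opt_square\<close>, the left one by \<open>primitive_bound\<close>; the condition on \<open>\<alpha>\<close> fits the two constants.\<close>

lemma cost_well_F:
  assumes "0 \<le> z" "z \<le> \<delta>"
  shows "2 * q2 * \<alpha> * \<epsilon> * \<bar>cost \<epsilon> (\<sigma> + \<tau> * z) - cost \<epsilon> \<sigma>\<bar> \<le> (opt \<epsilon> (\<sigma> + \<tau> * z))\<^sup>2"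
proof (cases "z = 0")
  case False
  then have z: "0 < z" using assms by simp
  have prim: "\<tau> * (cost \<epsilon> (\<sigma> + \<tau> * z) - cost \<epsilon> \<sigma>) \<le> sqrt (3 * (2 * q2 * \<epsilon>\<^sup>2) / (4 * lam1)) * F (\<sigma> + \<tau> * z)"
  proof (rule primitive_bound[OF z, where G = "\<lambda>z. \<tau> * (cost \<epsilon> (\<sigma> + \<tau> * z) - cost \<epsilon> \<sigma>)"
        and \<gamma> = "\<lambda>z. opt \<epsilon> (\<sigma> + \<tau> * z)" and f = "\<lambda>z. F (\<sigma> + \<tau> * z)"])
    fix t assume t: "0 \<le> t" "t \<le> z"
    show "(opt \<epsilon> (\<sigma> + \<tau> * t))\<^sup>2 \<le> 2 * q2 * \<epsilon>\<^sup>2 * F (\<sigma> + \<tau> * t)"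
      using t assms by (intro opt_square small_well) auto
    show "F (\<sigma> + \<tau> * t) \<le> F (\<sigma> + \<tau> * z) - lam1 / 2 * (z\<^sup>2 - t\<^sup>2)"
      using F_growth(1)[OF \<sigma> \<tau> t] assms \<delta> by auto
  qed (use q2 eps_pos lam_pos cost_well_deriv in auto)
  have "q2 * \<alpha> * sqrt (3 * (2 * q2 * \<epsilon>\<^sup>2) / (4 * lam1)) \<le> q1 * \<epsilon>"
  proof (rule power2_le_imp_le)
    have "(q2 * \<alpha> * sqrt (3 * (2 * q2 * \<epsilon>\<^sup>2) / (4 * lam1)))\<^sup>2 = \<epsilon>\<^sup>2 * ((3 * \<alpha>\<^sup>2 * q2 ^ 3) / (2 * lam1))"
    proof -
      have "(sqrt (3 * (2 * q2 * \<epsilon>\<^sup>2) / (4 * lam1)))\<^sup>2 = 3 * (2 * q2 * \<epsilon>\<^sup>2) / (4 * lam1)"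
        using q2 lam_pos by (intro real_sqrt_pow2) auto
      then have "(q2 * \<alpha> * sqrt (3 * (2 * q2 * \<epsilon>\<^sup>2) / (4 * lam1)))\<^sup>2 = q2\<^sup>2 * \<alpha>\<^sup>2 * (3 * (2 * q2 * \<epsilon>\<^sup>2) / (4 * lam1))"
        by (simp only: power_mult_distrib)
      then show ?thesis by (simp add: power2_eq_square power3_eq_cube)
    qed
    also have "\<dots> \<le> \<epsilon>\<^sup>2 * q1\<^sup>2"
      using \<alpha>(2) lam_pos by (intro mult_left_mono) (auto simp: field_simps)
    finally show "(q2 * \<alpha> * sqrt (3 * (2 * q2 * \<epsilon>\<^sup>2) / (4 * lam1)))\<^sup>2 \<le> (q1 * \<epsilon>)\<^sup>2"
      by (simp add: power_mult_distrib mult.commute)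
  qed (use q1 eps_pos in simp)
  then have "q2 * \<alpha> * sqrt (3 * (2 * q2 * \<epsilon>\<^sup>2) / (4 * lam1)) * (2 * \<epsilon> * F (\<sigma> + \<tau> * z)) \<le> q1 * \<epsilon> * (2 * \<epsilon> * F (\<sigma> + \<tau> * z))"
    using eps_pos F_nonneg by (intro mult_right_mono) auto
  moreover have "2 * q2 * \<alpha> * \<epsilon> * (\<tau> * (cost \<epsilon> (\<sigma> + \<tau> * z) - cost \<epsilon> \<sigma>))
      \<le> 2 * q2 * \<alpha> * \<epsilon> * (sqrt (3 * (2 * q2 * \<epsilon>\<^sup>2) / (4 * lam1)) * F (\<sigma> + \<tau> * z))"
    using prim q2 \<alpha> eps_pos by (intro mult_left_mono) auto
  ultimately have "2 * q2 * \<alpha> * \<epsilon> * (\<tau> * (cost \<epsilon> (\<sigma> + \<tau> * z) - cost \<epsilon> \<sigma>)) \<le> q1 * \<epsilon> * (2 * \<epsilon> * F (\<sigma> + \<tau> * z))"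
    by (simp add: mult_ac)
  also have "\<dots> = 2 * q1 * \<epsilon>\<^sup>2 * F (\<sigma> + \<tau> * z)" by (simp add: power2_eq_square)
  also have "\<dots> \<le> (opt \<epsilon> (\<sigma> + \<tau> * z))\<^sup>2" using assms by (intro opt_square small_well)
  finally show ?thesis using cost_well_abs[OF assms(1)] by simp
qed simp

lemma cost_well_size:
  assumes "0 \<le> z" "z \<le> \<delta>"
  shows "\<bar>cost \<epsilon> (\<sigma> + \<tau> * z) - cost \<epsilon> \<sigma>\<bar> \<le> \<epsilon> * (sqrt (q2 * lam2) / 2 * z\<^sup>2)"
    and "\<epsilon> * (sqrt (q1 * lam1) / 2 * z\<^sup>2) \<le> \<bar>cost \<epsilon> (\<sigma> + \<tau> * z) - cost \<epsilon> \<sigma>\<bar>"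
proof -
  have F0: "F \<sigma> = 0" using F_well \<sigma> by blast
  have bnd: "\<epsilon> * sqrt (q1 * lam1) * t \<le> opt \<epsilon> (\<sigma> + \<tau> * t) \<and> opt \<epsilon> (\<sigma> + \<tau> * t) \<le> \<epsilon> * sqrt (q2 * lam2) * t"
    if t: "0 \<le> t" "t \<le> \<delta>" for t
  proof
    note Fb = F_growth[OF \<sigma> \<tau> order_refl t(1)]
    have Fb: "lam1 / 2 * t\<^sup>2 \<le> F (\<sigma> + \<tau> * t)" "F (\<sigma> + \<tau> * t) \<le> lam2 / 2 * t\<^sup>2"
      using Fb t \<delta> F0 by auto
    have "(\<epsilon> * sqrt (q1 * lam1) * t)\<^sup>2 = 2 * q1 * \<epsilon>\<^sup>2 * (lam1 / 2 * t\<^sup>2)"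
      using q1 lam_pos by (simp add: power_mult_distrib)
    also have "\<dots> \<le> 2 * q1 * \<epsilon>\<^sup>2 * F (\<sigma> + \<tau> * t)" using Fb q1 by (intro mult_left_mono) auto
    also have "\<dots> \<le> (opt \<epsilon> (\<sigma> + \<tau> * t))\<^sup>2" using t by (intro opt_square small_well)
    finally show "\<epsilon> * sqrt (q1 * lam1) * t \<le> opt \<epsilon> (\<sigma> + \<tau> * t)"
      by (rule power2_le_imp_le) (rule opt_nonneg)
    have "(opt \<epsilon> (\<sigma> + \<tau> * t))\<^sup>2 \<le> 2 * q2 * \<epsilon>\<^sup>2 * F (\<sigma> + \<tau> * t)" using t by (intro opt_square small_well)
    also have "\<dots> \<le> 2 * q2 * \<epsilon>\<^sup>2 * (lam2 / 2 * t\<^sup>2)" using Fb q2 by (intro mult_left_mono) auto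
    also have "\<dots> = (\<epsilon> * sqrt (q2 * lam2) * t)\<^sup>2" using q2 lam_pos by (simp add: power_mult_distrib)
    finally show "opt \<epsilon> (\<sigma> + \<tau> * t) \<le> \<epsilon> * sqrt (q2 * lam2) * t"
      by (rule power2_le_imp_le) (use t eps_pos q2 lam_pos in auto)
  qed
  have sq: "((\<lambda>z. \<epsilon> * (c / 2 * z\<^sup>2)) has_real_derivative \<epsilon> * c * z) (at z)" for c z
    by (auto intro!: derivative_eq_intros)
  show "\<bar>cost \<epsilon> (\<sigma> + \<tau> * z) - cost \<epsilon> \<sigma>\<bar> \<le> \<epsilon> * (sqrt (q2 * lam2) / 2 * z\<^sup>2)"
    using increment_mono[OF assms(1) cost_well_deriv sq[of "sqrt (q2 * lam2)"]] bnd assms cost_well_abs[OF assms(1)] by simp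
  show "\<epsilon> * (sqrt (q1 * lam1) / 2 * z\<^sup>2) \<le> \<bar>cost \<epsilon> (\<sigma> + \<tau> * z) - cost \<epsilon> \<sigma>\<bar>"
    using increment_mono[OF assms(1) sq[of "sqrt (q1 * lam1)"] cost_well_deriv] bnd assms cost_well_abs[OF assms(1)] by simp
qed

end

lemma well_cases:
  fixes s \<sigma> :: real
  obtains \<tau> z where "\<tau> \<in> {1, -1}" "0 \<le> z" "s = \<sigma> + \<tau> * z" "z = \<bar>s - \<sigma>\<bar>"
proof (cases "\<sigma> \<le> s")
  case True
  then show thesis by (intro that[of 1 "s - \<sigma>"]) auto
next
  case False
  then show thesis by (intro that[of "-1" "\<sigma> - s"]) auto
qed

text \<open>The derivative of \<open>\<tau> x * \<bar>cost \<epsilon> (w x) - cost \<epsilon> \<sigma>\<bar>\<close> has a term with \<open>\<tau>'\<close>, absorbed by the gain of order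
  \<open>1 - \<tau>\<^sup>2\<close> in \<open>edens_ge_scaled\<close> through \<open>cost_well_F\<close>, and a term with \<open>\<tau>\<close>, absorbed by the reduced
  flux. The equation for \<open>\<tau>'\<close> is solved by hyperbolic tangents that vanish at either end.\<close>

lemma tail_calibration:
  assumes sm: "small \<epsilon>" and \<sigma>: "\<sigma> \<in> {1, -1}" and "x0 \<le> x1" and w: "C1_on_interval x0 x1 w w'"
    and bd: "\<And>x. x \<in> {x0..x1} \<Longrightarrow> \<bar>\<epsilon>\<^sup>2 * w' x\<bar> \<le> \<kappa>"
    and close: "\<And>x. x \<in> {x0..x1} \<Longrightarrow> \<bar>w x - \<sigma>\<bar> \<le> \<delta>"
    and \<tau>: "\<And>x. x \<in> {x0..x1} \<Longrightarrow> 0 \<le> \<tau> x \<and> \<tau> x \<le> 1"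
      "\<And>x. (\<tau> has_real_derivative \<tau>' x) (at x)"
      "\<And>x. \<bar>\<tau>' x\<bar> = \<alpha> / \<epsilon> * (1 - (\<tau> x)\<^sup>2)"
  shows "\<bar>\<tau> x1 * \<bar>cost \<epsilon> (w x1) - cost \<epsilon> \<sigma>\<bar> - \<tau> x0 * \<bar>cost \<epsilon> (w x0) - cost \<epsilon> \<sigma>\<bar>\<bar>
    \<le> \<epsilon> * integral {x0..x1} (\<lambda>x. edens \<epsilon> (w' x) (w x))"
proof -
  have e: "0 < \<epsilon>" using sm by (simp add: small_def)
  let ?\<Psi> = "\<lambda>s. \<bar>cost \<epsilon> s - cost \<epsilon> \<sigma>\<bar>"
  have "speed 0 = 0" using speed_legendre[of 0] kappa_pos by simp
  then have opt0: "opt \<epsilon> \<sigma> = 0"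
    using F_well(1)[OF \<sigma>] legendre_kappa_pos by (simp add: opt_def)
  have dPsi: "(?\<Psi> has_real_derivative sgn (s - \<sigma>) * opt \<epsilon> s) (at s)" for s
    by (rule abs_increment_deriv[OF cost_deriv cost_mono opt0])
  have "\<bar>\<tau> x1 * ?\<Psi> (w x1) - \<tau> x0 * ?\<Psi> (w x0)\<bar> \<le> integral {x0..x1} (\<lambda>x. \<epsilon> * edens \<epsilon> (w' x) (w x))"
  proof (rule increment_le_integral[where V = "\<lambda>x. \<tau> x * ?\<Psi> (w x)"
        and V' = "\<lambda>x. \<tau>' x * ?\<Psi> (w x) + \<tau> x * (sgn (w x - \<sigma>) * opt \<epsilon> (w x) * w' x)", OF \<open>x0 \<le> x1\<close>])
    show "(\<lambda>x. \<epsilon> * edens \<epsilon> (w' x) (w x)) integrable_on {x0..x1}"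
      using transition_cost(2)[OF e \<open>x0 \<le> x1\<close> w bd] by (intro integrable_on_mult_right)
    fix x assume x: "x \<in> {x0..x1}"
    have "((\<lambda>x. ?\<Psi> (w x)) has_real_derivative sgn (w x - \<sigma>) * opt \<epsilon> (w x) * w' x) (at x within {x0..x1})"
      using w x by (intro DERIV_chain2[OF dPsi]) (auto simp: C1_on_interval_def)
    from DERIV_mult'[OF has_field_derivative_at_within[OF \<tau>(2)] this]
    show "((\<lambda>x. \<tau> x * ?\<Psi> (w x)) has_real_derivative
        \<tau>' x * ?\<Psi> (w x) + \<tau> x * (sgn (w x - \<sigma>) * opt \<epsilon> (w x) * w' x)) (at x within {x0..x1})"
      by (simp add: add.commute)
    have s1: "\<epsilon>\<^sup>2 * F (w x) \<le> legendre Q s0" using sm \<sigma> close[OF x] by (auto simp: small_def)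
    obtain \<upsilon> z where z: "\<upsilon> \<in> {1, -1}" "0 \<le> z" "w x = \<sigma> + \<upsilon> * z" "z = \<bar>w x - \<sigma>\<bar>" by (rule well_cases)
    have K: "2 * q2 * \<alpha> * \<epsilon> * ?\<Psi> (w x) \<le> (opt \<epsilon> (w x))\<^sup>2"
      using cost_well_F[OF sm \<sigma> z(1,2)] close[OF x, folded z(4)] by (simp only: z(3))
    have K': "\<alpha> / \<epsilon> * ?\<Psi> (w x) \<le> (opt \<epsilon> (w x))\<^sup>2 / (2 * q2 * \<epsilon>\<^sup>2)"
    proof -
      have "\<alpha> / \<epsilon> * ?\<Psi> (w x) = (2 * q2 * \<alpha> * \<epsilon> * ?\<Psi> (w x)) / (2 * q2 * \<epsilon>\<^sup>2)"
        using e q2 by (simp add: power2_eq_square)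
      also have "\<dots> \<le> (opt \<epsilon> (w x))\<^sup>2 / (2 * q2 * \<epsilon>\<^sup>2)" using K e q2 by (intro divide_right_mono) auto
      finally show ?thesis .
    qed
    have t2: "0 \<le> 1 - (\<tau> x)\<^sup>2" using \<tau>(1)[OF x] by (simp add: power_le_one)
    have sg: "\<bar>sgn (w x - \<sigma>) * opt \<epsilon> (w x)\<bar> \<le> opt \<epsilon> (w x)"
      using opt_nonneg[of \<epsilon> "w x"] by (auto simp: abs_mult sgn_real_def)
    have "\<bar>\<tau>' x * ?\<Psi> (w x) + \<tau> x * (sgn (w x - \<sigma>) * opt \<epsilon> (w x) * w' x)\<bar>
        \<le> \<bar>\<tau>' x\<bar> * ?\<Psi> (w x) + \<tau> x * (\<bar>sgn (w x - \<sigma>) * opt \<epsilon> (w x)\<bar> * \<bar>w' x\<bar>)"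
      using \<tau>(1)[OF x] by (intro order_trans[OF abs_triangle_ineq]) (simp add: abs_mult)
    also have "\<dots> \<le> (1 - (\<tau> x)\<^sup>2) * ((opt \<epsilon> (w x))\<^sup>2 / (2 * q2 * \<epsilon>\<^sup>2)) + \<tau> x * (opt \<epsilon> (w x) * \<bar>w' x\<bar>)"
    proof (rule add_mono)
      show "\<bar>\<tau>' x\<bar> * ?\<Psi> (w x) \<le> (1 - (\<tau> x)\<^sup>2) * ((opt \<epsilon> (w x))\<^sup>2 / (2 * q2 * \<epsilon>\<^sup>2))"
        using mult_left_mono[OF K' t2] by (simp add: \<tau>(3) mult_ac)
      show "\<tau> x * (\<bar>sgn (w x - \<sigma>) * opt \<epsilon> (w x)\<bar> * \<bar>w' x\<bar>) \<le> \<tau> x * (opt \<epsilon> (w x) * \<bar>w' x\<bar>)"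
        using \<tau>(1)[OF x] sg by (intro mult_left_mono mult_right_mono) auto
    qed
    also have "\<dots> \<le> \<epsilon> * edens \<epsilon> (w' x) (w x)"
      using edens_ge_scaled[OF e bd[OF x] s1, of "\<tau> x"] \<tau>(1)[OF x] by (simp add: mult_ac)
    finally show "\<bar>\<tau>' x * ?\<Psi> (w x) + \<tau> x * (sgn (w x - \<sigma>) * opt \<epsilon> (w x) * w' x)\<bar> \<le> \<epsilon> * edens \<epsilon> (w' x) (w x)" .
  qed
  then show ?thesis by simp
qed

text \<open>Either the profile leaves the \<open>\<delta>\<close>-neighbourhood of the well, and then this alone costs more than the
  claim because \<open>\<delta>1\<close> is small compared with \<open>\<delta>\<close>, or the calibration applies on the whole interval.
  The point \<open>p\<close> is the end of the tail next to the jump.\<close>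

theorem tail_cost:
  assumes sm: "small \<epsilon>" and \<sigma>: "\<sigma> \<in> {1, -1}" and "x0 \<le> x1" and w: "C1_on_interval x0 x1 w w'"
    and bd: "\<And>x. x \<in> {x0..x1} \<Longrightarrow> \<bar>\<epsilon>\<^sup>2 * w' x\<bar> \<le> \<kappa>"
    and \<delta>1: "0 \<le> \<delta>1" "\<delta>1 \<le> \<delta>" "2 * sqrt (q2 * lam2) * \<delta>1\<^sup>2 \<le> sqrt (q1 * lam1) * \<delta>\<^sup>2"
    and p: "p \<in> {x0, x1}" "\<bar>w p - \<sigma>\<bar> \<le> \<delta>1"
  shows "\<bar>cost \<epsilon> (w p) - cost \<epsilon> \<sigma>\<bar> - \<epsilon> * (sqrt (q2 * lam2) * \<delta>1\<^sup>2 * exp (- 2 * \<alpha> * (x1 - x0) / \<epsilon>))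
    \<le> \<epsilon> * integral {x0..x1} (\<lambda>x. edens \<epsilon> (w' x) (w x))"
proof -
  have e: "0 < \<epsilon>" using sm by (simp add: small_def)
  let ?\<Psi> = "\<lambda>s. \<bar>cost \<epsilon> s - cost \<epsilon> \<sigma>\<bar>"
  let ?E = "integral {x0..x1} (\<lambda>x. edens \<epsilon> (w' x) (w x))"
  let ?C = "sqrt (q2 * lam2) * \<delta>1\<^sup>2"
  have C: "0 \<le> ?C" using q2 lam_pos by simp
  have Psi_p: "2 * ?\<Psi> (w p) \<le> \<epsilon> * ?C"
  proof -
    obtain \<upsilon> z where z: "\<upsilon> \<in> {1, -1}" "0 \<le> z" "w p = \<sigma> + \<upsilon> * z" "z = \<bar>w p - \<sigma>\<bar>" by (rule well_cases)
    have "?\<Psi> (w p) \<le> \<epsilon> * (sqrt (q2 * lam2) / 2 * z\<^sup>2)"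
    proof -
      have "z \<le> \<delta>" using p(2) z(4) \<delta>1(2) by linarith
      from cost_well_size(1)[OF sm \<sigma> z(1,2) this] show ?thesis by (simp only: z(3))
    qed
    also have "\<dots> \<le> \<epsilon> * (sqrt (q2 * lam2) / 2 * \<delta>1\<^sup>2)"
      using z(2) p(2)[folded z(4)] e q2 lam_pos by (intro mult_left_mono power_mono) auto
    finally show ?thesis by simp
  qed
  show ?thesis
  proof (cases "\<exists>x\<in>{x0..x1}. \<delta> < \<bar>w x - \<sigma>\<bar>")
    case True
    then obtain x where x: "x \<in> {x0..x1}" "\<delta> < \<bar>w x - \<sigma>\<bar>" by blast
    obtain \<upsilon> z where z: "\<upsilon> \<in> {1, -1}" "0 \<le> z" "w x = \<sigma> + \<upsilon> * z" "z = \<bar>w x - \<sigma>\<bar>" by (rule well_cases)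
    have "\<epsilon> * ?C \<le> \<epsilon> * (sqrt (q1 * lam1) / 2 * \<delta>\<^sup>2)" using \<delta>1 e by simp
    also have "\<dots> \<le> ?\<Psi> (\<sigma> + \<upsilon> * \<delta>)"
      using cost_well_size(2)[OF sm \<sigma> z(1)] \<delta> by simp
    also have "\<dots> \<le> ?\<Psi> (w x)"
    proof -
      have "\<delta> < z" using x(2) z(4) by simp
      then have "\<upsilon> = 1 \<and> cost \<epsilon> \<sigma> \<le> cost \<epsilon> (\<sigma> + \<upsilon> * \<delta>) \<and> cost \<epsilon> (\<sigma> + \<upsilon> * \<delta>) \<le> cost \<epsilon> (w x)
          \<or> \<upsilon> = -1 \<and> cost \<epsilon> (w x) \<le> cost \<epsilon> (\<sigma> + \<upsilon> * \<delta>) \<and> cost \<epsilon> (\<sigma> + \<upsilon> * \<delta>) \<le> cost \<epsilon> \<sigma>"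
        using z(1) \<delta> unfolding z(3) by (auto intro!: cost_mono)
      then show ?thesis by auto
    qed
    finally have far: "\<epsilon> * ?C \<le> ?\<Psi> (w x)" .
    define l r where "l = min p x" and "r = max p x"
    have lr: "x0 \<le> l" "l \<le> r" "r \<le> x1" using x p \<open>x0 \<le> x1\<close> by (auto simp: l_def r_def)
    have sub: "C1_on_interval l r w w'"
      using w lr by (intro C1_on_interval_subset[OF w])
    have bd': "\<bar>\<epsilon>\<^sup>2 * w' x\<bar> \<le> \<kappa>" if "x \<in> {l..r}" for x using that lr bd by auto
    have "\<bar>cost \<epsilon> (w r) - cost \<epsilon> (w l)\<bar> \<le> \<epsilon> * integral {l..r} (\<lambda>x. edens \<epsilon> (w' x) (w x))"
      using transition_cost(1)[OF e lr(2) sub bd'] .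
    also have "\<dots> \<le> \<epsilon> * ?E"
    proof (rule mult_left_mono[OF integral_subset_le])
      show "(\<lambda>x. edens \<epsilon> (w' x) (w x)) integrable_on {l..r}" by (rule transition_cost(2)[OF e lr(2) sub bd'])
      show "(\<lambda>x. edens \<epsilon> (w' x) (w x)) integrable_on {x0..x1}" by (rule transition_cost(2)[OF e \<open>x0 \<le> x1\<close> w bd])
    qed (use lr e edens_nonneg bd in auto)
    also have "\<bar>cost \<epsilon> (w r) - cost \<epsilon> (w l)\<bar> = \<bar>cost \<epsilon> (w x) - cost \<epsilon> (w p)\<bar>"
      by (auto simp: l_def r_def min_def max_def)
    finally have "?\<Psi> (w x) - ?\<Psi> (w p) \<le> \<epsilon> * ?E" by linarith
    moreover have "t \<le> E" if "s - t \<le> E" "c \<le> s" "2 * t \<le> c" for s t c E :: real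
      using that by linarith
    ultimately have "?\<Psi> (w p) \<le> \<epsilon> * ?E" using far Psi_p by blast
    moreover have "0 \<le> \<epsilon> * (?C * exp (- 2 * \<alpha> * (x1 - x0) / \<epsilon>))"
      using e C by simp
    ultimately show ?thesis by linarith
  next
    case False
    then have close: "\<And>x. x \<in> {x0..x1} \<Longrightarrow> \<bar>w x - \<sigma>\<bar> \<le> \<delta>" by force
    define T where "T = tanh (\<alpha> / \<epsilon> * (x1 - x0))"
    have d: "((\<lambda>x. tanh (\<alpha> / \<epsilon> * (c * (x - y)))) has_real_derivative (1 - (tanh (\<alpha> / \<epsilon> * (c * (x - y))))\<^sup>2) * (\<alpha> / \<epsilon> * c)) (at x)"
      for c x y :: real
      using e by (auto intro!: derivative_eq_intros)
    have tb: "0 \<le> 1 - (tanh (z::real))\<^sup>2" for z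
    proof -
      have "\<bar>tanh z\<bar> \<le> 1" using tanh_real_lt_1[of z] tanh_real_gt_neg1[of z] by linarith
      then show ?thesis by (simp add: abs_square_le_1)
    qed
    have "T * ?\<Psi> (w p) \<le> \<epsilon> * ?E"
    proof (cases "p = x0")
      case True
      have "\<bar>tanh (\<alpha> / \<epsilon> * (-1 * (x1 - x1))) * ?\<Psi> (w x1) - tanh (\<alpha> / \<epsilon> * (-1 * (x0 - x1))) * ?\<Psi> (w x0)\<bar> \<le> \<epsilon> * ?E"
        by (rule tail_calibration[OF sm \<sigma> \<open>x0 \<le> x1\<close> w bd close, where \<tau> = "\<lambda>x. tanh (\<alpha> / \<epsilon> * (-1 * (x - x1)))"])
           (use d[of "-1" x1] \<alpha> e tb tanh_real_lt_1 in \<open>auto simp: abs_mult less_imp_le\<close>)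
      then show ?thesis using True by (simp add: T_def)
    next
      case False
      have "\<bar>tanh (\<alpha> / \<epsilon> * (1 * (x1 - x0))) * ?\<Psi> (w x1) - tanh (\<alpha> / \<epsilon> * (1 * (x0 - x0))) * ?\<Psi> (w x0)\<bar> \<le> \<epsilon> * ?E"
        by (rule tail_calibration[OF sm \<sigma> \<open>x0 \<le> x1\<close> w bd close, where \<tau> = "\<lambda>x. tanh (\<alpha> / \<epsilon> * (1 * (x - x0)))"])
           (use d[of 1 x0] \<alpha> e tb tanh_real_lt_1 in \<open>auto simp: abs_mult less_imp_le\<close>)
      then show ?thesis using False p by (simp add: T_def)
    qed
    moreover have "?\<Psi> (w p) - T * ?\<Psi> (w p) \<le> \<epsilon> * (?C * exp (- 2 * \<alpha> * (x1 - x0) / \<epsilon>))"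
    proof -
      have "1 - T \<le> 2 * exp (- 2 * \<alpha> * (x1 - x0) / \<epsilon>)"
        using tanh_ge[of "\<alpha> / \<epsilon> * (x1 - x0)"] by (simp add: T_def algebra_simps)
      then have "(1 - T) * ?\<Psi> (w p) \<le> 2 * exp (- 2 * \<alpha> * (x1 - x0) / \<epsilon>) * ?\<Psi> (w p)" by (rule mult_right_mono) simp
      also have "\<dots> = exp (- 2 * \<alpha> * (x1 - x0) / \<epsilon>) * (2 * ?\<Psi> (w p))" by simp
      also have "\<dots> \<le> exp (- 2 * \<alpha> * (x1 - x0) / \<epsilon>) * (\<epsilon> * ?C)" using Psi_p by (intro mult_left_mono) auto
      finally show ?thesis by (simp add: algebra_simps)
    qed
    ultimately show ?thesis by linarith
  qed
qed

end


section \<open>Lower bound for the energy near a step function\<close>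

lemma integral_gap_le:
  fixes f :: "real \<Rightarrow> real"
  assumes "f integrable_on {a..d}" "\<And>x. x \<in> {a..d} \<Longrightarrow> 0 \<le> f x" "a \<le> b" "b \<le> c" "c \<le> d"
  shows "integral {a..b} f + integral {c..d} f \<le> integral {a..d} f"
proof -
  have i: "f integrable_on {s..t}" if "a \<le> s" "t \<le> d" for s t
    using integrable_subinterval_real[OF assms(1)] that by auto
  have "integral {a..b} f + integral {b..d} f = integral {a..d} f"
    using assms by (intro Henstock_Kurzweil_Integration.integral_combine) auto
  moreover have "integral {b..c} f + integral {c..d} f = integral {b..d} f"
    using assms i by (intro Henstock_Kurzweil_Integration.integral_combine) auto
  moreover have "0 \<le> integral {b..c} f"
    using assms i by (intro Henstock_Kurzweil_Integration.integral_nonneg) auto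
  ultimately show ?thesis by linarith
qed

lemma step_function_separated:
  assumes "step_function a b N h v" "separation_radius a b N h r"
  shows "\<And>i. i \<in> {1..N} \<Longrightarrow> a \<le> h i - r \<and> h i + r \<le> b"
    and "\<And>i. i \<in> {1..N} \<Longrightarrow> Suc i \<in> {1..N} \<Longrightarrow> h i + r \<le> h (Suc i) - r"
    and "\<And>i. i \<in> {1..N} \<Longrightarrow> \<exists>\<sigma>l \<sigma>r. \<sigma>l \<in> {1, -1} \<and> \<sigma>r \<in> {1, -1} \<and> \<sigma>l \<noteq> \<sigma>r
        \<and> (\<forall>x\<in>{h i - r<..<h i}. v x = \<sigma>l) \<and> (\<forall>x\<in>{h i<..<h i + r}. v x = \<sigma>r)"
proof -
  have r: "0 < r" and disj: "disjoint_family_on (\<lambda>i. {h i - r<..<h i + r}) {1..N}"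
    and ends: "a \<le> h 1 - r" "h N + r \<le> b"
    using assms(2) by (auto simp: separation_radius_def)
  have N: "N \<ge> 1" and mono: "strict_mono_on {1..N} h"
    and v: "\<And>x. x \<in> {a..b} \<Longrightarrow> v x \<in> {-1, 1}"
    and const: "\<And>x y. x \<in> {a..b} \<Longrightarrow> y \<in> {a..b} \<Longrightarrow> x \<le> y \<Longrightarrow> {x..y} \<inter> h ` {1..N} = {} \<Longrightarrow> v x = v y"
    and jump: "\<And>i. i \<in> {1..N} \<Longrightarrow> \<exists>l l'. l \<noteq> l' \<and> (v \<longlongrightarrow> l) (at_left (h i)) \<and> (v \<longlongrightarrow> l') (at_right (h i))"
    using assms(1) by (auto simp: step_function_def)
  have h_mono: "h i \<le> h j" if "i \<in> {1..N}" "j \<in> {1..N}" "i \<le> j" for i j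
    using strict_mono_onD[OF mono that(1,2)] that(3) by (cases "i = j") auto
  show inside: "a \<le> h i - r \<and> h i + r \<le> b" if "i \<in> {1..N}" for i
    using h_mono[of 1 i] h_mono[of i N] that ends N by auto
  have iso: "h j \<notin> {h i - r<..<h i + r}" if "i \<in> {1..N}" "j \<in> {1..N}" "i \<noteq> j" for i j
  proof
    assume "h j \<in> {h i - r<..<h i + r}"
    moreover have "h j \<in> {h j - r<..<h j + r}" using r by simp
    ultimately show False using disj that unfolding disjoint_family_on_def by blast
  qed
  show "h i + r \<le> h (Suc i) - r" if i: "i \<in> {1..N}" "Suc i \<in> {1..N}" for i
  proof (rule ccontr)
    assume "\<not> h i + r \<le> h (Suc i) - r"
    moreover have "h i < h (Suc i)" using strict_mono_onD[OF mono i] by simp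
    ultimately have "(h i + h (Suc i)) / 2 \<in> {h i - r<..<h i + r} \<inter> {h (Suc i) - r<..<h (Suc i) + r}"
      using r by auto
    then show False using disj i unfolding disjoint_family_on_def by (metis empty_iff n_not_Suc_n)
  qed
  show "\<exists>\<sigma>l \<sigma>r. \<sigma>l \<in> {1, -1} \<and> \<sigma>r \<in> {1, -1} \<and> \<sigma>l \<noteq> \<sigma>r
      \<and> (\<forall>x\<in>{h i - r<..<h i}. v x = \<sigma>l) \<and> (\<forall>x\<in>{h i<..<h i + r}. v x = \<sigma>r)" if i: "i \<in> {1..N}" for i
  proof -
    have free: "{x..y} \<inter> h ` {1..N} = {}" if "{x..y} \<subseteq> {h i - r<..<h i + r} - {h i}" for x y
    proof -
      have "h j \<notin> {x..y}" if j: "j \<in> {1..N}" for j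
        using iso[OF i j] \<open>{x..y} \<subseteq> {h i - r<..<h i + r} - {h i}\<close> by (cases "i = j") auto
      then show ?thesis by blast
    qed
    have eq: "v x = v y" if "{min x y..max x y} \<subseteq> {h i - r<..<h i + r} - {h i}" for x y
    proof -
      have "{min x y..max x y} \<subseteq> {a..b}" using that inside[OF i] by fastforce
      then have "v (min x y) = v (max x y)"
        using free[OF that] by (intro const) (auto simp: min_def max_def)
      then show ?thesis by (auto simp: min_def max_def split: if_splits)
    qed
    define \<sigma>l \<sigma>r where "\<sigma>l = v (h i - r / 2)" and "\<sigma>r = v (h i + r / 2)"
    have L: "v x = \<sigma>l" if "x \<in> {h i - r<..<h i}" for x
      unfolding \<sigma>l_def using that r by (intro eq) auto
    have R: "v x = \<sigma>r" if "x \<in> {h i<..<h i + r}" for x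
      unfolding \<sigma>r_def using that r by (intro eq) auto
    obtain l l' where l: "l \<noteq> l'" "(v \<longlongrightarrow> l) (at_left (h i))" "(v \<longlongrightarrow> l') (at_right (h i))"
      using jump[OF i] by blast
    have "\<forall>\<^sub>F x in at_left (h i). x \<in> {h i - r<..<h i}"
      using r by (intro eventually_at_leftI[of "h i - r"]) auto
    then have "\<forall>\<^sub>F x in at_left (h i). v x = \<sigma>l" by eventually_elim (rule L)
    then have "(v \<longlongrightarrow> \<sigma>l) (at_left (h i))" by (rule tendsto_eventually)
    then have "l = \<sigma>l" using l(2) by (rule tendsto_unique[OF trivial_limit_at_left_real, rotated])
    have "\<forall>\<^sub>F x in at_right (h i). x \<in> {h i<..<h i + r}"
      using r by (intro eventually_at_rightI[of _ "h i + r"]) auto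
    then have "\<forall>\<^sub>F x in at_right (h i). v x = \<sigma>r" by eventually_elim (rule R)
    then have "(v \<longlongrightarrow> \<sigma>r) (at_right (h i))" by (rule tendsto_eventually)
    then have "l' = \<sigma>r" using l(3) by (rule tendsto_unique[OF trivial_limit_at_right_real, rotated])
    have "\<sigma>l \<in> {1, -1}" "\<sigma>r \<in> {1, -1}"
      using v[of "h i - r / 2"] v[of "h i + r / 2"] inside[OF i] r by (auto simp: \<sigma>l_def \<sigma>r_def)
    then show ?thesis using L R l(1) \<open>l = \<sigma>l\<close> \<open>l' = \<sigma>r\<close> by blast
  qed
qed

text \<open>Otherwise the integral over \<open>{s<..<t}\<close> alone would exceed the \<open>L\<^sup>1\<close> norm.\<close>

lemma L1_close_point:
  assumes "a \<le> s" "s < t" "t \<le> b" "0 \<le> d" and L1: "L1_norm a b (\<lambda>x. w x - v x) < ennreal (d * (t - s))"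
    and v: "\<And>x. x \<in> {s<..<t} \<Longrightarrow> v x = \<sigma>"
  obtains x where "x \<in> {s<..<t}" "\<bar>w x - \<sigma>\<bar> \<le> d"
proof -
  have "\<exists>x\<in>{s<..<t}. \<bar>w x - \<sigma>\<bar> \<le> d"
  proof (rule ccontr)
    assume far: "\<not> (\<exists>x\<in>{s<..<t}. \<bar>w x - \<sigma>\<bar> \<le> d)"
    have st: "{s<..<t} \<in> sets (lebesgue_on {a<..<b})"
      using assms by (auto simp: sets_restrict_space_iff)
    have "ennreal (d * (t - s)) = ennreal d * emeasure (lebesgue_on {a<..<b}) {s<..<t}"
      using assms by (subst emeasure_restrict_space) (auto simp: ennreal_mult)
    also have "\<dots> = (\<integral>\<^sup>+x. ennreal d * indicator {s<..<t} x \<partial>lebesgue_on {a<..<b})"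
      by (rule nn_integral_cmult_indicator[OF st, symmetric])
    also have "\<dots> \<le> L1_norm a b (\<lambda>x. w x - v x)"
      unfolding L1_norm_def
    proof (rule nn_integral_mono)
      fix x
      show "ennreal d * indicator {s<..<t} x \<le> ennreal \<bar>w x - v x\<bar>"
      proof (cases "x \<in> {s<..<t}")
        case True
        then have "d \<le> \<bar>w x - v x\<bar>" using far v[of x] by force
        then show ?thesis using True by (simp add: ennreal_leI)
      qed simp
    qed
    finally show False using L1 by simp
  qed
  then show thesis using that by blast
qed

context wells
begin

text \<open>The tail on the left, the transition between \<open>xl\<close> and \<open>xr\<close> and the tail on the right together pay for
  the way from \<open>\<sigma>l\<close> to \<open>\<sigma>r\<close>, by the triangle inequality. The values at \<open>xl\<close> and \<open>xr\<close> may lie on either side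
  of the wells.\<close>

lemma single_transition:
  assumes sm: "small \<epsilon>" and F1: "\<And>s. s \<in> {-1..1} \<Longrightarrow> \<epsilon>\<^sup>2 * F s \<le> legendre Q \<kappa>"
    and \<delta>1: "0 \<le> \<delta>1" "\<delta>1 \<le> \<delta>" "2 * sqrt (q2 * lam2) * \<delta>1\<^sup>2 \<le> sqrt (q1 * lam1) * \<delta>\<^sup>2"
    and \<rho>: "\<rho> < r" and w: "C1_on_interval (h - r) (h + r) w w'"
    and bd: "\<And>x. x \<in> {h - r..h + r} \<Longrightarrow> \<bar>\<epsilon>\<^sup>2 * w' x\<bar> \<le> \<kappa>"
    and \<sigma>: "\<sigma>l \<in> {1, -1}" "\<sigma>r \<in> {1, -1}" "\<sigma>l \<noteq> \<sigma>r"
    and xl: "h - \<rho> < xl" "xl < h" "\<bar>w xl - \<sigma>l\<bar> \<le> \<delta>1"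
    and xr: "h < xr" "xr < h + \<rho>" "\<bar>w xr - \<sigma>r\<bar> \<le> \<delta>1"
  shows "c_min Q F \<kappa> \<epsilon> - 2 * (sqrt (q2 * lam2) * \<delta>1\<^sup>2) * exp (- 2 * \<alpha> * (r - \<rho>) / \<epsilon>)
    \<le> integral {h - r..h + r} (\<lambda>x. edens \<epsilon> (w' x) (w x))"
proof -
  have e: "0 < \<epsilon>" using sm by (simp add: small_def)
  let ?e = "\<lambda>x. edens \<epsilon> (w' x) (w x)"
  define C where "C = sqrt (q2 * lam2) * \<delta>1\<^sup>2"
  define X where "X = exp (- 2 * \<alpha> * (r - \<rho>) / \<epsilon>)"
  have C: "0 \<le> C" using q2 lam_pos by (simp add: C_def)
  have exp_le: "exp (- 2 * \<alpha> * l / \<epsilon>) \<le> X" if "r - \<rho> \<le> l" for l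
    unfolding X_def using that e \<alpha> by (auto intro!: divide_right_mono mult_left_mono)
  have I1: "\<bar>cost \<epsilon> (w xl) - cost \<epsilon> \<sigma>l\<bar> - \<epsilon> * (C * X) \<le> \<epsilon> * integral {h - r..xl} ?e"
  proof -
    have "\<bar>cost \<epsilon> (w xl) - cost \<epsilon> \<sigma>l\<bar> - \<epsilon> * (sqrt (q2 * lam2) * \<delta>1\<^sup>2 * exp (- 2 * \<alpha> * (xl - (h - r)) / \<epsilon>)) \<le> \<epsilon> * integral {h - r..xl} ?e"
      by (rule tail_cost[OF sm \<sigma>(1) _ C1_on_interval_subset[OF w] _ \<delta>1]) (use xl xr \<rho> bd in auto)
    moreover have "\<epsilon> * (C * exp (- 2 * \<alpha> * (xl - (h - r)) / \<epsilon>)) \<le> \<epsilon> * (C * X)"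
      using e C xl by (intro mult_left_mono exp_le) auto
    ultimately show ?thesis by (simp add: C_def)
  qed
  have I3: "\<bar>cost \<epsilon> (w xr) - cost \<epsilon> \<sigma>r\<bar> - \<epsilon> * (C * X) \<le> \<epsilon> * integral {xr..h + r} ?e"
  proof -
    have "\<bar>cost \<epsilon> (w xr) - cost \<epsilon> \<sigma>r\<bar> - \<epsilon> * (sqrt (q2 * lam2) * \<delta>1\<^sup>2 * exp (- 2 * \<alpha> * ((h + r) - xr) / \<epsilon>)) \<le> \<epsilon> * integral {xr..h + r} ?e"
      by (rule tail_cost[OF sm \<sigma>(2) _ C1_on_interval_subset[OF w] _ \<delta>1]) (use xl xr \<rho> bd in auto)
    moreover have "\<epsilon> * (C * exp (- 2 * \<alpha> * ((h + r) - xr) / \<epsilon>)) \<le> \<epsilon> * (C * X)"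
      using e C xr by (intro mult_left_mono exp_le) auto
    ultimately show ?thesis by (simp add: C_def)
  qed
  have I2: "\<bar>cost \<epsilon> (w xr) - cost \<epsilon> (w xl)\<bar> \<le> \<epsilon> * integral {xl..xr} ?e"
    by (rule transition_cost(1)[OF e _ C1_on_interval_subset[OF w]]) (use xl xr \<rho> bd in auto)
  have int: "?e integrable_on {h - r..h + r}"
    by (rule transition_cost(2)[OF e _ w bd]) (use xl xr \<rho> in auto)
  have nn: "0 \<le> ?e x" if "x \<in> {h - r..h + r}" for x using edens_nonneg[OF e bd[OF that]] .
  have int': "?e integrable_on {h - r..xr}"
    by (rule integrable_subinterval_real[OF int]) (use xl xr \<rho> in auto)
  have "integral {h - r..xl} ?e + integral {xl..xr} ?e \<le> integral {h - r..xr} ?e"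
    by (rule integral_gap_le[OF int']) (use xl xr \<rho> nn in auto)
  moreover have "integral {h - r..xr} ?e + integral {xr..h + r} ?e \<le> integral {h - r..h + r} ?e"
    by (rule integral_gap_le[OF int]) (use xl xr \<rho> nn in auto)
  ultimately have sum: "\<epsilon> * (integral {h - r..xl} ?e + integral {xl..xr} ?e + integral {xr..h + r} ?e) \<le> \<epsilon> * integral {h - r..h + r} ?e"
    using e by (intro mult_left_mono) auto
  have "\<epsilon> * c_min Q F \<kappa> \<epsilon> = cost \<epsilon> 1 - cost \<epsilon> (-1)"
    using c_min_eq[OF e F1] e by simp
  also have "\<dots> \<le> \<bar>cost \<epsilon> \<sigma>r - cost \<epsilon> \<sigma>l\<bar>" using \<sigma> by auto
  also have "\<dots> \<le> \<bar>cost \<epsilon> (w xl) - cost \<epsilon> \<sigma>l\<bar> + \<bar>cost \<epsilon> (w xr) - cost \<epsilon> (w xl)\<bar> + \<bar>cost \<epsilon> (w xr) - cost \<epsilon> \<sigma>r\<bar>"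
    by linarith
  also have "\<dots> \<le> \<epsilon> * integral {h - r..h + r} ?e + 2 * (\<epsilon> * (C * X))"
    using I1 I2 I3 sum by (simp only: distrib_left)
  finally have "\<epsilon> * c_min Q F \<kappa> \<epsilon> \<le> \<epsilon> * (integral {h - r..h + r} ?e + 2 * C * X)"
    by (simp add: algebra_simps)
  then show ?thesis using e by (simp add: C_def X_def)
qed

theorem energy_lower_bound:
  assumes st: "step_function a b N h v" and sep: "separation_radius a b N h r"
    and sm: "small \<epsilon>" and F1: "\<And>s. s \<in> {-1..1} \<Longrightarrow> \<epsilon>\<^sup>2 * F s \<le> legendre Q \<kappa>"
    and \<delta>1: "0 < \<delta>1" "\<delta>1 \<le> \<delta>" "2 * sqrt (q2 * lam2) * \<delta>1\<^sup>2 \<le> sqrt (q1 * lam1) * \<delta>\<^sup>2"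
    and \<rho>: "0 < \<rho>" "\<rho> < r" and w: "C1_on_interval a b w w'"
    and bd: "\<And>x. x \<in> {a..b} \<Longrightarrow> \<bar>\<epsilon>\<^sup>2 * w' x\<bar> \<le> \<kappa>"
    and L1: "L1_norm a b (\<lambda>x. w x - v x) < ennreal (\<delta>1 * \<rho>)"
  shows "real N * (c_min Q F \<kappa> \<epsilon> - 2 * (sqrt (q2 * lam2) * \<delta>1\<^sup>2) * exp (- 2 * \<alpha> * (r - \<rho>) / \<epsilon>))
    \<le> integral {a..b} (\<lambda>x. edens \<epsilon> (w' x) (w x))"
proof -
  have e: "0 < \<epsilon>" using sm by (simp add: small_def)
  let ?e = "\<lambda>x. edens \<epsilon> (w' x) (w x)"
  let ?X = "c_min Q F \<kappa> \<epsilon> - 2 * (sqrt (q2 * lam2) * \<delta>1\<^sup>2) * exp (- 2 * \<alpha> * (r - \<rho>) / \<epsilon>)"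
  note S = step_function_separated[OF st sep]
  have N: "N \<ge> 1" using st by (simp add: step_function_def)
  have "a \<le> b" using S(1)[of 1] N \<rho> by auto
  have int: "?e integrable_on {a..b}" by (rule transition_cost(2)[OF e \<open>a \<le> b\<close> w bd])
  have nn: "0 \<le> ?e x" if "x \<in> {a..b}" for x using edens_nonneg[OF e bd[OF that]] .
  have one: "?X \<le> integral {h i - r..h i + r} ?e" if i: "i \<in> {1..N}" for i
  proof -
    obtain \<sigma>l \<sigma>r where \<sigma>: "\<sigma>l \<in> {1, -1}" "\<sigma>r \<in> {1, -1}" "\<sigma>l \<noteq> \<sigma>r"
      and vl: "\<And>x. x \<in> {h i - r<..<h i} \<Longrightarrow> v x = \<sigma>l" and vr: "\<And>x. x \<in> {h i<..<h i + r} \<Longrightarrow> v x = \<sigma>r"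
      using S(3)[OF i] by blast
    obtain xl where xl: "xl \<in> {h i - \<rho><..<h i}" "\<bar>w xl - \<sigma>l\<bar> \<le> \<delta>1"
    proof (rule L1_close_point)
      show "L1_norm a b (\<lambda>x. w x - v x) < ennreal (\<delta>1 * (h i - (h i - \<rho>)))" using L1 by simp
      show "v x = \<sigma>l" if "x \<in> {h i - \<rho><..<h i}" for x using that \<rho> by (intro vl) auto
    qed (use S(1)[OF i] \<rho> \<delta>1 in auto)
    obtain xr where xr: "xr \<in> {h i<..<h i + \<rho>}" "\<bar>w xr - \<sigma>r\<bar> \<le> \<delta>1"
    proof (rule L1_close_point)
      show "L1_norm a b (\<lambda>x. w x - v x) < ennreal (\<delta>1 * ((h i + \<rho>) - h i))" using L1 by simp
      show "v x = \<sigma>r" if "x \<in> {h i<..<h i + \<rho>}" for x using that \<rho> by (intro vr) auto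
    qed (use S(1)[OF i] \<rho> \<delta>1 in auto)
    show ?thesis
      by (rule single_transition[OF sm F1 _ \<delta>1(2,3) \<rho>(2) C1_on_interval_subset[OF w] _ \<sigma> _ _ xl(2) _ _ xr(2)])
         (use S(1)[OF i] xl(1) xr(1) \<delta>1 bd in auto)
  qed
  \<comment> \<open>The right end of the region that belongs to the first \<open>n\<close> jumps.\<close>
  define E where "E n = (if n = 0 then a else h n + r)" for n
  have "real n * ?X \<le> integral {a..E n} ?e" if "n \<le> N" for n
    using that
  proof (induction n)
    case 0
    then show ?case by (simp add: E_def)
  next
    case (Suc n)
    have i: "Suc n \<in> {1..N}" using Suc.prems by simp
    have En: "a \<le> E n" "E n \<le> h (Suc n) - r"
      using S(1)[OF i] S(1)[of n] S(2)[of n] i \<rho> by (auto simp: E_def)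
    have "integral {a..E n} ?e + integral {h (Suc n) - r..h (Suc n) + r} ?e \<le> integral {a..h (Suc n) + r} ?e"
    proof (rule integral_gap_le)
      show "?e integrable_on {a..h (Suc n) + r}"
        using S(1)[OF i] by (intro integrable_subinterval_real[OF int]) auto
      show "0 \<le> ?e x" if "x \<in> {a..h (Suc n) + r}" for x using that S(1)[OF i] by (intro nn) auto
    qed (use En \<rho> in auto)
    with Suc.IH Suc.prems one[OF i] have "real n * ?X + ?X \<le> integral {a..h (Suc n) + r} ?e" by linarith
    then show ?case by (simp add: E_def distrib_right add.commute)
  qed
  from this[of N] have "real N * ?X \<le> integral {a..h N + r} ?e" using N by (simp add: E_def)
  also have "integral {a..h N + r} ?e \<le> integral {a..b} ?e"
  proof (rule integral_subset_le)
    show "?e integrable_on {a..h N + r}"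
      using S(1)[of N] N by (intro integrable_subinterval_real[OF int]) auto
  qed (use S(1)[of N] N int nn in auto)
  finally show ?thesis .
qed

end


section \<open>Curves in a Sobolev space\<close>

lemma integrable_Leb_continuous: "continuous_on {a..b} f \<Longrightarrow> integrable (Leb a b) (f :: real \<Rightarrow> real)"
  by (simp add: integrable_Leb_iff absolutely_integrable_continuous_real)

lemma integrable_Leb_mult_continuous:
  fixes c g :: "real \<Rightarrow> real"
  assumes c: "continuous_on {a..b} c" and g: "integrable (Leb a b) g"
  shows "integrable (Leb a b) (\<lambda>x. c x * g x)"
  unfolding integrable_Leb_iff
proof (rule absolutely_integrable_bounded_measurable_product_real)
  show "c \<in> borel_measurable (lebesgue_on {a..b})"
    by (rule continuous_imp_measurable_on_sets_lebesgue[OF c]) simp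
  show "bounded (c ` {a..b})" by (intro compact_imp_bounded compact_continuous_image c) simp
qed (use g in \<open>simp_all add: integrable_Leb_iff\<close>)

lemma integrable_Leb_const: "integrable (Leb a b) (\<lambda>x. k :: real)"
  by (rule integrable_Leb_continuous) simp

lemma LINT_Leb_const: "a \<le> b \<Longrightarrow> (LINT x|Leb a b. (k :: real)) = (b - a) * k"
  by (simp add: measure_restrict_space)

lemma in_L2_integrable:
  assumes "in_L2 a b f"
  shows "integrable (Leb a b) f"
proof (rule Bochner_Integration.integrable_bound)
  show "integrable (Leb a b) (\<lambda>x. 1 + (f x)\<^sup>2)"
    using assms by (simp add: in_L2_def integrable_Leb_const)
  show "AE x in Leb a b. norm (f x) \<le> norm (1 + (f x)\<^sup>2)"
  proof (rule AE_I2)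
    fix x show "norm (f x) \<le> norm (1 + (f x)\<^sup>2)"
      using sum_squares_bound[of 1 "\<bar>f x\<bar>"] by simp
  qed
qed (use assms in \<open>simp add: in_L2_def\<close>)

lemma in_L2_continuous: "continuous_on {a..b} f \<Longrightarrow> in_L2 a b f"
  unfolding in_L2_def
  by (intro conjI borel_measurable_integrable integrable_Leb_continuous continuous_intros)

lemma in_L2_diff:
  assumes "in_L2 a b f" "in_L2 a b g"
  shows "in_L2 a b (\<lambda>x. f x - g x)"
  unfolding in_L2_def
proof
  show m: "(\<lambda>x. f x - g x) \<in> borel_measurable (Leb a b)" using assms by (auto simp: in_L2_def)
  show "integrable (Leb a b) (\<lambda>x. (f x - g x)\<^sup>2)"
  proof (rule Bochner_Integration.integrable_bound)
    show "integrable (Leb a b) (\<lambda>x. 2 * (f x)\<^sup>2 + 2 * (g x)\<^sup>2)" using assms by (simp add: in_L2_def)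
    show "AE x in Leb a b. norm ((f x - g x)\<^sup>2) \<le> norm (2 * (f x)\<^sup>2 + 2 * (g x)\<^sup>2)"
    proof (rule AE_I2)
      fix x have "0 \<le> (f x + g x)\<^sup>2" by simp
      then have "(f x - g x)\<^sup>2 \<le> 2 * (f x)\<^sup>2 + 2 * (g x)\<^sup>2"
        by (simp add: power2_eq_square algebra_simps)
      then show "norm ((f x - g x)\<^sup>2) \<le> norm (2 * (f x)\<^sup>2 + 2 * (g x)\<^sup>2)" by simp
    qed
  qed (use m in simp)
qed

lemma L1_le_L2:
  assumes "a < b" "in_L2 a b f"
  shows "(LINT x|Leb a b. \<bar>f x\<bar>)\<^sup>2 \<le> (b - a) * (LINT x|Leb a b. (f x)\<^sup>2)"
proof -
  define I m where "I = (LINT x|Leb a b. \<bar>f x\<bar>)" and "m = I / (b - a)"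
  have i: "integrable (Leb a b) (\<lambda>x. \<bar>f x\<bar>)" "integrable (Leb a b) (\<lambda>x. (f x)\<^sup>2)"
    using assms in_L2_integrable[OF assms(2)] by (auto simp: in_L2_def)
  have "(LINT x|Leb a b. 0) \<le> (LINT x|Leb a b. (f x)\<^sup>2 - 2 * m * \<bar>f x\<bar> + m\<^sup>2)"
  proof (rule Bochner_Integration.integral_mono)
    show "integrable (Leb a b) (\<lambda>x. (f x)\<^sup>2 - 2 * m * \<bar>f x\<bar> + m\<^sup>2)"
      using i integrable_Leb_const by simp
    fix x
    have "(f x)\<^sup>2 - 2 * m * \<bar>f x\<bar> + m\<^sup>2 = (\<bar>f x\<bar> - m)\<^sup>2" by (simp add: power2_eq_square algebra_simps)
    then show "0 \<le> (f x)\<^sup>2 - 2 * m * \<bar>f x\<bar> + m\<^sup>2" by simp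
  qed simp
  also have "\<dots> = (LINT x|Leb a b. (f x)\<^sup>2) - 2 * m * I + (b - a) * m\<^sup>2"
    using i integrable_Leb_const \<open>a < b\<close> by (simp add: I_def measure_restrict_space)
  finally have *: "0 \<le> (LINT x|Leb a b. (f x)\<^sup>2) - 2 * m * I + (b - a) * m\<^sup>2" by simp
  have mI: "(b - a) * m = I" using \<open>a < b\<close> by (simp add: m_def)
  then have "(b - a) * m\<^sup>2 = m * I" by (simp add: power2_eq_square flip: mult.assoc)
  with * have "m * I \<le> (LINT x|Leb a b. (f x)\<^sup>2)" by (simp add: mult.commute)
  then have "(b - a) * (m * I) \<le> (b - a) * (LINT x|Leb a b. (f x)\<^sup>2)" using \<open>a < b\<close> by simp
  moreover have "(b - a) * (m * I) = I\<^sup>2" by (simp only: mult.assoc[symmetric] mI power2_eq_square)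
  ultimately show ?thesis by (simp only: I_def)
qed

text \<open>\<open>\<bar>y x\<bar> - \<bar>y s\<bar>\<close> is at most the integral of \<open>\<bar>y'\<bar>\<close>; average over \<open>s\<close>.\<close>

lemma sup_le_W11:
  assumes "a < b" and y: "C1_on_interval a b y y'" and x: "x \<in> {a..b}"
  shows "\<bar>y x\<bar> \<le> (LINT s|Leb a b. \<bar>y s\<bar>) / (b - a) + (LINT s|Leb a b. \<bar>y' s\<bar>)"
proof -
  define B where "B = (LINT s|Leb a b. \<bar>y' s\<bar>)"
  have cy': "continuous_on {a..b} (\<lambda>s. \<bar>y' s\<bar>)" using y by (auto simp: C1_on_interval_def intro: continuous_intros)
  have cy: "continuous_on {a..b} (\<lambda>s. \<bar>y s\<bar>)"
    using abs_cont_continuous[OF abs_cont_C1[OF y]] by (intro continuous_intros)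
  have B: "B = integral {a..b} (\<lambda>s. \<bar>y' s\<bar>)"
    unfolding B_def by (intro LINT_Leb absolutely_integrable_continuous_real cy')
  have inc: "\<bar>y t - y s\<bar> \<le> B" if "a \<le> s" "s \<le> t" "t \<le> b" for s t
  proof -
    have c: "continuous_on {s..t} y'" "continuous_on {s..t} (\<lambda>s. \<bar>y' s\<bar>)"
      using y cy' that by (auto simp: C1_on_interval_def intro: continuous_on_subset)
    have "\<bar>y t - y s\<bar> = \<bar>integral {s..t} y'\<bar>" using abs_contD(2)[OF abs_cont_C1[OF y] that] by simp
    also have "\<dots> \<le> integral {s..t} (\<lambda>s. \<bar>y' s\<bar>)"
      using integral_norm_bound_integral[of y' "{s..t}" "\<lambda>s. \<bar>y' s\<bar>"] c by (auto intro: integrable_continuous_real)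
    also have "\<dots> \<le> B" unfolding B using that c cy'
      by (intro integral_subset_le) (auto intro: integrable_continuous_real)
    finally show ?thesis .
  qed
  have "(LINT s|Leb a b. \<bar>y x\<bar> - B) \<le> (LINT s|Leb a b. \<bar>y s\<bar>)"
  proof (rule Bochner_Integration.integral_mono)
    fix s assume "s \<in> space (Leb a b)"
    then have s: "a \<le> s" "s \<le> b" by auto
    have "\<bar>y x - y s\<bar> \<le> B" using inc[of s x] inc[of x s] s x by (cases "s \<le> x") (auto simp: abs_minus_commute)
    then show "\<bar>y x\<bar> - B \<le> \<bar>y s\<bar>" by linarith
  qed (auto intro: integrable_Leb_const integrable_Leb_continuous cy)
  then have "(b - a) * (\<bar>y x\<bar> - B) \<le> (LINT s|Leb a b. \<bar>y s\<bar>)"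
    using \<open>a < b\<close> by (simp only: LINT_Leb_const)
  then show ?thesis using \<open>a < b\<close> by (simp add: B_def[symmetric] field_simps)
qed

text \<open>A curve of \<open>C\<^sup>1\<close> functions \<open>z s\<close> with space derivatives \<open>p s\<close> that is differentiable at the time \<open>t\<close> as a
  curve in \<open>H\<^sup>1\<close>. The time derivative \<open>U\<close> and its weak space derivative \<open>W\<close> are only square integrable.\<close>

locale H1_curve =
  fixes a b :: real and S :: "real set" and t :: real
    and z p :: "real \<Rightarrow> real \<Rightarrow> real" and U W :: "real \<Rightarrow> real"
  assumes ab: "a < b" and tS: "t \<in> S"
    and C1: "\<And>s. s \<in> S \<Longrightarrow> C1_on_interval a b (z s) (p s)"
    and L2: "in_L2 a b U" "in_L2 a b W"
    and lim: "((\<lambda>s. (LINT x|Leb a b. ((z s x - z t x) / (s - t) - U x)\<^sup>2)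
        + (LINT x|Leb a b. ((p s x - p t x) / (s - t) - W x)\<^sup>2)) \<longlongrightarrow> 0) (at t within S)"
begin

text \<open>The errors of the difference quotients in time.\<close>

definition "ez s x = (z s x - z t x) / (s - t) - U x"
definition "ep s x = (p s x - p t x) / (s - t) - W x"

lemma cont_z: "s \<in> S \<Longrightarrow> continuous_on {a..b} (z s)" and cont_p: "s \<in> S \<Longrightarrow> continuous_on {a..b} (p s)"
  using C1[of s] abs_cont_continuous[OF abs_cont_C1, of a b "z s" "p s"] by (auto simp: C1_on_interval_def)

lemma L2_err: "s \<in> S \<Longrightarrow> in_L2 a b (ez s)" "s \<in> S \<Longrightarrow> in_L2 a b (ep s)"
proof -
  assume s: "s \<in> S"
  have "continuous_on {a..b} (\<lambda>x. (1 / (s - t)) * (z s x - z t x))"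
    by (intro continuous_intros cont_z s tS)
  moreover have "continuous_on {a..b} (\<lambda>x. (1 / (s - t)) * (p s x - p t x))"
    by (intro continuous_intros cont_p s tS)
  ultimately show "in_L2 a b (ez s)" "in_L2 a b (ep s)"
    unfolding ez_def[abs_def] ep_def[abs_def]
    using in_L2_diff[OF in_L2_continuous L2(1)] in_L2_diff[OF in_L2_continuous L2(2)] by simp_all
qed

lemma evS: "\<forall>\<^sub>F s in at t within S. s \<in> S \<and> s \<noteq> t"
  by (auto simp: eventually_at_filter)

lemma err_square_tendsto:
  "((\<lambda>s. LINT x|Leb a b. (ez s x)\<^sup>2) \<longlongrightarrow> 0) (at t within S)"
  "((\<lambda>s. LINT x|Leb a b. (ep s x)\<^sup>2) \<longlongrightarrow> 0) (at t within S)"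
proof -
  have 0: "0 \<le> (LINT x|Leb a b. (ez s x)\<^sup>2)" "0 \<le> (LINT x|Leb a b. (ep s x)\<^sup>2)" for s
    by (auto intro: Bochner_Integration.integral_nonneg)
  show "((\<lambda>s. LINT x|Leb a b. (ez s x)\<^sup>2) \<longlongrightarrow> 0) (at t within S)"
    by (rule tendsto_sandwich[OF _ _ tendsto_const lim]) (use 0 in \<open>auto simp: ez_def ep_def\<close>)
  show "((\<lambda>s. LINT x|Leb a b. (ep s x)\<^sup>2) \<longlongrightarrow> 0) (at t within S)"
    by (rule tendsto_sandwich[OF _ _ tendsto_const lim]) (use 0 in \<open>auto simp: ez_def ep_def\<close>)
qed

lemma L1_tendsto_of_L2:
  assumes "((\<lambda>s. LINT x|Leb a b. (f s x)\<^sup>2) \<longlongrightarrow> 0) (at t within S)" "\<And>s. s \<in> S \<Longrightarrow> in_L2 a b (f s)"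
  shows "((\<lambda>s. LINT x|Leb a b. \<bar>f s x\<bar>) \<longlongrightarrow> 0) (at t within S)"
proof -
  have "((\<lambda>s. sqrt ((b - a) * (LINT x|Leb a b. (f s x)\<^sup>2))) \<longlongrightarrow> sqrt ((b - a) * 0)) (at t within S)"
    by (intro tendsto_intros assms)
  then have lim0: "((\<lambda>s. sqrt ((b - a) * (LINT x|Leb a b. (f s x)\<^sup>2))) \<longlongrightarrow> 0) (at t within S)" by simp
  have "\<forall>\<^sub>F s in at t within S. (LINT x|Leb a b. \<bar>f s x\<bar>) \<le> sqrt ((b - a) * (LINT x|Leb a b. (f s x)\<^sup>2))"
    using evS by eventually_elim (use L1_le_L2[OF ab assms(2)] in \<open>auto intro!: real_le_rsqrt\<close>)
  then have "\<forall>\<^sub>F s in at t within S. norm (LINT x|Leb a b. \<bar>f s x\<bar>) \<le> sqrt ((b - a) * (LINT x|Leb a b. (f s x)\<^sup>2))"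
    by eventually_elim simp
  then show ?thesis using lim0 by (rule Lim_null_comparison)
qed

lemmas err_L1_tendsto = L1_tendsto_of_L2[OF err_square_tendsto(1) L2_err(1)] L1_tendsto_of_L2[OF err_square_tendsto(2) L2_err(2)]

lemma increment_z: "s \<noteq> t \<Longrightarrow> z s x - z t x = (s - t) * (ez s x + U x)"
  and increment_p: "s \<noteq> t \<Longrightarrow> p s x - p t x = (s - t) * (ep s x + W x)"
  by (auto simp: ez_def ep_def)

lemma int_err: "s \<in> S \<Longrightarrow> integrable (Leb a b) (ez s)" "s \<in> S \<Longrightarrow> integrable (Leb a b) (ep s)"
  and int_UW: "integrable (Leb a b) U" "integrable (Leb a b) W"
  using L2_err L2 in_L2_integrable by auto

lemma increment_L1:
  assumes "s \<in> S" "s \<noteq> t"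
  shows "(LINT x|Leb a b. \<bar>z s x - z t x\<bar>) \<le> \<bar>s - t\<bar> * ((LINT x|Leb a b. \<bar>ez s x\<bar>) + (LINT x|Leb a b. \<bar>U x\<bar>))"
    "(LINT x|Leb a b. \<bar>p s x - p t x\<bar>) \<le> \<bar>s - t\<bar> * ((LINT x|Leb a b. \<bar>ep s x\<bar>) + (LINT x|Leb a b. \<bar>W x\<bar>))"
proof -
  have *: "(LINT x|Leb a b. \<bar>k * (f x + g x)\<bar>) \<le> \<bar>k\<bar> * ((LINT x|Leb a b. \<bar>f x\<bar>) + (LINT x|Leb a b. \<bar>g x\<bar>))"
    if "integrable (Leb a b) f" "integrable (Leb a b) g" for f g :: "real \<Rightarrow> real" and k
  proof -
    have "(LINT x|Leb a b. \<bar>k * (f x + g x)\<bar>) \<le> (LINT x|Leb a b. \<bar>k\<bar> * (\<bar>f x\<bar> + \<bar>g x\<bar>))"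
      using that by (intro Bochner_Integration.integral_mono) (auto simp: abs_mult intro!: mult_left_mono)
    then show ?thesis using that by simp
  qed
  show "(LINT x|Leb a b. \<bar>z s x - z t x\<bar>) \<le> \<bar>s - t\<bar> * ((LINT x|Leb a b. \<bar>ez s x\<bar>) + (LINT x|Leb a b. \<bar>U x\<bar>))"
    using *[OF int_err(1)[OF assms(1)] int_UW(1), of "s - t"] by (simp only: increment_z[OF assms(2)])
  show "(LINT x|Leb a b. \<bar>p s x - p t x\<bar>) \<le> \<bar>s - t\<bar> * ((LINT x|Leb a b. \<bar>ep s x\<bar>) + (LINT x|Leb a b. \<bar>W x\<bar>))"
    using *[OF int_err(2)[OF assms(1)] int_UW(2), of "s - t"] by (simp only: increment_p[OF assms(2)])
qed

lemma time_tendsto: "((\<lambda>s. \<bar>s - t\<bar>) \<longlongrightarrow> 0) (at t within S)"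
proof -
  have "((\<lambda>s. \<bar>s - t\<bar>) \<longlongrightarrow> \<bar>t - t\<bar>) (at t within S)" by (intro tendsto_intros)
  then show ?thesis by simp
qed

lemma L1_continuous: "((\<lambda>s. LINT x|Leb a b. \<bar>z s x - z t x\<bar>) \<longlongrightarrow> 0) (at t within S)"
proof (rule tendsto_sandwich[OF _ _ tendsto_const])
  show "\<forall>\<^sub>F s in at t within S. (LINT x|Leb a b. \<bar>z s x - z t x\<bar>)
      \<le> \<bar>s - t\<bar> * ((LINT x|Leb a b. \<bar>ez s x\<bar>) + (LINT x|Leb a b. \<bar>U x\<bar>))"
    using evS by eventually_elim (rule increment_L1; simp)
  have "((\<lambda>s. \<bar>s - t\<bar> * ((LINT x|Leb a b. \<bar>ez s x\<bar>) + (LINT x|Leb a b. \<bar>U x\<bar>)))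
      \<longlongrightarrow> 0 * (0 + (LINT x|Leb a b. \<bar>U x\<bar>))) (at t within S)"
    by (intro tendsto_intros time_tendsto err_L1_tendsto)
  then show "((\<lambda>s. \<bar>s - t\<bar> * ((LINT x|Leb a b. \<bar>ez s x\<bar>) + (LINT x|Leb a b. \<bar>U x\<bar>))) \<longlongrightarrow> 0) (at t within S)"
    by simp
qed (auto intro: Bochner_Integration.integral_nonneg)

text \<open>The embedding of \<open>W\<^sup>1\<^sup>,\<^sup>1\<close> into bounded functions, applied to the increment in time.\<close>

lemma uniform_continuous:
  assumes "0 < \<eta>"
  shows "\<forall>\<^sub>F s in at t within S. \<forall>x\<in>{a..b}. \<bar>z s x - z t x\<bar> < \<eta>"
proof -
  define G where "G s = \<bar>s - t\<bar> * ((LINT x|Leb a b. \<bar>ez s x\<bar>) + (LINT x|Leb a b. \<bar>U x\<bar>)) / (b - a)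
      + \<bar>s - t\<bar> * ((LINT x|Leb a b. \<bar>ep s x\<bar>) + (LINT x|Leb a b. \<bar>W x\<bar>))" for s
  have "(G \<longlongrightarrow> 0 * (0 + (LINT x|Leb a b. \<bar>U x\<bar>)) / (b - a) + 0 * (0 + (LINT x|Leb a b. \<bar>W x\<bar>))) (at t within S)"
    unfolding G_def using ab by (intro tendsto_intros time_tendsto err_L1_tendsto) auto
  then have "\<forall>\<^sub>F s in at t within S. G s < \<eta>" using assms by (intro order_tendstoD(2)) auto
  then show ?thesis using evS
  proof eventually_elim
    case (elim s)
    show ?case
    proof
      fix x assume x: "x \<in> {a..b}"
      have "C1_on_interval a b (\<lambda>x. z s x - z t x) (\<lambda>x. p s x - p t x)"
        using C1[of s] C1[OF tS] elim by (intro C1_on_interval_diff) auto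
      from sup_le_W11[OF ab this x]
      have "\<bar>z s x - z t x\<bar> \<le> (LINT x|Leb a b. \<bar>z s x - z t x\<bar>) / (b - a) + (LINT x|Leb a b. \<bar>p s x - p t x\<bar>)" .
      also have "\<dots> \<le> G s" unfolding G_def using elim ab
        by (intro add_mono divide_right_mono increment_L1) auto
      finally show "\<bar>z s x - z t x\<bar> < \<eta>" using elim by simp
    qed
  qed
qed

lemma derivative_of_integral:
  assumes f: "\<And>s. s \<in> S \<Longrightarrow> integrable (Leb a b) (f s)" and d: "integrable (Leb a b) d"
    and err: "\<And>e. 0 < e \<Longrightarrow> \<forall>\<^sub>F s in at t within S. \<exists>r. integrable (Leb a b) r
      \<and> (\<forall>x\<in>{a<..<b}. \<bar>(f s x - f t x) / (s - t) - d x\<bar> \<le> r x) \<and> (LINT x|Leb a b. r x) < e"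
  shows "((\<lambda>s. LINT x|Leb a b. f s x) has_real_derivative (LINT x|Leb a b. d x)) (at t within S)"
proof -
  have "((\<lambda>s. ((LINT x|Leb a b. f s x) - (LINT x|Leb a b. f t x)) / (s - t)) \<longlongrightarrow> (LINT x|Leb a b. d x)) (at t within S)"
  proof (rule tendstoI)
    fix e :: real assume "0 < e"
    from err[OF this] evS
    show "\<forall>\<^sub>F s in at t within S. dist (((LINT x|Leb a b. f s x) - (LINT x|Leb a b. f t x)) / (s - t)) (LINT x|Leb a b. d x) < e"
    proof eventually_elim
      case (elim s)
      then obtain r where r: "integrable (Leb a b) r" "(LINT x|Leb a b. r x) < e"
        "\<And>x. x \<in> {a<..<b} \<Longrightarrow> \<bar>(f s x - f t x) / (s - t) - d x\<bar> \<le> r x" by blast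
      have i: "integrable (Leb a b) (\<lambda>x. (f s x - f t x) / (s - t) - d x)"
        using f[of s] f[OF tS] d elim by auto
      have "((LINT x|Leb a b. f s x) - (LINT x|Leb a b. f t x)) / (s - t) - (LINT x|Leb a b. d x)
          = (LINT x|Leb a b. (f s x - f t x) / (s - t) - d x)"
        using f[of s] f[OF tS] d elim by simp
      also have "\<bar>\<dots>\<bar> \<le> (LINT x|Leb a b. \<bar>(f s x - f t x) / (s - t) - d x\<bar>)" by (rule integral_abs_bound)
      also have "\<dots> \<le> (LINT x|Leb a b. r x)"
        using i r by (intro Bochner_Integration.integral_mono) auto
      finally show ?case using r(2) by (simp add: dist_real_def)
    qed
  qed
  then show ?thesis by (simp add: has_field_derivative_iff)
qed

lemma inner_product_derivative:
  assumes y: "continuous_on {a..b} y"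
  shows "((\<lambda>s. LINT x|Leb a b. y x * z s x) has_real_derivative (LINT x|Leb a b. y x * U x)) (at t within S)"
proof (rule derivative_of_integral)
  have "bounded (y ` {a..b})" by (intro compact_imp_bounded compact_continuous_image y) simp
  then obtain B where B: "\<And>x. x \<in> {a..b} \<Longrightarrow> \<bar>y x\<bar> \<le> B"
    unfolding bounded_iff by fastforce
  fix e :: real assume "0 < e"
  have "((\<lambda>s. B * (LINT x|Leb a b. \<bar>ez s x\<bar>)) \<longlongrightarrow> B * 0) (at t within S)"
    by (intro tendsto_intros err_L1_tendsto)
  then have "\<forall>\<^sub>F s in at t within S. B * (LINT x|Leb a b. \<bar>ez s x\<bar>) < e"
    using \<open>0 < e\<close> by (intro order_tendstoD(2)) auto
  then show "\<forall>\<^sub>F s in at t within S. \<exists>r. integrable (Leb a b) r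
      \<and> (\<forall>x\<in>{a<..<b}. \<bar>(y x * z s x - y x * z t x) / (s - t) - y x * U x\<bar> \<le> r x) \<and> (LINT x|Leb a b. r x) < e"
    using evS
  proof eventually_elim
    case (elim s)
    show ?case
    proof (intro exI[of _ "\<lambda>x. B * \<bar>ez s x\<bar>"] conjI ballI)
      show "integrable (Leb a b) (\<lambda>x. B * \<bar>ez s x\<bar>)" using int_err elim by simp
      show "(LINT x|Leb a b. B * \<bar>ez s x\<bar>) < e" using elim by simp
      fix x assume "x \<in> {a<..<b}"
      then have "\<bar>y x\<bar> \<le> B" by (intro B) simp
      moreover have "(y x * z s x - y x * z t x) / (s - t) - y x * U x = y x * ez s x"
        by (simp add: ez_def algebra_simps diff_divide_distrib)
      ultimately show "\<bar>(y x * z s x - y x * z t x) / (s - t) - y x * U x\<bar> \<le> B * \<bar>ez s x\<bar>"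
        by (simp add: abs_mult mult_right_mono)
    qed
  qed
qed (rule integrable_Leb_mult_continuous[OF y]; auto intro: integrable_Leb_continuous cont_z int_UW)+

end


section \<open>Energy dissipation\<close>

lemma continuous_AE_eq_imp_eq:
  fixes f g :: "real \<Rightarrow> real"
  assumes "a < b" and c: "continuous_on {a..b} f" "continuous_on {a..b} g"
    and eq: "AE x in Leb a b. f x = g x" and x: "x \<in> {a..b}"
  shows "f x = g x"
proof -
  have h: "continuous_on {a..b} (\<lambda>x. (f x - g x)\<^sup>2)" by (intro continuous_intros c)
  have "integral {a..b} (\<lambda>x. (f x - g x)\<^sup>2) = (LINT x|Leb a b. (f x - g x)\<^sup>2)"
    by (intro LINT_Leb[symmetric] absolutely_integrable_continuous_real h)
  also have "\<dots> = 0"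
    by (rule integral_eq_zero_AE) (use eq in eventually_elim, simp)
  finally show ?thesis
    using integral_eq_0_iff[OF h] \<open>a < b\<close> x by auto
qed

locale energy_curve =
  reaction_diffusion Q \<kappa> F lam1 lam2 \<eta> + H1_curve a b S t z p U W
  for Q F :: "real \<Rightarrow> real" and \<kappa> lam1 lam2 \<eta> a b t :: real and S :: "real set"
    and z p :: "real \<Rightarrow> real \<Rightarrow> real" and U W :: "real \<Rightarrow> real" +
  fixes \<epsilon> :: real
  assumes eps: "0 < \<epsilon>" and slope: "\<And>s x. s \<in> S \<Longrightarrow> x \<in> {a..b} \<Longrightarrow> \<bar>\<epsilon>\<^sup>2 * p s x\<bar> \<le> \<kappa>"
begin

lemma cont_flux: "s \<in> S \<Longrightarrow> continuous_on {a..b} (\<lambda>x. Q (\<epsilon>\<^sup>2 * p s x))"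
  and cont_Qtilde_p: "s \<in> S \<Longrightarrow> continuous_on {a..b} (\<lambda>x. Qtilde Q (\<epsilon>\<^sup>2 * p s x))"
  and cont_F_z: "s \<in> S \<Longrightarrow> continuous_on {a..b} (\<lambda>x. F (z s x))"
  and cont_F'_z: "s \<in> S \<Longrightarrow> continuous_on {a..b} (\<lambda>x. deriv F (z s x))"
  by (auto intro!: continuous_on_compose2[OF cont_Q[of UNIV]] continuous_on_compose2[OF cont_Qt[of UNIV]] continuous_on_compose2[OF cont_F[of UNIV]]
      continuous_on_compose2[OF cont_deriv_F] continuous_on_mult continuous_on_const cont_p cont_z)

text \<open>The slopes \<open>p s\<close> need not converge uniformly as \<open>s\<close> tends to \<open>t\<close>, but they stay in the range where \<open>Q\<close> is
  Lipschitz continuous, so the second order remainder is bounded by the square of an \<open>L\<^sup>2\<close> norm.\<close>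

lemma Qtilde_integral_derivative:
  "((\<lambda>s. LINT x|Leb a b. Qtilde Q (\<epsilon>\<^sup>2 * p s x)) has_real_derivative
     (LINT x|Leb a b. (\<epsilon>\<^sup>2 * Q (\<epsilon>\<^sup>2 * p t x)) * W x)) (at t within S)"
proof (rule derivative_of_integral)
  show "integrable (Leb a b) (\<lambda>x. Qtilde Q (\<epsilon>\<^sup>2 * p s x))" if "s \<in> S" for s
    by (intro integrable_Leb_continuous cont_Qtilde_p that)
  show "integrable (Leb a b) (\<lambda>x. (\<epsilon>\<^sup>2 * Q (\<epsilon>\<^sup>2 * p t x)) * W x)"
    by (intro integrable_Leb_mult_continuous continuous_on_mult continuous_on_const cont_flux tS int_UW)
  have "bounded (deriv Q ` {-\<kappa>..\<kappa>})"
    using continuous_on_subset[OF cont_deriv_Q] by (intro compact_imp_bounded compact_continuous_image) auto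
  then obtain M where M: "\<And>s. s \<in> {-\<kappa>..\<kappa>} \<Longrightarrow> \<bar>deriv Q s\<bar> \<le> M"
    unfolding bounded_iff by fastforce
  have M0: "0 \<le> M" using M[of 0] kappa_pos by fastforce
  define R where "R s x = \<epsilon>\<^sup>2 * Q \<kappa> * \<bar>ep s x\<bar> + M * \<epsilon>^4 * \<bar>s - t\<bar> * ((ep s x)\<^sup>2 + 2 * (W x)\<^sup>2)" for s x
  have intR: "integrable (Leb a b) (R s)" if "s \<in> S" for s
    unfolding R_def using int_err[OF that] L2_err[OF that] L2 by (auto simp: in_L2_def)
  have LR: "(LINT x|Leb a b. R s x) = \<epsilon>\<^sup>2 * Q \<kappa> * (LINT x|Leb a b. \<bar>ep s x\<bar>)
      + M * \<epsilon>^4 * \<bar>s - t\<bar> * ((LINT x|Leb a b. (ep s x)\<^sup>2) + 2 * (LINT x|Leb a b. (W x)\<^sup>2))" if "s \<in> S" for s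
    unfolding R_def using int_err[OF that] L2_err[OF that] L2 by (simp add: in_L2_def)
  have bound: "\<bar>(Qtilde Q (\<epsilon>\<^sup>2 * p s x) - Qtilde Q (\<epsilon>\<^sup>2 * p t x)) / (s - t) - (\<epsilon>\<^sup>2 * Q (\<epsilon>\<^sup>2 * p t x)) * W x\<bar> \<le> R s x"
    if s: "s \<in> S" "s \<noteq> t" and x: "x \<in> {a<..<b}" for s x
  proof -
    let ?\<alpha> = "\<epsilon>\<^sup>2 * p t x" and ?\<beta> = "\<epsilon>\<^sup>2 * p s x"
    have ab': "\<bar>?\<alpha>\<bar> \<le> \<kappa>" "\<bar>?\<beta>\<bar> \<le> \<kappa>" using slope[OF tS] slope[OF s(1)] x by auto
    have inc: "?\<beta> - ?\<alpha> = \<epsilon>\<^sup>2 * (s - t) * (ep s x + W x)"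
      using increment_p[OF s(2), of x] by (simp add: right_diff_distrib[symmetric] mult.assoc)
    obtain \<xi> where \<xi>: "Qtilde Q ?\<beta> - Qtilde Q ?\<alpha> = Q \<xi> * (?\<beta> - ?\<alpha>)" "min ?\<alpha> ?\<beta> \<le> \<xi>" "\<xi> \<le> max ?\<alpha> ?\<beta>"
      using mean_value_between[OF Qt_deriv] by blast
    obtain \<zeta> where \<zeta>: "Q \<xi> - Q ?\<alpha> = deriv Q \<zeta> * (\<xi> - ?\<alpha>)" "min ?\<alpha> \<xi> \<le> \<zeta>" "\<zeta> \<le> max ?\<alpha> \<xi>"
      using mean_value_between[OF Q_deriv] by blast
    have rng: "\<xi> \<in> {-\<kappa>..\<kappa>}" "\<zeta> \<in> {-\<kappa>..\<kappa>}" "\<bar>\<xi> - ?\<alpha>\<bar> \<le> \<bar>?\<beta> - ?\<alpha>\<bar>"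
      using \<xi>(2,3) \<zeta>(2,3) ab' by auto
    have Q\<xi>: "\<bar>Q \<xi>\<bar> \<le> Q \<kappa>"
      using Q_mono[of \<xi> \<kappa>] Q_mono[of "-\<kappa>" \<xi>] rng(1) by (simp add: Q_odd abs_le_iff)
    have "(Qtilde Q ?\<beta> - Qtilde Q ?\<alpha>) / (s - t) = \<epsilon>\<^sup>2 * Q \<xi> * (ep s x + W x)"
      unfolding \<xi>(1) inc using s(2) by simp
    then have "(Qtilde Q ?\<beta> - Qtilde Q ?\<alpha>) / (s - t) - (\<epsilon>\<^sup>2 * Q ?\<alpha>) * W x
        = \<epsilon>\<^sup>2 * Q \<xi> * ep s x + \<epsilon>\<^sup>2 * (Q \<xi> - Q ?\<alpha>) * W x" by (simp add: algebra_simps)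
    also have "\<bar>\<dots>\<bar> \<le> \<epsilon>\<^sup>2 * \<bar>Q \<xi>\<bar> * \<bar>ep s x\<bar> + \<epsilon>\<^sup>2 * \<bar>Q \<xi> - Q ?\<alpha>\<bar> * \<bar>W x\<bar>"
      by (intro order_trans[OF abs_triangle_ineq]) (simp add: abs_mult)
    also have "\<dots> \<le> \<epsilon>\<^sup>2 * Q \<kappa> * \<bar>ep s x\<bar> + \<epsilon>\<^sup>2 * (M * (\<epsilon>\<^sup>2 * \<bar>s - t\<bar> * \<bar>ep s x + W x\<bar>)) * \<bar>W x\<bar>"
    proof (intro add_mono mult_right_mono mult_left_mono)
      have "\<bar>Q \<xi> - Q ?\<alpha>\<bar> = \<bar>deriv Q \<zeta>\<bar> * \<bar>\<xi> - ?\<alpha>\<bar>" by (simp only: \<zeta>(1) abs_mult)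
      also have "\<dots> \<le> M * \<bar>?\<beta> - ?\<alpha>\<bar>" using M[OF rng(2)] rng(3) M0 by (intro mult_mono) auto
      also have "\<dots> = M * (\<epsilon>\<^sup>2 * \<bar>s - t\<bar> * \<bar>ep s x + W x\<bar>)" unfolding inc by (simp add: abs_mult)
      finally show "\<bar>Q \<xi> - Q ?\<alpha>\<bar> \<le> M * (\<epsilon>\<^sup>2 * \<bar>s - t\<bar> * \<bar>ep s x + W x\<bar>)" .
    qed (use Q\<xi> in auto)
    also have "\<dots> = \<epsilon>\<^sup>2 * Q \<kappa> * \<bar>ep s x\<bar> + M * \<epsilon>^4 * \<bar>s - t\<bar> * (\<bar>ep s x + W x\<bar> * \<bar>W x\<bar>)"
      by (simp add: power2_eq_square power4_eq_xxxx)
    also have "\<dots> \<le> R s x"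
      unfolding R_def
    proof (intro add_left_mono mult_left_mono)
      have "\<bar>ep s x + W x\<bar> * \<bar>W x\<bar> \<le> (\<bar>ep s x\<bar> + \<bar>W x\<bar>) * \<bar>W x\<bar>" by (intro mult_right_mono abs_triangle_ineq) simp
      also have "\<dots> \<le> (ep s x)\<^sup>2 + 2 * (W x)\<^sup>2"
      proof -
        have "2 * (\<bar>ep s x\<bar> * \<bar>W x\<bar>) \<le> (ep s x)\<^sup>2 + (W x)\<^sup>2"
          using sum_squares_bound[of "\<bar>ep s x\<bar>" "\<bar>W x\<bar>"] by (simp add: mult.assoc)
        moreover have "(\<bar>ep s x\<bar> + \<bar>W x\<bar>) * \<bar>W x\<bar> = \<bar>ep s x\<bar> * \<bar>W x\<bar> + (W x)\<^sup>2"
          by (simp add: distrib_right power2_eq_square)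
        ultimately show ?thesis
          using zero_le_power2[of "ep s x"] zero_le_power2[of "W x"] by linarith
      qed
      finally show "\<bar>ep s x + W x\<bar> * \<bar>W x\<bar> \<le> (ep s x)\<^sup>2 + 2 * (W x)\<^sup>2" .
    qed (use M0 in simp)
    finally show ?thesis .
  qed
  fix e :: real assume "0 < e"
  have "((\<lambda>s. \<epsilon>\<^sup>2 * Q \<kappa> * (LINT x|Leb a b. \<bar>ep s x\<bar>)
      + M * \<epsilon>^4 * \<bar>s - t\<bar> * ((LINT x|Leb a b. (ep s x)\<^sup>2) + 2 * (LINT x|Leb a b. (W x)\<^sup>2)))
      \<longlongrightarrow> \<epsilon>\<^sup>2 * Q \<kappa> * 0 + M * \<epsilon>^4 * 0 * (0 + 2 * (LINT x|Leb a b. (W x)\<^sup>2))) (at t within S)"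
    by (intro tendsto_add tendsto_mult tendsto_const time_tendsto err_L1_tendsto err_square_tendsto)
  then have "\<forall>\<^sub>F s in at t within S. \<epsilon>\<^sup>2 * Q \<kappa> * (LINT x|Leb a b. \<bar>ep s x\<bar>)
      + M * \<epsilon>^4 * \<bar>s - t\<bar> * ((LINT x|Leb a b. (ep s x)\<^sup>2) + 2 * (LINT x|Leb a b. (W x)\<^sup>2)) < e"
    using \<open>0 < e\<close> by (intro order_tendstoD(2)) auto
  then show "\<forall>\<^sub>F s in at t within S. \<exists>r. integrable (Leb a b) r
      \<and> (\<forall>x\<in>{a<..<b}. \<bar>(Qtilde Q (\<epsilon>\<^sup>2 * p s x) - Qtilde Q (\<epsilon>\<^sup>2 * p t x)) / (s - t) - (\<epsilon>\<^sup>2 * Q (\<epsilon>\<^sup>2 * p t x)) * W x\<bar> \<le> r x)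
      \<and> (LINT x|Leb a b. r x) < e"
    using evS
  proof eventually_elim
    case (elim s)
    then show ?case using intR LR bound by (intro exI[of _ "R s"]) auto
  qed
qed

text \<open>\<open>F'\<close> is merely continuous. The values \<open>z s\<close> do converge uniformly, so uniform continuity of \<open>F'\<close> on a
  bounded interval is enough.\<close>

lemma F_integral_derivative:
  "((\<lambda>s. LINT x|Leb a b. F (z s x)) has_real_derivative
     (LINT x|Leb a b. deriv F (z t x) * U x)) (at t within S)"
proof (rule derivative_of_integral)
  show "integrable (Leb a b) (\<lambda>x. F (z s x))" if "s \<in> S" for s
    by (intro integrable_Leb_continuous cont_F_z that)
  show "integrable (Leb a b) (\<lambda>x. deriv F (z t x) * U x)"
    by (intro integrable_Leb_mult_continuous cont_F'_z tS int_UW)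
  have "bounded (z t ` {a..b})"
    by (intro compact_imp_bounded compact_continuous_image cont_z tS) simp
  then obtain m where m: "\<And>x. x \<in> {a..b} \<Longrightarrow> \<bar>z t x\<bar> \<le> m"
    unfolding bounded_iff by fastforce
  have cF': "continuous_on {-(m+1)..m+1} (deriv F)" by (rule continuous_on_subset[OF cont_deriv_F]) simp
  then have "bounded (deriv F ` {-(m+1)..m+1})"
    by (intro compact_imp_bounded compact_continuous_image) simp_all
  then obtain M where M: "\<And>s. s \<in> {-(m+1)..m+1} \<Longrightarrow> \<bar>deriv F s\<bar> \<le> M"
    unfolding bounded_iff by fastforce
  fix e :: real assume "0 < e"
  define K where "K = (LINT x|Leb a b. \<bar>U x\<bar>)"
  have "0 \<le> K" unfolding K_def by (rule Bochner_Integration.integral_nonneg) simp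
  define \<omega> where "\<omega> = e / (2 * (K + 1))"
  have \<omega>: "0 < \<omega>" "\<omega> * K \<le> e / 2"
    using \<open>0 < e\<close> \<open>0 \<le> K\<close> by (auto simp: \<omega>_def field_simps)
  obtain \<delta> where \<delta>: "0 < \<delta>" "\<And>x y. x \<in> {-(m+1)..m+1} \<Longrightarrow> y \<in> {-(m+1)..m+1} \<Longrightarrow> \<bar>y - x\<bar> < \<delta> \<Longrightarrow> \<bar>deriv F y - deriv F x\<bar> < \<omega>"
    using compact_uniformly_continuous[OF cF' compact_Icc] \<omega>(1)
    unfolding uniformly_continuous_on_def dist_real_def by meson
  have "((\<lambda>s. M * (LINT x|Leb a b. \<bar>ez s x\<bar>)) \<longlongrightarrow> M * 0) (at t within S)"
    by (intro tendsto_mult tendsto_const err_L1_tendsto)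
  then have "\<forall>\<^sub>F s in at t within S. M * (LINT x|Leb a b. \<bar>ez s x\<bar>) < e / 2"
    using \<open>0 < e\<close> by (intro order_tendstoD(2)) auto
  moreover have "\<forall>\<^sub>F s in at t within S. \<forall>x\<in>{a..b}. \<bar>z s x - z t x\<bar> < min 1 \<delta>"
    using \<delta>(1) by (intro uniform_continuous) simp
  ultimately show "\<forall>\<^sub>F s in at t within S. \<exists>r. integrable (Leb a b) r
      \<and> (\<forall>x\<in>{a<..<b}. \<bar>(F (z s x) - F (z t x)) / (s - t) - deriv F (z t x) * U x\<bar> \<le> r x)
      \<and> (LINT x|Leb a b. r x) < e"
    using evS
  proof eventually_elim
    case (elim s)
    then have s: "s \<in> S" "s \<noteq> t" by auto
    show ?case
    proof (intro exI[of _ "\<lambda>x. M * \<bar>ez s x\<bar> + \<omega> * \<bar>U x\<bar>"] conjI ballI)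
      show "integrable (Leb a b) (\<lambda>x. M * \<bar>ez s x\<bar> + \<omega> * \<bar>U x\<bar>)"
        using int_err[OF s(1)] int_UW by simp
      have "(LINT x|Leb a b. M * \<bar>ez s x\<bar> + \<omega> * \<bar>U x\<bar>) = M * (LINT x|Leb a b. \<bar>ez s x\<bar>) + \<omega> * (LINT x|Leb a b. \<bar>U x\<bar>)"
        using int_err[OF s(1)] int_UW by simp
      then show "(LINT x|Leb a b. M * \<bar>ez s x\<bar> + \<omega> * \<bar>U x\<bar>) < e" using elim(1) \<omega>(2) by (simp add: K_def)
      fix x assume x: "x \<in> {a<..<b}"
      obtain \<xi> where \<xi>: "F (z s x) - F (z t x) = deriv F \<xi> * (z s x - z t x)" "min (z t x) (z s x) \<le> \<xi>" "\<xi> \<le> max (z t x) (z s x)"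
        using mean_value_between[OF F_deriv] by blast
      have zz: "\<bar>z s x - z t x\<bar> < min 1 \<delta>" "\<bar>z t x\<bar> \<le> m" using elim(2) m x by auto
      then have rng: "\<xi> \<in> {-(m+1)..m+1}" "z t x \<in> {-(m+1)..m+1}" "\<bar>\<xi> - z t x\<bar> < \<delta>"
        using \<xi>(2,3) by auto
      have "(F (z s x) - F (z t x)) / (s - t) = deriv F \<xi> * (ez s x + U x)"
        unfolding \<xi>(1) increment_z[OF s(2)] using s(2) by simp
      then have "(F (z s x) - F (z t x)) / (s - t) - deriv F (z t x) * U x = deriv F \<xi> * ez s x + (deriv F \<xi> - deriv F (z t x)) * U x"
        by (simp add: algebra_simps)
      also have "\<bar>\<dots>\<bar> \<le> \<bar>deriv F \<xi>\<bar> * \<bar>ez s x\<bar> + \<bar>deriv F \<xi> - deriv F (z t x)\<bar> * \<bar>U x\<bar>"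
        by (intro order_trans[OF abs_triangle_ineq]) (simp add: abs_mult)
      also have "\<dots> \<le> M * \<bar>ez s x\<bar> + \<omega> * \<bar>U x\<bar>"
        using M[OF rng(1)] less_imp_le[OF \<delta>(2)[OF rng(2,1,3)]] by (intro add_mono mult_right_mono) auto
      finally show "\<bar>(F (z s x) - F (z t x)) / (s - t) - deriv F (z t x) * U x\<bar> \<le> M * \<bar>ez s x\<bar> + \<omega> * \<bar>U x\<bar>" .
    qed
  qed
qed

theorem energy_derivative:
  "((\<lambda>s. LINT x|Leb a b. edens \<epsilon> (p s x) (z s x)) has_real_derivative
     ((LINT x|Leb a b. Q (\<epsilon>\<^sup>2 * p t x) * W x) + (LINT x|Leb a b. deriv F (z t x) * U x)) / \<epsilon>) (at t within S)"
proof (rule has_field_derivative_transform_within[where d = 1, OF _ _ tS])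
  have "((\<lambda>s. (LINT x|Leb a b. Qtilde Q (\<epsilon>\<^sup>2 * p s x)) / \<epsilon>^3 + (LINT x|Leb a b. F (z s x)) / \<epsilon>) has_real_derivative
     (LINT x|Leb a b. (\<epsilon>\<^sup>2 * Q (\<epsilon>\<^sup>2 * p t x)) * W x) / \<epsilon>^3 + (LINT x|Leb a b. deriv F (z t x) * U x) / \<epsilon>) (at t within S)"
    by (intro DERIV_add DERIV_cdivide Qtilde_integral_derivative F_integral_derivative)
  also have "(LINT x|Leb a b. (\<epsilon>\<^sup>2 * Q (\<epsilon>\<^sup>2 * p t x)) * W x) / \<epsilon>^3 = (LINT x|Leb a b. Q (\<epsilon>\<^sup>2 * p t x) * W x) / \<epsilon>"
    using eps by (simp add: mult.assoc power3_eq_cube power2_eq_square)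
  finally show "((\<lambda>s. (LINT x|Leb a b. Qtilde Q (\<epsilon>\<^sup>2 * p s x)) / \<epsilon>^3 + (LINT x|Leb a b. F (z s x)) / \<epsilon>) has_real_derivative
     ((LINT x|Leb a b. Q (\<epsilon>\<^sup>2 * p t x) * W x) + (LINT x|Leb a b. deriv F (z t x) * U x)) / \<epsilon>) (at t within S)"
    by (simp add: add_divide_distrib)
  show "(LINT x|Leb a b. Qtilde Q (\<epsilon>\<^sup>2 * p s x)) / \<epsilon>^3 + (LINT x|Leb a b. F (z s x)) / \<epsilon>
      = (LINT x|Leb a b. edens \<epsilon> (p s x) (z s x))" if "s \<in> S" for s
    unfolding edens_def using that
    by (simp add: integrable_Leb_continuous cont_Qtilde_p cont_F_z)
qed simp

text \<open>The boundary terms vanish because \<open>Q 0 = 0\<close> and the slope is 0 at both ends.\<close>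

lemma integration_by_parts:
  assumes p0: "p t a = 0" "p t b = 0" and p: "has_weak_deriv a b (p t) p'" "in_L2 a b p'"
    and U: "has_weak_deriv a b U W"
  obtains q' where "has_weak_deriv a b (\<lambda>x. Q (\<epsilon>\<^sup>2 * p t x)) q'" "integrable (Leb a b) (\<lambda>x. q' x * U x)"
    "(LINT x|Leb a b. Q (\<epsilon>\<^sup>2 * p t x) * W x) = - (LINT x|Leb a b. q' x * U x)"
proof -
  have "p' absolutely_integrable_on {a..b}" using in_L2_integrable[OF p(2)] by (simp add: integrable_Leb_iff)
  from weak_deriv_abs_cont_representative[OF ab p(1) this]
  obtain g where g: "abs_cont a b g p'" "AE x in Leb a b. p t x = g x" by blast
  have gp: "g x = p t x" if "x \<in> {a..b}" for x
  proof (rule continuous_AE_eq_imp_eq[OF ab abs_cont_continuous[OF g(1)] cont_p[OF tS] _ that])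
    show "AE x in Leb a b. g x = p t x" using g(2) by eventually_elim simp
  qed
  have p_ac: "abs_cont a b (p t) p'"
    using g(1) gp unfolding abs_cont_def by auto
  have d1: "((\<lambda>s. Q (\<epsilon>\<^sup>2 * s)) has_real_derivative \<epsilon>\<^sup>2 * deriv Q (\<epsilon>\<^sup>2 * s)) (at s)" for s
  proof -
    have "((\<lambda>s. Q (\<epsilon>\<^sup>2 * s)) has_real_derivative deriv Q (\<epsilon>\<^sup>2 * s) * \<epsilon>\<^sup>2) (at s)"
      by (rule DERIV_chain2[OF Q_deriv]) (auto intro!: derivative_eq_intros)
    then show ?thesis by (simp add: mult.commute)
  qed
  have d2: "continuous_on UNIV (\<lambda>s. \<epsilon>\<^sup>2 * deriv Q (\<epsilon>\<^sup>2 * s))"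
    by (intro continuous_intros continuous_on_compose2[OF cont_deriv_Q]) auto
  define q' where "q' = (\<lambda>x. \<epsilon>\<^sup>2 * deriv Q (\<epsilon>\<^sup>2 * p t x) * p' x)"
  have q: "abs_cont a b (\<lambda>x. Q (\<epsilon>\<^sup>2 * p t x)) q'"
    unfolding q'_def by (rule abs_cont_compose[OF p_ac d1 d2])
  have "W absolutely_integrable_on {a..b}" using int_UW(2) by (simp add: integrable_Leb_iff)
  from weak_deriv_abs_cont_representative[OF ab U this]
  obtain V where V: "abs_cont a b V W" "AE x in Leb a b. U x = V x" by blast
  from abs_cont_mult[OF q V(1)]
  have qV: "abs_cont a b (\<lambda>x. Q (\<epsilon>\<^sup>2 * p t x) * V x) (\<lambda>x. q' x * V x + Q (\<epsilon>\<^sup>2 * p t x) * W x)" .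
  have iqW: "integrable (Leb a b) (\<lambda>x. Q (\<epsilon>\<^sup>2 * p t x) * W x)"
    by (intro integrable_Leb_mult_continuous cont_flux tS int_UW)
  have "integrable (Leb a b) (\<lambda>x. q' x * V x + Q (\<epsilon>\<^sup>2 * p t x) * W x)"
    using abs_contD(1)[OF qV] by (simp add: integrable_Leb_iff)
  from Bochner_Integration.integrable_diff[OF this iqW]
  have iqV: "integrable (Leb a b) (\<lambda>x. q' x * V x)" by simp
  have mq': "q' \<in> borel_measurable (Leb a b)"
    using abs_contD(1)[OF q] by (intro borel_measurable_integrable) (simp add: integrable_Leb_iff)
  have AE: "AE x in Leb a b. q' x * V x = q' x * U x" using V(2) by eventually_elim simp
  have m: "(\<lambda>x. q' x * U x) \<in> borel_measurable (Leb a b)" using borel_measurable_times[OF mq'] L2(1) by (simp add: in_L2_def)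
  have iqU: "integrable (Leb a b) (\<lambda>x. q' x * U x)"
    by (rule Bochner_Integration.integrable_cong_AE_imp[OF iqV m]) (use AE in eventually_elim, simp)
  have "(LINT x|Leb a b. q' x * V x) + (LINT x|Leb a b. Q (\<epsilon>\<^sup>2 * p t x) * W x)
      = (LINT x|Leb a b. q' x * V x + Q (\<epsilon>\<^sup>2 * p t x) * W x)"
    using iqV iqW by simp
  also have "\<dots> = integral {a..b} (\<lambda>x. q' x * V x + Q (\<epsilon>\<^sup>2 * p t x) * W x)"
    by (rule LINT_Leb[OF abs_contD(1)[OF qV]])
  also have "\<dots> = 0" using abs_contD(2)[OF qV, of a b] ab p0 by simp
  finally have "(LINT x|Leb a b. Q (\<epsilon>\<^sup>2 * p t x) * W x) = - (LINT x|Leb a b. q' x * V x)" by simp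
  also have "(LINT x|Leb a b. q' x * V x) = (LINT x|Leb a b. q' x * U x)"
    by (rule integral_cong_AE[OF borel_measurable_integrable[OF iqV] m AE])
  finally show thesis using that[OF abs_cont_has_weak_deriv[OF q] iqU] by blast
qed

end


lemma H_norm_1_square:
  assumes "has_weak_deriv a b f g"
  shows "(H_norm 1 a b f)\<^sup>2 = (LINT x|Leb a b. (f x)\<^sup>2) + (LINT x|Leb a b. (g x)\<^sup>2)"
proof -
  have "(LINT x|Leb a b. (weak_deriv a b f x)\<^sup>2) = (LINT x|Leb a b. (g x)\<^sup>2)"
  proof (rule integral_cong_AE)
    show "AE x in Leb a b. (weak_deriv a b f x)\<^sup>2 = (g x)\<^sup>2"
      using weak_deriv_AE[OF assms] by eventually_elim simp
  qed (use weak_deriv_measurable[OF assms] assms loc_integrable_measurable in \<open>auto simp: has_weak_deriv_iff\<close>)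
  then show ?thesis
    by (simp add: H_norm_def atMost_Suc numeral_2_eq_2 add_nonneg_nonneg Bochner_Integration.integral_nonneg)
qed

text \<open>For the difference quotients the Sobolev norm can be computed with the classical derivatives, since
  weak derivatives are unique.\<close>

lemma H1_curve_of_C1_into_H:
  assumes ab: "a < b" and t: "t \<in> S" and H: "C1_into_H 1 a b S u ut"
    and C1: "\<And>s. s \<in> S \<Longrightarrow> C1_on_interval a b (u s) (ux s)"
  obtains W where "H1_curve a b S t u ux (ut t) W" "has_weak_deriv a b (ut t) W"
proof -
  have "in_H 1 a b (ut t)" using H t by (auto simp: C1_into_H_def C_into_H_def)
  then obtain W where W: "in_L2 a b (ut t)" "has_weak_deriv a b (ut t) W" "in_L2 a b W" by auto
  let ?H = "\<lambda>s. H_norm 1 a b (\<lambda>x. (u s x - u t x) / (s - t) - ut t x)"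
  let ?N = "\<lambda>s. (LINT x|Leb a b. ((u s x - u t x) / (s - t) - ut t x)\<^sup>2)
        + (LINT x|Leb a b. ((ux s x - ux t x) / (s - t) - W x)\<^sup>2)"
  have "(?H \<longlongrightarrow> 0) (at t within S)" using H t by (auto simp: C1_into_H_def)
  then have "((\<lambda>s. (?H s)\<^sup>2) \<longlongrightarrow> 0\<^sup>2) (at t within S)" by (rule tendsto_power)
  then have "((\<lambda>s. (?H s)\<^sup>2) \<longlongrightarrow> 0) (at t within S)" by simp
  moreover have "\<forall>\<^sub>F s in at t within S. (?H s)\<^sup>2 = ?N s"
  proof -
    have "(?H s)\<^sup>2 = ?N s" if "s \<in> S" for s
    proof (rule H_norm_1_square)
      have "has_weak_deriv a b (\<lambda>x. (1 / (s - t)) * (u s x - u t x) - ut t x) (\<lambda>x. (1 / (s - t)) * (ux s x - ux t x) - W x)"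
        by (intro has_weak_deriv_diff has_weak_deriv_cmult W(2) abs_cont_has_weak_deriv abs_cont_C1 C1 that t)
      then show "has_weak_deriv a b (\<lambda>x. (u s x - u t x) / (s - t) - ut t x) (\<lambda>x. (ux s x - ux t x) / (s - t) - W x)"
        by simp
    qed
    then show ?thesis by (auto simp: eventually_at_filter)
  qed
  ultimately have "(?N \<longlongrightarrow> 0) (at t within S)"
    by (rule Lim_transform_eventually)
  then have "H1_curve a b S t u ux (ut t) W"
    using ab t C1 W by unfold_locales auto
  then show thesis using W(2) that by blast
qed

context reaction_diffusion
begin

lemma energy_eq:
  assumes w: "C1_on_interval a b w w'"
  shows "energy Q F a b \<epsilon> w = (LINT x|Leb a b. edens \<epsilon> (w' x) (w x))"
    and "energy Q F a b \<epsilon> w = integral {a..b} (\<lambda>x. edens \<epsilon> (w' x) (w x))"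
proof -
  have wd: "has_weak_deriv a b w w'" by (rule abs_cont_has_weak_deriv[OF abs_cont_C1[OF w]])
  have cw: "continuous_on {a..b} w" using abs_cont_continuous[OF abs_cont_C1[OF w]] .
  have cw': "continuous_on {a..b} w'" using w by (simp add: C1_on_interval_def)
  have c: "continuous_on {a..b} (\<lambda>x. edens \<epsilon> (w' x) (w x))"
    unfolding edens_def divide_inverse
    by (intro continuous_on_add continuous_on_mult continuous_on_const continuous_on_compose2[OF cont_Qt[of UNIV]] continuous_on_compose2[OF cont_F[of UNIV]] cw cw') auto
  show eq: "energy Q F a b \<epsilon> w = (LINT x|Leb a b. edens \<epsilon> (w' x) (w x))"
    unfolding energy_def
  proof (rule integral_cong_AE)
    show "AE x in Leb a b. Qtilde Q (\<epsilon>\<^sup>2 * weak_deriv a b w x) / \<epsilon>^3 + F (w x) / \<epsilon> = edens \<epsilon> (w' x) (w x)"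
      using weak_deriv_AE[OF wd] by eventually_elim (simp add: edens_def)
    have [measurable]: "weak_deriv a b w \<in> borel_measurable (Leb a b)" "w \<in> borel_measurable (Leb a b)"
      "Qtilde Q \<in> borel_measurable borel" "F \<in> borel_measurable borel"
      using weak_deriv_measurable[OF wd] wd loc_integrable_measurable borel_measurable_continuous_onI[OF cont_Qt]
        borel_measurable_continuous_onI[OF cont_F] by (auto simp: has_weak_deriv_iff)
    show "(\<lambda>x. Qtilde Q (\<epsilon>\<^sup>2 * weak_deriv a b w x) / \<epsilon>^3 + F (w x) / \<epsilon>) \<in> borel_measurable (Leb a b)"
      by measurable
    show "(\<lambda>x. edens \<epsilon> (w' x) (w x)) \<in> borel_measurable (Leb a b)"
      by (intro borel_measurable_integrable integrable_Leb_continuous c)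
  qed
  show "energy Q F a b \<epsilon> w = integral {a..b} (\<lambda>x. edens \<epsilon> (w' x) (w x))"
    unfolding eq by (intro LINT_Leb absolutely_integrable_continuous_real c)
qed

text \<open>With \<open>y = u T - u 0\<close> one has \<open>(\<integral> u y)' = \<integral> u\<^sub>t y \<le> T / 2 * \<parallel>u\<^sub>t\<parallel>\<^sup>2 + \<parallel>y\<parallel>\<^sup>2 / (2 * T)\<close>, and \<open>\<parallel>u\<^sub>t\<parallel>\<^sup>2\<close> is
  \<open>- \<epsilon>\<close> times the derivative of the energy. Integrating from 0 to \<open>T\<close> bounds \<open>\<parallel>y\<parallel>\<^sup>2\<close>. Testing with the fixed
  function \<open>y\<close> replaces the integral of \<open>\<parallel>u\<^sub>t\<parallel>\<close> over time. At time 0 the slope need not vanish at the ends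
  of the interval, so the dissipation identity is only used at positive times.\<close>

theorem energy_dissipation:
  assumes ab: "a < b" and eps: "0 < \<epsilon>" and T: "0 < T"
    and C1: "\<And>s. s \<in> {0..T} \<Longrightarrow> C1_on_interval a b (u s) (ux s)"
    and slope: "\<And>s x. s \<in> {0..T} \<Longrightarrow> x \<in> {a..b} \<Longrightarrow> \<bar>\<epsilon>\<^sup>2 * ux s x\<bar> \<le> \<kappa>"
    and H2: "\<And>s. s \<in> {0..T} \<Longrightarrow> in_H 2 a b (u s)" and H1: "C1_into_H 1 a b {0..T} u ut"
    and pde: "\<And>s. 0 < s \<Longrightarrow> s < T \<Longrightarrow> AE x in Leb a b. ut s x = weak_deriv a b (\<lambda>y. Q (\<epsilon>\<^sup>2 * ux s y)) x - deriv F (u s x)"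
    and bc: "\<And>s. 0 < s \<Longrightarrow> s < T \<Longrightarrow> ux s a = 0 \<and> ux s b = 0"
  shows "(LINT x|Leb a b. (u T x - u 0 x)\<^sup>2) \<le> \<epsilon> * T * (energy Q F a b \<epsilon> (u 0) - energy Q F a b \<epsilon> (u T))"
proof -
  define e where "e s = (LINT x|Leb a b. edens \<epsilon> (ux s x) (u s x))" for s
  define y where "y = (\<lambda>x. u T x - u 0 x)"
  define c where "c s = (LINT x|Leb a b. y x * u s x)" for s
  define Y where "Y = (LINT x|Leb a b. (y x)\<^sup>2)"
  have cu: "continuous_on {a..b} (u s)" if "s \<in> {0..T}" for s
    using abs_cont_continuous[OF abs_cont_C1[OF C1[OF that]]] .
  have cy: "continuous_on {a..b} y" unfolding y_def using T by (intro continuous_on_diff cu) auto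
  have iy: "integrable (Leb a b) (\<lambda>x. (y x)\<^sup>2)" by (intro integrable_Leb_continuous continuous_intros cy)
  have deriv: "\<exists>e' c'. (e has_real_derivative e') (at t within {0..T}) \<and> (c has_real_derivative c') (at t within {0..T})
      \<and> (0 < t \<longrightarrow> t < T \<longrightarrow> c' \<le> - (T * \<epsilon> / 2) * e' + Y / (2 * T))" if t: "t \<in> {0..T}" for t
  proof -
    obtain W where W: "H1_curve a b {0..T} t u ux (ut t) W" "has_weak_deriv a b (ut t) W"
      by (rule H1_curve_of_C1_into_H[OF ab t H1 C1])
    interpret H1_curve a b "{0..T}" t u ux "ut t" W by (rule W(1))
    interpret energy_curve Q F \<kappa> lam1 lam2 \<eta> a b t "{0..T}" u ux "ut t" W \<epsilon>
      using eps slope by unfold_locales auto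
    let ?e' = "((LINT x|Leb a b. Q (\<epsilon>\<^sup>2 * ux t x) * W x) + (LINT x|Leb a b. deriv F (u t x) * ut t x)) / \<epsilon>"
    let ?c' = "LINT x|Leb a b. y x * ut t x"
    have "?c' \<le> - (T * \<epsilon> / 2) * ?e' + Y / (2 * T)" if t0: "0 < t" "t < T"
    proof -
      obtain g p' where g: "has_weak_deriv a b (u t) g" "has_weak_deriv a b g p'" "in_L2 a b p'"
        using H2[OF t] by (auto simp: numeral_2_eq_2)
      have "has_weak_deriv a b (u t) (ux t)" by (rule abs_cont_has_weak_deriv[OF abs_cont_C1[OF C1[OF t]]])
      then have "AE x in Leb a b. g x = ux t x" by (rule weak_deriv_unique[OF g(1)])
      moreover have "loc_integrable a b (ux t)"
        by (intro absolutely_integrable_imp_loc_integrable absolutely_integrable_continuous_real cont_p t)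
      ultimately have p: "has_weak_deriv a b (ux t) p'" by (intro has_weak_deriv_cong_AE[OF g(2)])
      obtain q' where q: "has_weak_deriv a b (\<lambda>x. Q (\<epsilon>\<^sup>2 * ux t x)) q'" "integrable (Leb a b) (\<lambda>x. q' x * ut t x)"
        "(LINT x|Leb a b. Q (\<epsilon>\<^sup>2 * ux t x) * W x) = - (LINT x|Leb a b. q' x * ut t x)"
        using integration_by_parts[OF _ _ p g(3) W(2)] bc[OF t0] by blast
      have iF: "integrable (Leb a b) (\<lambda>x. deriv F (u t x) * ut t x)"
        by (intro integrable_Leb_mult_continuous cont_F'_z t int_UW)
      have iU: "integrable (Leb a b) (\<lambda>x. (ut t x)\<^sup>2)" using L2 by (simp add: in_L2_def)
      have "(LINT x|Leb a b. q' x * ut t x - deriv F (u t x) * ut t x) = (LINT x|Leb a b. (ut t x)\<^sup>2)"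
      proof (rule integral_cong_AE)
        show "AE x in Leb a b. q' x * ut t x - deriv F (u t x) * ut t x = (ut t x)\<^sup>2"
          using pde[OF t0] weak_deriv_AE[OF q(1)]
        proof eventually_elim
          case (elim x)
          then have "q' x - deriv F (u t x) = ut t x" by simp
          then show ?case by (metis left_diff_distrib power2_eq_square)
        qed
      qed (use q(2) iF iU in \<open>auto intro: borel_measurable_integrable\<close>)
      then have "(LINT x|Leb a b. Q (\<epsilon>\<^sup>2 * ux t x) * W x) + (LINT x|Leb a b. deriv F (u t x) * ut t x)
          = - (LINT x|Leb a b. (ut t x)\<^sup>2)"
        using q(2,3) iF by simp
      then have e': "?e' = - (LINT x|Leb a b. (ut t x)\<^sup>2) / \<epsilon>" by (simp only:)
      have "?c' \<le> (LINT x|Leb a b. T / 2 * (ut t x)\<^sup>2 + 1 / (2 * T) * (y x)\<^sup>2)"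
      proof (rule Bochner_Integration.integral_mono)
        show "integrable (Leb a b) (\<lambda>x. y x * ut t x)"
          by (intro integrable_Leb_mult_continuous cy int_UW)
        show "integrable (Leb a b) (\<lambda>x. T / 2 * (ut t x)\<^sup>2 + 1 / (2 * T) * (y x)\<^sup>2)"
          using iU iy by simp
        fix x
        have "0 \<le> (T * ut t x - y x)\<^sup>2" by simp
        then show "y x * ut t x \<le> T / 2 * (ut t x)\<^sup>2 + 1 / (2 * T) * (y x)\<^sup>2"
          using T by (simp add: power2_eq_square field_simps)
      qed
      also have "\<dots> = T / 2 * (LINT x|Leb a b. (ut t x)\<^sup>2) + Y / (2 * T)"
        using iU iy by (simp add: Y_def)
      also have "\<dots> = - (T * \<epsilon> / 2) * ?e' + Y / (2 * T)"
        unfolding e' using eps by simp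
      finally show ?thesis .
    qed
    moreover have "(e has_real_derivative ?e') (at t within {0..T})"
      unfolding e_def by (rule energy_derivative)
    moreover have "(c has_real_derivative ?c') (at t within {0..T})"
      unfolding c_def by (rule inner_product_derivative[OF cy])
    ultimately show ?thesis by blast
  qed
  \<comment> \<open>Nonincreasing by \<open>deriv\<close>; the claim is \<open>\<phi> T \<le> \<phi> 0\<close>.\<close>
  define \<phi> where "\<phi> t = c t + T * \<epsilon> / 2 * e t - Y / (2 * T) * t" for t
  have d\<phi>: "\<exists>d. (\<phi> has_real_derivative d) (at t within {0..T}) \<and> (0 < t \<longrightarrow> t < T \<longrightarrow> d \<le> 0)" if t: "t \<in> {0..T}" for t
  proof -
    obtain e' c' where d: "(e has_real_derivative e') (at t within {0..T})" "(c has_real_derivative c') (at t within {0..T})"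
      "0 < t \<longrightarrow> t < T \<longrightarrow> c' \<le> - (T * \<epsilon> / 2) * e' + Y / (2 * T)"
      using deriv[OF t] by blast
    have "(\<phi> has_real_derivative c' + T * \<epsilon> / 2 * e' - Y / (2 * T) * 1) (at t within {0..T})"
      unfolding \<phi>_def by (intro DERIV_diff DERIV_add DERIV_cmult d DERIV_ident)
    then show ?thesis using d(3) by (intro exI[of _ "c' + T * \<epsilon> / 2 * e' - Y / (2 * T) * 1"]) auto
  qed
  have "continuous_on {0..T} \<phi>"
    using d\<phi> by (meson DERIV_continuous continuous_on_eq_continuous_within)
  moreover have int: "\<exists>d. (\<phi> has_real_derivative d) (at t) \<and> d \<le> 0" if "0 < t" "t < T" for t
    using d\<phi>[of t] that at_within_interior[of t "{0..T}"] by auto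
  then have "\<phi> differentiable (at t)" if "0 < t" "t < T" for t
    using that by (auto simp: real_differentiable_def)
  ultimately obtain l s where ls: "0 < s" "s < T" "(\<phi> has_real_derivative l) (at s)" "\<phi> T - \<phi> 0 = (T - 0) * l"
    using MVT[OF T] by blast
  have "l \<le> 0" using int[OF ls(1,2)] DERIV_unique[OF ls(3)] by auto
  then have "\<phi> T \<le> \<phi> 0" using ls(4) T mult_nonneg_nonpos[of T l] by simp
  moreover have "c T - c 0 = Y"
  proof -
    have "c T - c 0 = (LINT x|Leb a b. y x * u T x - y x * u 0 x)"
      unfolding c_def using T
      by (intro Bochner_Integration.integral_diff[symmetric] integrable_Leb_mult_continuous cy integrable_Leb_continuous cu) auto
    then show ?thesis by (simp add: Y_def y_def power2_eq_square algebra_simps)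
  qed
  ultimately have "Y + T * \<epsilon> / 2 * e T - Y / (2 * T) * T \<le> T * \<epsilon> / 2 * e 0"
    unfolding \<phi>_def by simp
  moreover have "Y / (2 * T) * T = Y / 2" using T by simp
  ultimately have "Y \<le> \<epsilon> * T * (e 0 - e T)" by (simp add: algebra_simps)
  moreover have "e 0 = energy Q F a b \<epsilon> (u 0)" "e T = energy Q F a b \<epsilon> (u T)"
    unfolding e_def using T by (simp_all add: energy_eq(1)[OF C1])
  ultimately show ?thesis by (simp add: Y_def y_def)
qed

end

lemma L1_distance_continuous:
  assumes ab: "a < b" and C1: "\<And>s. s \<in> S \<Longrightarrow> C1_on_interval a b (u s) (ux s)"
    and H1: "C1_into_H 1 a b S u ut" and f: "continuous_on {a..b} f"
  shows "continuous_on S (\<lambda>t. LINT x|Leb a b. \<bar>u t x - f x\<bar>)"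
  unfolding continuous_on_def
proof
  fix t assume t: "t \<in> S"
  obtain W where W: "H1_curve a b S t u ux (ut t) W" "has_weak_deriv a b (ut t) W"
    by (rule H1_curve_of_C1_into_H[OF ab t H1 C1])
  interpret H1_curve a b S t u ux "ut t" W by (rule W(1))
  have i: "integrable (Leb a b) (\<lambda>x. \<bar>u s x - f x\<bar>)" "integrable (Leb a b) (\<lambda>x. \<bar>u s x - u t x\<bar>)" if "s \<in> S" for s
    using that t by (auto intro!: integrable_Leb_continuous continuous_on_rabs continuous_on_diff cont_z f simp del: integrable_abs_iff)
  have le: "\<bar>(LINT x|Leb a b. \<bar>u s x - f x\<bar>) - (LINT x|Leb a b. \<bar>u t x - f x\<bar>)\<bar> \<le> (LINT x|Leb a b. \<bar>u s x - u t x\<bar>)" if "s \<in> S" for s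
  proof -
    have "(LINT x|Leb a b. \<bar>u s x - f x\<bar>) - (LINT x|Leb a b. \<bar>u t x - f x\<bar>) = (LINT x|Leb a b. \<bar>u s x - f x\<bar> - \<bar>u t x - f x\<bar>)"
      using i that t by (intro Bochner_Integration.integral_diff[symmetric]) auto
    also have "\<bar>\<dots>\<bar> \<le> (LINT x|Leb a b. \<bar>\<bar>u s x - f x\<bar> - \<bar>u t x - f x\<bar>\<bar>)" by (rule integral_abs_bound)
    also have "\<dots> \<le> (LINT x|Leb a b. \<bar>u s x - u t x\<bar>)"
      by (intro Bochner_Integration.integral_mono integrable_abs Bochner_Integration.integrable_diff i that t) auto
    finally show ?thesis .
  qed
  have "\<forall>\<^sub>F s in at t within S. norm ((LINT x|Leb a b. \<bar>u s x - f x\<bar>) - (LINT x|Leb a b. \<bar>u t x - f x\<bar>)) \<le> (LINT x|Leb a b. \<bar>u s x - u t x\<bar>)"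
    using evS by eventually_elim (use le in simp)
  then have "((\<lambda>s. (LINT x|Leb a b. \<bar>u s x - f x\<bar>) - (LINT x|Leb a b. \<bar>u t x - f x\<bar>)) \<longlongrightarrow> 0) (at t within S)"
    using L1_continuous by (rule Lim_null_comparison)
  then show "((\<lambda>s. LINT x|Leb a b. \<bar>u s x - f x\<bar>) \<longlongrightarrow> (LINT x|Leb a b. \<bar>u t x - f x\<bar>)) (at t within S)"
    by (simp add: LIM_zero_iff)
qed


section \<open>Metastability\<close>

text \<open>Away from the jumps \<open>v\<close> is locally constant.\<close>

lemma step_function_measurable:
  assumes "step_function a b N h v"
  shows "v \<in> borel_measurable (Leb a b)"
proof -
  let ?H = "h ` {1..N} \<inter> {a<..<b}"
  have step: "v x = v y" if "x \<in> {a..b}" "y \<in> {a..b}" "x \<le> y" "{x..y} \<inter> h ` {1..N} = {}" for x y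
    using assms that by (simp add: step_function_def)
  have "continuous_on ({a<..<b} - ?H) v"
    unfolding continuous_on_def
  proof
    fix x assume x: "x \<in> {a<..<b} - ?H"
    have "open ({a<..<b} - h ` {1..N})" by (intro open_Diff finite_imp_closed) auto
    then obtain e where e: "0 < e" "\<And>y. dist x y < e \<Longrightarrow> y \<in> {a<..<b} - h ` {1..N}"
      using x unfolding open_dist by (metis Diff_iff Int_iff dist_commute)
    have const: "v (min x y) = v (max x y)" if "dist x y < e" for y
    proof -
      have sub: "s \<in> {a<..<b} - h ` {1..N}" if "s \<in> {min x y..max x y}" for s
        using that \<open>dist x y < e\<close> by (intro e(2)) (auto simp: dist_real_def min_def max_def split: if_splits)
      have le: "min x y \<le> max x y" by (simp add: min_def max_def)
      then have "min x y \<in> {a..b}" "max x y \<in> {a..b}" using sub[of "min x y"] sub[of "max x y"] by auto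
      moreover have "{min x y..max x y} \<inter> h ` {1..N} = {}" using sub by blast
      ultimately show ?thesis using step le by simp
    qed
    have "v y = v x" if "dist y x < e" for y
      using const[of y] that by (cases "x \<le> y") (auto simp: dist_commute min_def max_def)
    then have "\<forall>\<^sub>F y in at x within {a<..<b} - ?H. v y = v x"
      unfolding eventually_at using e(1) by blast
    then show "(v \<longlongrightarrow> v x) (at x within {a<..<b} - ?H)" by (rule tendsto_eventually)
  qed
  moreover have neg: "negligible ?H" by (intro negligible_finite) simp
  ultimately have "v \<in> borel_measurable (lebesgue_on ({a<..<b} - ?H))"
    by (intro continuous_imp_measurable_on_sets_lebesgue sets.Diff negligible_imp_sets[of ?H]) auto
  moreover have "?H \<in> null_sets (Leb a b)"
  proof -
    from neg have "?H \<in> null_sets lebesgue" by (simp add: negligible_iff_null_sets)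
    then show ?thesis by (auto simp: null_sets_restrict_space)
  qed
  ultimately show ?thesis using borel_measurable_diff_null[of ?H "{a<..<b}" v] by simp
qed

text \<open>The weak derivative is a choice that depends on the values in \<open>(a, b)\<close> only, so it is literally the same
  function for \<open>f\<close> and \<open>g\<close>.\<close>

lemma energy_cong:
  assumes "\<And>x. x \<in> {a..b} \<Longrightarrow> f x = g x"
  shows "energy Q F a b \<epsilon> f = energy Q F a b \<epsilon> g"
proof -
  have "set_integrable lebesgue {c..d} f \<longleftrightarrow> set_integrable lebesgue {c..d} g" if "a < c" "d < b" for c d
  proof -
    have "(\<lambda>x. indicator {c..d} x *\<^sub>R f x) = (\<lambda>x. indicator {c..d} x *\<^sub>R g x)"
      using that assms by (auto simp: indicator_def)
    then show ?thesis by (simp only: set_integrable_def)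
  qed
  moreover have "(LINT x|Leb a b. f x * k x) = (LINT x|Leb a b. g x * k x)" for k :: "real \<Rightarrow> real"
    using assms by (intro Bochner_Integration.integral_cong) auto
  ultimately have "has_weak_deriv a b f = has_weak_deriv a b g"
    unfolding has_weak_deriv_def by (auto intro!: ext)
  then have "weak_deriv a b f = weak_deriv a b g" by (simp add: weak_deriv_def)
  then show ?thesis
    unfolding energy_def using assms by (intro Bochner_Integration.integral_cong) auto
qed

lemma L1_norm_cong:
  assumes "\<And>x. x \<in> {a..b} \<Longrightarrow> f x = g x"
  shows "L1_norm a b f = L1_norm a b g"
  unfolding L1_norm_def using assms by (intro nn_integral_cong) auto

lemma L1_norm_triangle:
  assumes f: "continuous_on {a..b} f" and g: "continuous_on {a..b} g" and v: "v \<in> borel_measurable (Leb a b)"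
  shows "L1_norm a b (\<lambda>x. f x - v x) \<le> ennreal (LINT x|Leb a b. \<bar>f x - g x\<bar>) + L1_norm a b (\<lambda>x. g x - v x)"
proof -
  have fg: "integrable (Leb a b) (\<lambda>x. \<bar>f x - g x\<bar>)"
    by (intro integrable_Leb_continuous continuous_on_rabs continuous_on_diff f g)
  have mg: "g \<in> borel_measurable (Leb a b)" by (intro borel_measurable_integrable integrable_Leb_continuous g)
  have "L1_norm a b (\<lambda>x. f x - v x) \<le> (\<integral>\<^sup>+x. ennreal \<bar>f x - g x\<bar> + ennreal \<bar>g x - v x\<bar> \<partial>Leb a b)"
    unfolding L1_norm_def by (intro nn_integral_mono) (simp flip: ennreal_plus)
  also have "\<dots> = (\<integral>\<^sup>+x. ennreal \<bar>f x - g x\<bar> \<partial>Leb a b) + L1_norm a b (\<lambda>x. g x - v x)"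
    unfolding L1_norm_def
    by (intro nn_integral_add measurable_compose[OF _ measurable_ennreal] borel_measurable_integrable[OF fg] borel_measurable_abs borel_measurable_diff mg v)
  also have "(\<integral>\<^sup>+x. ennreal \<bar>f x - g x\<bar> \<partial>Leb a b) = ennreal (LINT x|Leb a b. \<bar>f x - g x\<bar>)"
    by (rule nn_integral_eq_integral[OF fg]) simp
  finally show ?thesis .
qed

lemma no_intermediate_value:
  fixes D :: "real \<Rightarrow> real"
  assumes "0 \<le> T" "continuous_on {0..T} D" "D 0 \<le> \<beta>" "\<beta> < d"
    and gap: "\<And>t. 0 < t \<Longrightarrow> t \<le> T \<Longrightarrow> D t < d \<Longrightarrow> D t \<le> \<beta>"
    and t: "t \<in> {0..T}"
  shows "D t \<le> \<beta>"
proof (rule ccontr)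
  assume "\<not> D t \<le> \<beta>"
  define y where "y = min (D t) ((\<beta> + d) / 2)"
  have y: "\<beta> < y" "y < d" "y \<le> D t" using \<open>\<not> D t \<le> \<beta>\<close> \<open>\<beta> < d\<close> by (auto simp: y_def min_less_iff_disj)
  have "\<exists>s\<ge>0. s \<le> t \<and> D s = y"
    using t y assms by (intro IVT' continuous_on_subset[OF assms(2)]) auto
  then obtain s where s: "0 \<le> s" "s \<le> t" "D s = y" by blast
  then have "s \<noteq> 0" using y assms(3) by auto
  then show False using gap[of s] s y t by auto
qed

lemma (in flux) sup_deriv_Q:
  "deriv Q 0 \<le> (SUP s\<in>{-\<kappa>..\<kappa>}. deriv Q s)"
proof (rule cSUP_upper)
  show "bdd_above (deriv Q ` {-\<kappa>..\<kappa>})"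
    using continuous_on_subset[OF cont_deriv_Q]
    by (intro bounded_imp_bdd_above compact_imp_bounded compact_continuous_image) auto
qed (use kappa_pos in simp)

text \<open>The strict inequality for \<open>A\<close> leaves room to shorten the tails from \<open>r\<close> to \<open>r - \<rho>\<close>, and the rate
  \<open>\<alpha> = A / (2 * (r - \<rho>))\<close> makes the error \<open>exp (- A / \<epsilon>)\<close>. This rate satisfies
  \<open>\<alpha>\<^sup>2 \<le> lam1 / (2 * Qm)\<close>, where \<open>Qm\<close> is the maximum of \<open>deriv Q\<close>. Since \<open>deriv Q 0 \<le> Qm\<close>, the
  requirement of the locale \<open>wells\<close> is met even if \<open>deriv Q\<close> varies by 5 per cent for small slopes:
  \<open>3 / 2 * (21 / 20)\<^sup>3\<close> is less than \<open>2 * (19 / 20)\<^sup>2\<close>.\<close>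

theorem (in reaction_diffusion) exponential_lower_bound:
  assumes st: "step_function a b N h v" and sep: "separation_radius a b N h r"
    and A: "0 < A" "A < r * sqrt (2 * lam1 * inverse (SUP s\<in>{-\<kappa>..\<kappa>}. deriv Q s))"
  obtains C d where "0 \<le> C" "0 < d"
    "\<forall>\<^sub>F \<epsilon> in at_right 0. \<forall>w w'. C1_on_interval a b w w' \<longrightarrow> (\<forall>x\<in>{a..b}. \<bar>\<epsilon>\<^sup>2 * w' x\<bar> \<le> \<kappa>)
       \<longrightarrow> L1_norm a b (\<lambda>x. w x - v x) < ennreal d
       \<longrightarrow> real N * c_min Q F \<kappa> \<epsilon> - C * exp (- A / \<epsilon>) \<le> energy Q F a b \<epsilon> w"
proof -
  define Qm where "Qm = (SUP s\<in>{-\<kappa>..\<kappa>}. deriv Q s)"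
  define q where "q = deriv Q 0"
  have q: "0 < q" "q \<le> Qm" using Q_deriv_pos[of 0] kappa_pos sup_deriv_Q by (simp_all add: q_def Qm_def)
  have r: "0 < r" using sep by (simp add: separation_radius_def)
  define B where "B = sqrt (2 * lam1 / Qm)"
  have B: "0 < B" "B\<^sup>2 = 2 * lam1 / Qm" "A < r * B"
    using q lam_pos A by (simp_all add: B_def Qm_def[symmetric] divide_inverse)
  define \<rho> where "\<rho> = (r - A / B) / 2"
  have AB: "0 < A / B" "A / B < r" using A B by (simp_all add: field_simps)
  have "2 * \<rho> = r - A / B" by (simp add: \<rho>_def)
  with AB have \<rho>: "0 < \<rho>" "\<rho> < r" "A / B < r - \<rho>" by linarith+
  define \<alpha> where "\<alpha> = A / (2 * (r - \<rho>))"
  have \<alpha>: "0 < \<alpha>" "2 * \<alpha> \<le> B" using A \<rho> B by (simp_all add: \<alpha>_def field_simps)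
  have "(2 * \<alpha>)\<^sup>2 \<le> B\<^sup>2" using \<alpha> by (intro power_mono) auto
  then have \<alpha>2: "\<alpha>\<^sup>2 * Qm \<le> lam1 / 2" using B q by (simp add: power_mult_distrib field_simps)
  obtain s0 where s0: "0 < s0" "s0 \<le> \<kappa>"
    "\<And>s. 0 \<le> s \<Longrightarrow> s \<le> s0 \<Longrightarrow> 19/20 * q \<le> deriv Q s \<and> deriv Q s \<le> 21/20 * q"
    using near_linear unfolding q_def by blast
  interpret wells Q \<kappa> F lam1 lam2 \<eta> "19/20 * q" "21/20 * q" s0 "\<eta> / 2" \<alpha>
  proof
    have "3 * \<alpha>\<^sup>2 * (21/20 * q) ^ 3 = 27783 / 8000 * (\<alpha>\<^sup>2 * q) * q\<^sup>2"
      by (simp add: power2_eq_square power3_eq_cube)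
    also have "\<dots> \<le> 27783 / 8000 * (lam1 / 2) * q\<^sup>2"
    proof -
      have "\<alpha>\<^sup>2 * q \<le> \<alpha>\<^sup>2 * Qm" using q by (intro mult_left_mono) auto
      with \<alpha>2 have "\<alpha>\<^sup>2 * q \<le> lam1 / 2" by linarith
      then show ?thesis by (intro mult_right_mono mult_left_mono) auto
    qed
    also have "\<dots> \<le> 361 / 200 * lam1 * q\<^sup>2" using lam_pos by (intro mult_right_mono) auto
    also have "\<dots> = 2 * lam1 * (19/20 * q)\<^sup>2" by (simp add: power2_eq_square)
    finally show "3 * \<alpha>\<^sup>2 * (21/20 * q) ^ 3 \<le> 2 * lam1 * (19/20 * q)\<^sup>2" .
  qed (use q s0 lam_pos \<alpha> in auto)
  define c1 c2 where "c1 = sqrt (19/20 * q * lam1)" and "c2 = sqrt (21/20 * q * lam2)"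
  have c: "0 < c1" "0 < c2" using q lam_pos by (simp_all add: c1_def c2_def)
  \<comment> \<open>The ratio of \<open>\<delta>1\<close> to the radius \<open>\<eta> / 2\<close> of the neighbourhoods of the wells.\<close>
  define x where "x = c1 / (c1 + 2 * c2)"
  have x: "0 < x" "x \<le> 1" "2 * c2 * x \<le> c1" using c by (simp_all add: x_def field_simps)
  have x2: "2 * c2 * x\<^sup>2 \<le> c1"
  proof -
    have "2 * c2 * x\<^sup>2 = 2 * c2 * x * x" by (simp add: power2_eq_square)
    also have "\<dots> \<le> 2 * c2 * x * 1" using x c by (intro mult_left_mono) auto
    finally show ?thesis using x(3) by simp
  qed
  define \<delta>1 where "\<delta>1 = \<eta> / 2 * x"
  have \<delta>1: "0 < \<delta>1" "\<delta>1 \<le> \<eta> / 2" "2 * c2 * \<delta>1\<^sup>2 \<le> c1 * (\<eta> / 2)\<^sup>2"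
  proof -
    have "2 * c2 * \<delta>1\<^sup>2 = 2 * c2 * x\<^sup>2 * (\<eta> / 2)\<^sup>2" by (simp only: \<delta>1_def power_mult_distrib mult_ac)
    also have "\<dots> \<le> c1 * (\<eta> / 2)\<^sup>2" using x2 by (rule mult_right_mono) simp
    finally show "2 * c2 * \<delta>1\<^sup>2 \<le> c1 * (\<eta> / 2)\<^sup>2" .
  qed (use x lam_pos in \<open>simp_all add: \<delta>1_def mult_left_le\<close>)
  have "bounded (F ` {-(1 + \<eta> / 2)..1 + \<eta> / 2})"
    by (intro compact_imp_bounded compact_continuous_image cont_F) simp
  then obtain M where M': "\<forall>y\<in>F ` {-(1 + \<eta> / 2)..1 + \<eta> / 2}. norm y \<le> M"
    unfolding bounded_iff by blast
  have M: "F s \<le> M" if "s \<in> {-(1 + \<eta> / 2)..1 + \<eta> / 2}" for s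
    using bspec[OF M' imageI[OF that]] by simp
  have "((\<lambda>\<epsilon>. \<epsilon>\<^sup>2 * M) \<longlongrightarrow> 0\<^sup>2 * M) (at_right 0)" by (intro tendsto_intros)
  moreover have "0 < legendre Q s0" using legendre_strict_mono[of 0 s0] s0 by simp
  ultimately have "\<forall>\<^sub>F \<epsilon> in at_right 0. \<epsilon>\<^sup>2 * M < legendre Q s0" by (intro order_tendstoD(2)) auto
  then have "\<forall>\<^sub>F \<epsilon> in at_right 0. \<forall>w w'. C1_on_interval a b w w' \<longrightarrow> (\<forall>x\<in>{a..b}. \<bar>\<epsilon>\<^sup>2 * w' x\<bar> \<le> \<kappa>)
       \<longrightarrow> L1_norm a b (\<lambda>x. w x - v x) < ennreal (\<delta>1 * \<rho>)
       \<longrightarrow> real N * c_min Q F \<kappa> \<epsilon> - (real N * (2 * (c2 * \<delta>1\<^sup>2))) * exp (- A / \<epsilon>) \<le> energy Q F a b \<epsilon> w"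
    using eventually_at_right_less[of 0]
  proof eventually_elim
    case (elim \<epsilon>)
    have F_le: "\<epsilon>\<^sup>2 * F s \<le> legendre Q s0" if "s \<in> {-(1 + \<eta> / 2)..1 + \<eta> / 2}" for s
    proof -
      have "\<epsilon>\<^sup>2 * F s \<le> \<epsilon>\<^sup>2 * M" by (intro mult_left_mono M that) simp
      then show ?thesis using elim(1) by linarith
    qed
    have sm: "small \<epsilon>" unfolding small_def
    proof (intro conjI ballI allI impI)
      fix \<sigma> s :: real assume "\<sigma> \<in> {1, -1}" "\<bar>s - \<sigma>\<bar> \<le> \<eta> / 2"
      then have "- (1 + \<eta> / 2) \<le> s" "s \<le> 1 + \<eta> / 2" using lam_pos unfolding abs_le_iff by auto
      then show "\<epsilon>\<^sup>2 * F s \<le> legendre Q s0" by (intro F_le) simp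
    qed (use elim in simp)
    have F1: "\<epsilon>\<^sup>2 * F s \<le> legendre Q \<kappa>" if "s \<in> {-1..1}" for s
      using F_le[of s] that lam_pos legendre_mono[of s0 \<kappa>] s0 by auto
    have ex: "- 2 * \<alpha> * (r - \<rho>) / \<epsilon> = - A / \<epsilon>" 
    proof -
      have "\<alpha> * (2 * (r - \<rho>)) = A" using \<rho> unfolding \<alpha>_def by (intro nonzero_eq_divide_eq[THEN iffD1]) auto
      then have "- 2 * \<alpha> * (r - \<rho>) = - A" by (simp add: algebra_simps)
      then show ?thesis by (simp only:)
    qed
    show ?case
    proof (intro allI impI)
      fix w w' assume w: "C1_on_interval a b w w'" and bd: "\<forall>x\<in>{a..b}. \<bar>\<epsilon>\<^sup>2 * w' x\<bar> \<le> \<kappa>"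
        and L1: "L1_norm a b (\<lambda>x. w x - v x) < ennreal (\<delta>1 * \<rho>)"
      have "real N * (c_min Q F \<kappa> \<epsilon> - 2 * (sqrt (21/20 * q * lam2) * \<delta>1\<^sup>2) * exp (- 2 * \<alpha> * (r - \<rho>) / \<epsilon>))
          \<le> integral {a..b} (\<lambda>x. edens \<epsilon> (w' x) (w x))"
        by (rule energy_lower_bound[OF st sep sm F1 \<delta>1(1,2) \<delta>1(3)[unfolded c1_def c2_def] \<rho>(1,2) w _ L1]) (use bd in auto)
      then show "real N * c_min Q F \<kappa> \<epsilon> - (real N * (2 * (c2 * \<delta>1\<^sup>2))) * exp (- A / \<epsilon>) \<le> energy Q F a b \<epsilon> w"
        unfolding energy_eq(2)[OF w] ex c2_def by (simp add: algebra_simps)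
    qed
  qed
  moreover have "0 \<le> real N * (2 * (c2 * \<delta>1\<^sup>2))" "0 < \<delta>1 * \<rho>" using c \<delta>1(1) \<rho>(1) by simp_all
  ultimately show thesis using that by blast
qed

lemma (in reaction_diffusion) L1_drift:
  assumes ab: "a < b" and eps: "0 < \<epsilon>" and sol: "is_solution Q F \<kappa> a b \<epsilon> u0 u"
  obtains ux where "\<And>t. 0 \<le> t \<Longrightarrow> C1_on_interval a b (u t) (ux t)"
    "\<And>t x. 0 \<le> t \<Longrightarrow> x \<in> {a..b} \<Longrightarrow> \<bar>\<epsilon>\<^sup>2 * ux t x\<bar> \<le> \<kappa>"
    "\<And>T. 0 < T \<Longrightarrow> continuous_on {0..T} (\<lambda>t. LINT x|Leb a b. \<bar>u t x - u 0 x\<bar>)"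
    "\<And>T. 0 < T \<Longrightarrow> (LINT x|Leb a b. \<bar>u T x - u 0 x\<bar>)\<^sup>2
      \<le> (b - a) * (\<epsilon> * T * (energy Q F a b \<epsilon> (u 0) - energy Q F a b \<epsilon> (u T)))"
proof -
  obtain ux ut where
    H: "\<And>T. 0 < T \<Longrightarrow> C_into_H 2 a b {0..T} u \<and> C1_into_H 1 a b {0..T} u ut"
    and C1: "\<And>t. 0 \<le> t \<Longrightarrow> C1_on_interval a b (u t) (ux t)"
    and pde: "\<And>t. 0 < t \<Longrightarrow> AE x in lebesgue_on {a<..<b}.
             ut t x = weak_deriv a b (\<lambda>y. Q (\<epsilon>\<^sup>2 * ux t y)) x - deriv F (u t x)"
    and bc: "\<And>t. 0 < t \<Longrightarrow> ux t a = 0 \<and> ux t b = 0"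
    and sl: "\<And>t x. 0 \<le> t \<Longrightarrow> x \<in> {a..b} \<Longrightarrow> \<bar>ux t x\<bar> \<le> \<kappa> / \<epsilon>\<^sup>2"
    using sol unfolding is_solution_def by blast
  have slope: "\<bar>\<epsilon>\<^sup>2 * ux t x\<bar> \<le> \<kappa>" if "0 \<le> t" "x \<in> {a..b}" for t x
    using sl[OF that] eps by (simp add: abs_mult field_simps)
  have cu: "continuous_on {a..b} (u t)" if "0 \<le> t" for t
    using abs_cont_continuous[OF abs_cont_C1[OF C1[OF that]]] .
  show thesis
  proof (rule that[of ux, OF C1 slope])
    fix T :: real assume T: "0 < T"
    show "continuous_on {0..T} (\<lambda>t. LINT x|Leb a b. \<bar>u t x - u 0 x\<bar>)"
      by (rule L1_distance_continuous[OF ab C1 _ cu]) (use H[OF T] in auto)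
    have "in_L2 a b (\<lambda>x. u T x - u 0 x)"
      using T by (intro in_L2_continuous continuous_on_diff cu) auto
    from L1_le_L2[OF ab this]
    have "(LINT x|Leb a b. \<bar>u T x - u 0 x\<bar>)\<^sup>2 \<le> (b - a) * (LINT x|Leb a b. (u T x - u 0 x)\<^sup>2)" .
    also have "\<dots> \<le> (b - a) * (\<epsilon> * T * (energy Q F a b \<epsilon> (u 0) - energy Q F a b \<epsilon> (u T)))"
    proof (rule mult_left_mono)
      show "(LINT x|Leb a b. (u T x - u 0 x)\<^sup>2) \<le> \<epsilon> * T * (energy Q F a b \<epsilon> (u 0) - energy Q F a b \<epsilon> (u T))"
        by (rule energy_dissipation[where ux = ux and ut = ut, OF ab eps T])
           (use C1 slope H[OF T] pde bc in \<open>auto simp: C_into_H_def\<close>)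
    qed (use ab in simp)
    finally show "(LINT x|Leb a b. \<bar>u T x - u 0 x\<bar>)\<^sup>2
      \<le> (b - a) * (\<epsilon> * T * (energy Q F a b \<epsilon> (u 0) - energy Q F a b \<epsilon> (u T)))" .
  qed
qed

theorem theorem1:
  fixes Q F v :: "real \<Rightarrow> real"
    and a b \<kappa> \<theta> lam1 lam2 \<eta> r A m :: real
    and N :: nat and h :: "nat \<Rightarrow> real"
    and u0 :: "real \<Rightarrow> real \<Rightarrow> real"
    and u :: "real \<Rightarrow> real \<Rightarrow> real \<Rightarrow> real"
  assumes "a < b"
    and "admissible_flux Q \<kappa>"
    and "admissible_potential F \<theta> lam1 lam2 \<eta>"
    and "\<theta> = 2"
    and "step_function a b N h v"
    and "separation_radius a b N h r"
    and "0 < A" and "A < r * sqrt (2 * lam1 * inverse (SUP s\<in>{-\<kappa>..\<kappa>}. deriv Q s))"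
    and "\<forall>\<^sub>F \<epsilon> in at_right 0. is_solution Q F \<kappa> a b \<epsilon> (u0 \<epsilon>) (u \<epsilon>)"
    and "((\<lambda>\<epsilon>. L1_norm a b (\<lambda>x. u0 \<epsilon> x - v x)) \<longlongrightarrow> 0) (at_right 0)"
    and "\<exists>C>0. \<exists>\<epsilon>0>0. \<forall>\<epsilon>\<in>{0<..<\<epsilon>0}.
           energy Q F a b \<epsilon> (u0 \<epsilon>) \<le> real N * c_min Q F \<kappa> \<epsilon> + C * exp (- A / \<epsilon>)"
    and "m > 0"
  shows "((\<lambda>\<epsilon>. SUP t\<in>{0..m * exp (A / \<epsilon>)}. L1_norm a b (\<lambda>x. u \<epsilon> t x - v x)) \<longlongrightarrow> 0)
           (at_right 0)"
proof -
  interpret reaction_diffusion Q \<kappa> F lam1 lam2 \<eta>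
    using assms(2,3,4) by unfold_locales simp_all
  note ab = assms(1) and st = assms(5) and lim0 = assms(10)
  obtain C1 \<epsilon>0 where C1: "0 < C1" "0 < \<epsilon>0"
    "\<And>\<epsilon>. \<epsilon> \<in> {0<..<\<epsilon>0} \<Longrightarrow> energy Q F a b \<epsilon> (u0 \<epsilon>) \<le> real N * c_min Q F \<kappa> \<epsilon> + C1 * exp (- A / \<epsilon>)"
    using assms(11) by blast
  obtain C2 d where C2: "0 \<le> C2" "0 < d" and lower:
    "\<forall>\<^sub>F \<epsilon> in at_right 0. \<forall>w w'. C1_on_interval a b w w' \<longrightarrow> (\<forall>x\<in>{a..b}. \<bar>\<epsilon>\<^sup>2 * w' x\<bar> \<le> \<kappa>)
       \<longrightarrow> L1_norm a b (\<lambda>x. w x - v x) < ennreal d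
       \<longrightarrow> real N * c_min Q F \<kappa> \<epsilon> - C2 * exp (- A / \<epsilon>) \<le> energy Q F a b \<epsilon> w"
    by (rule exponential_lower_bound[OF st assms(6-8)])
  define K where "K = (b - a) * m * (C1 + C2)"
  define \<beta> where "\<beta> \<epsilon> = sqrt (K * \<epsilon>)" for \<epsilon>
  have "((\<lambda>\<epsilon>. sqrt (K * \<epsilon>)) \<longlongrightarrow> sqrt (K * 0)) (at_right 0)" by (intro tendsto_intros)
  then have \<beta>_lim: "(\<beta> \<longlongrightarrow> 0) (at_right 0)" by (simp add: \<beta>_def[abs_def])
  have K: "0 \<le> K" using ab C1 C2 assms(12) by (simp add: K_def)
  have bound: "\<forall>\<^sub>F \<epsilon> in at_right 0. (SUP t\<in>{0..m * exp (A / \<epsilon>)}. L1_norm a b (\<lambda>x. u \<epsilon> t x - v x))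
      \<le> ennreal (\<beta> \<epsilon>) + L1_norm a b (\<lambda>x. u0 \<epsilon> x - v x)"
  proof -
    have "\<forall>\<^sub>F \<epsilon> in at_right 0. \<epsilon> \<in> {0<..<\<epsilon>0}" using C1(2) by (intro eventually_at_rightI[of 0 \<epsilon>0]) auto
    moreover have "\<forall>\<^sub>F \<epsilon> in at_right 0. \<beta> \<epsilon> < d / 2" using \<beta>_lim C2 by (intro order_tendstoD(2)) auto
    moreover have "\<forall>\<^sub>F \<epsilon> in at_right 0. L1_norm a b (\<lambda>x. u0 \<epsilon> x - v x) < ennreal (d / 2)"
      using lim0 C2 by (intro order_tendstoD(2)) auto
    ultimately show ?thesis using assms(9) lower
    proof eventually_elim
      case (elim \<epsilon>)
      have eps: "0 < \<epsilon>" using elim(1) by simp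
      obtain ux where C1u: "\<And>t. 0 \<le> t \<Longrightarrow> C1_on_interval a b (u \<epsilon> t) (ux t)"
        and slope: "\<And>t x. 0 \<le> t \<Longrightarrow> x \<in> {a..b} \<Longrightarrow> \<bar>\<epsilon>\<^sup>2 * ux t x\<bar> \<le> \<kappa>"
        and cont: "\<And>T. 0 < T \<Longrightarrow> continuous_on {0..T} (\<lambda>t. LINT x|Leb a b. \<bar>u \<epsilon> t x - u \<epsilon> 0 x\<bar>)"
        and drift: "\<And>T. 0 < T \<Longrightarrow> (LINT x|Leb a b. \<bar>u \<epsilon> T x - u \<epsilon> 0 x\<bar>)\<^sup>2
          \<le> (b - a) * (\<epsilon> * T * (energy Q F a b \<epsilon> (u \<epsilon> 0) - energy Q F a b \<epsilon> (u \<epsilon> T)))"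
        by (rule L1_drift[OF ab eps elim(4)]) blast
      have init: "u \<epsilon> 0 x = u0 \<epsilon> x" if "x \<in> {a..b}" for x using elim(4) that by (auto simp: is_solution_def)
      have cu: "continuous_on {a..b} (u \<epsilon> t)" if "0 \<le> t" for t
        using abs_cont_continuous[OF abs_cont_C1[OF C1u[OF that]]] .
      have L0: "L1_norm a b (\<lambda>x. u \<epsilon> 0 x - v x) = L1_norm a b (\<lambda>x. u0 \<epsilon> x - v x)"
        by (rule L1_norm_cong) (simp add: init)
      have E0: "energy Q F a b \<epsilon> (u \<epsilon> 0) \<le> real N * c_min Q F \<kappa> \<epsilon> + C1 * exp (- A / \<epsilon>)"
        using C1(3)[OF elim(1)] energy_cong[of a b "u \<epsilon> 0" "u0 \<epsilon>"] init by simp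
      define D where "D t = (LINT x|Leb a b. \<bar>u \<epsilon> t x - u \<epsilon> 0 x\<bar>)" for t
      have tri: "L1_norm a b (\<lambda>x. u \<epsilon> t x - v x) \<le> ennreal (D t) + L1_norm a b (\<lambda>x. u0 \<epsilon> x - v x)" if "0 \<le> t" for t
        using L1_norm_triangle[OF cu[OF that] cu[OF order_refl] step_function_measurable[OF st]] by (simp add: D_def L0)
      define T where "T = m * exp (A / \<epsilon>)"
      have T: "0 < T" using assms(12) by (simp add: T_def)
      have "D t \<le> \<beta> \<epsilon>" if "t \<in> {0..T}" for t
      proof (rule no_intermediate_value[where D = D and T = T and d = "d / 2"])
        show "0 \<le> T" using T by simp
        show "continuous_on {0..T} D" using cont[OF T] by (simp add: D_def[abs_def])
        show "D 0 \<le> \<beta> \<epsilon>" using K eps by (simp add: D_def \<beta>_def)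
        show "\<beta> \<epsilon> < d / 2" by (rule elim(2))
        show "t \<in> {0..T}" by (rule that)
        fix t assume t: "0 < t" "t \<le> T" "D t < d / 2"
        have D0: "0 \<le> D t" unfolding D_def by (rule Bochner_Integration.integral_nonneg) simp
        have "L1_norm a b (\<lambda>x. u \<epsilon> t x - v x) \<le> ennreal (D t) + L1_norm a b (\<lambda>x. u0 \<epsilon> x - v x)"
          using t(1) by (intro tri) simp
        also have "\<dots> < ennreal (D t) + ennreal (d / 2)"
          using elim(3) by (simp add: ennreal_add_left_cancel_less)
        also have "\<dots> \<le> ennreal d" using t(3) D0 C2 by (simp flip: ennreal_plus)
        finally have "real N * c_min Q F \<kappa> \<epsilon> - C2 * exp (- A / \<epsilon>) \<le> energy Q F a b \<epsilon> (u \<epsilon> t)"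
          using elim(5) C1u[of t] slope[of t] t(1) by auto
        with E0 have dE: "energy Q F a b \<epsilon> (u \<epsilon> 0) - energy Q F a b \<epsilon> (u \<epsilon> t) \<le> (C1 + C2) * exp (- A / \<epsilon>)"
          by (simp add: algebra_simps)
        have "(D t)\<^sup>2 \<le> (b - a) * (\<epsilon> * t * (energy Q F a b \<epsilon> (u \<epsilon> 0) - energy Q F a b \<epsilon> (u \<epsilon> t)))"
          unfolding D_def by (rule drift[OF t(1)])
        also have "\<dots> \<le> (b - a) * (\<epsilon> * t * ((C1 + C2) * exp (- A / \<epsilon>)))"
          using ab eps t(1) dE by (intro mult_left_mono) auto
        also have "\<dots> \<le> (b - a) * (\<epsilon> * T * ((C1 + C2) * exp (- A / \<epsilon>)))"
          using ab eps t C1 C2 by (intro mult_left_mono mult_right_mono) auto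
        also have "\<dots> = K * \<epsilon> * (exp (A / \<epsilon>) * exp (- A / \<epsilon>))" by (simp add: T_def K_def)
        also have "exp (A / \<epsilon>) * exp (- A / \<epsilon>) = 1" by (simp flip: exp_add)
        finally show "D t \<le> \<beta> \<epsilon>" unfolding \<beta>_def by (intro real_le_rsqrt) simp
      qed
      then have "ennreal (D t) + L1_norm a b (\<lambda>x. u0 \<epsilon> x - v x) \<le> ennreal (\<beta> \<epsilon>) + L1_norm a b (\<lambda>x. u0 \<epsilon> x - v x)"
        if "t \<in> {0..T}" for t
        using that by (intro add_right_mono ennreal_leI)
      then have "L1_norm a b (\<lambda>x. u \<epsilon> t x - v x) \<le> ennreal (\<beta> \<epsilon>) + L1_norm a b (\<lambda>x. u0 \<epsilon> x - v x)" if "t \<in> {0..T}" for t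
        using order_trans[OF tri[of t]] that by simp
      then show ?case unfolding T_def by (rule SUP_least)
    qed
  qed
  have "((\<lambda>\<epsilon>. ennreal (\<beta> \<epsilon>) + L1_norm a b (\<lambda>x. u0 \<epsilon> x - v x)) \<longlongrightarrow> ennreal 0 + 0) (at_right 0)"
    by (intro tendsto_add tendsto_ennrealI \<beta>_lim lim0)
  then have upper: "((\<lambda>\<epsilon>. ennreal (\<beta> \<epsilon>) + L1_norm a b (\<lambda>x. u0 \<epsilon> x - v x)) \<longlongrightarrow> 0) (at_right 0)" by simp
  show ?thesis
    by (rule tendsto_sandwich[OF _ bound tendsto_const upper]) simp
qed


end
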